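(* Let $N$ be a compact complex space form (a Kähler manifold of constant holomorphic sectional curvature) and let $\phi:S^2\to N$ be a harmonic map from the $2$-sphere. Then any Jacobi field $v$ along $\phi$ preserves complex isotropy to first order, i.e. $j^{\mathbf C}_{r,s}(v)=0$ for all integers $r,s\ge1$ and all local complex coordinates on $S^2$; equivalently, any smooth variation $\{\phi_t\}$ of $\phi$ tangent to a Jacobi field is complex isotropic to first order.
   Context: All manifolds and maps are smooth ($C^\infty$); manifolds are compact without boundary. $S^2$ carries its standard Riemann surface structure (and any Riemannian metric compatible with it; harmonicity and the Jacobi condition below do not depend on this choice). A vector field along $\phi:M\to N$ is a smooth section of $\phi^{-1}TN$. $\nabla$ denotes the connections induced by the Levi-Civita connections. The tension field is $\tau(\phi)=\mathrm{Trace}\,\nabla d\phi$, and $\phi$ is harmonic if $\tau(\phi)=0$. For $\phi$ harmonic, the Jacobi operator is $J_\phi(v)=\Delta v-\mathrm{Trace}\,R^N(d\phi,v)d\phi$, where $\Delta=-\mathrm{Trace}\,\nabla^2$ on $\phi^{-1}TN$ and the curvature sign convention is $R(X,Y)=-[\nabla_X,\nabla_Y]+\nabla_{[X,Y]}$. A Jacobi field along $\phi$ is a vector field $v$ along $\phi$ with $J_\phi(v)=0$. A smooth variation $\{\phi_t\}$ of $\phi$ is a smooth map $M\times I\to N$, $(x,t)\mapsto\phi_t(x)$, with $I\ni 0$ an open interval and $\phi_0=\phi$; it is tangent to $v$ if $v=\frac{\partial\phi_t}{\partial t}\big|_{t=0}$. Let $\langle\ ,\ \rangle^{\mathbf C}$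 be the complex-bilinear extension of the metric of $N$ to $T^{c}N=TN\otimes_{\mathbb R}\mathbb C=T'N\oplus T''N$ (decomposition into $(1,0)$ and $(0,1)$ parts), and let $\langle v,w\rangle^{\mathrm{Herm}}=\langle v,\overline w\rangle^{\mathbf C}$ be the Hermitian extension. For a smooth map $\phi$ from a Riemann surface $M$ with local complex coordinate $z$, let $\frac{\partial\phi}{\partial z}$ and $\frac{\partial\phi}{\partial\bar z}$ denote the $T'N$-components of $d^{c}\phi(\frac{\partial}{\partial z})$ and $d^{c}\phi(\frac{\partial}{\partial\bar z})$, where $d^{c}\phi$ is the complex-linear extension of $d\phi$. Extend $\nabla$ complex-linearly, put $\frac{\nabla}{\partial z}=\nabla_{\partial/\partial z}$, $\frac{\nabla}{\partial\bar z}=\nabla_{\partial/\partial\bar z}$, with $k$-fold iterates $\frac{\nabla^k}{\partial z^k}$, $\frac{\nabla^k}{\partial\bar z^k}$. For integers $r,s\ge1$ set $$\eta^{\mathbf C}_{r,s}(\phi)=\left\langle\frac{\nabla^{r-1}}{\partial z^{r-1}}\frac{\partial\phi}{\partial z},\frac{\nabla^{s-1}}{\partial\bar z^{s-1}}\frac{\partial\phi}{\partial\bar z}\right\rangle^{\mathrm{Herm}},$$ $$j^{\mathbf C}_{r,s}(v)=\left\langle\frac{\nabla^{r}v}{\partial z^{r}},\frac{\nabla^{s-1}}{\partial\bar z^{s-1}}\frac{\partial\phi}{\partial\bar z}\right\rangle^{\mathrm{Herm}}+\left\langle\frac{\nabla^{r-1}}{\partial z^{r-1}}\frac{\partial\phi}{\partial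 z},\frac{\nabla^{s}v}{\partial\bar z^{s}}\right\rangle^{\mathrm{Herm}}.$$ The variation $\{\phi_t\}$ is complex isotropic to first order if, for all $r,s\ge1$ and every local complex coordinate, $\eta^{\mathbf C}_{r,s}(\phi)=0$ and $\frac{\partial}{\partial t}\big|_{t=0}\eta^{\mathbf C}_{r,s}(\phi_t)=0$. *)

theory Defs
  imports "HOL-Analysis.Analysis"
begin

section \<open>Smooth maps between open subsets of Euclidean spaces\<close>

abbreviation Dif :: "('a::euclidean_space \<Rightarrow> 'b::real_normed_vector) \<Rightarrow> 'a \<Rightarrow> 'a \<Rightarrow> 'b" where
  "Dif f x \<equiv> frechet_derivative f (at x)"

text \<open>\<open>Ck_on k f S\<close> and \<open>smooth_on f S\<close> are only meant for open \<open>S\<close>.\<close>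

primrec Ck_on :: "nat \<Rightarrow> ('a::euclidean_space \<Rightarrow> 'b::real_normed_vector) \<Rightarrow> 'a set \<Rightarrow> bool" where
  "Ck_on 0 f S \<longleftrightarrow> continuous_on S f"
| "Ck_on (Suc k) f S \<longleftrightarrow> f differentiable_on S \<and> (\<forall>b\<in>Basis. Ck_on k (\<lambda>x. Dif f x b) S)"

definition smooth_on :: "('a::euclidean_space \<Rightarrow> 'b::real_normed_vector) \<Rightarrow> 'a set \<Rightarrow> bool" where
  "smooth_on f S \<longleftrightarrow> (\<forall>k. Ck_on k f S)"


section \<open>Complex manifolds\<close>

text \<open>A manifold is a subset \<open>M\<close> of a Hausdorff space with the subspace topology, and an atlas
  \<open>A\<close> of charts \<open>(U, \<kappa>)\<close> with values in a Euclidean space \<open>'a\<close>. The complex structure of the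
  model space \<open>'a\<close> is the linear map \<open>J\<close> (multiplication by \<open>\<i>\<close>); a smooth map between open
  subsets of \<open>'a\<close> is holomorphic iff its derivatives commute with \<open>J\<close>.\<close>

type_synonym ('m, 'a) chart = "'m set \<times> ('m \<Rightarrow> 'a)"

definition chart_on :: "'m::t2_space set \<Rightarrow> ('m, 'a::euclidean_space) chart \<Rightarrow> bool" where
  "chart_on M c \<longleftrightarrow> openin (top_of_set M) (fst c) \<and> open (snd c ` fst c) \<and>
     homeomorphism (fst c) (snd c ` fst c) (snd c) (inv_into (fst c) (snd c))"

definition transition :: "('m, 'a) chart \<Rightarrow> ('m, 'a) chart \<Rightarrow> 'a \<Rightarrow> 'a" where
  "transition c d = snd d \<circ> inv_into (fst c) (snd c)"

definition holo_compatible ::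
  "('a \<Rightarrow> 'a) \<Rightarrow> ('m, 'a::euclidean_space) chart \<Rightarrow> ('m, 'a) chart \<Rightarrow> bool" where
  "holo_compatible J c d \<longleftrightarrow>
     smooth_on (transition c d) (snd c ` (fst c \<inter> fst d)) \<and>
     (\<forall>q \<in> snd c ` (fst c \<inter> fst d). \<forall>X.
        Dif (transition c d) q (J X) = J (Dif (transition c d) q X))"

definition complex_atlas ::
  "('a \<Rightarrow> 'a) \<Rightarrow> 'm::t2_space set \<Rightarrow> ('m, 'a::euclidean_space) chart set \<Rightarrow> bool" where
  "complex_atlas J M A \<longleftrightarrow> (\<forall>c\<in>A. chart_on M c) \<and> (\<Union>c\<in>A. fst c) = M \<and>
     (\<forall>c\<in>A. \<forall>d\<in>A. holo_compatible J c d)"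

definition max_complex_atlas ::
  "('a \<Rightarrow> 'a) \<Rightarrow> 'm::t2_space set \<Rightarrow> ('m, 'a::euclidean_space) chart set \<Rightarrow> ('m, 'a) chart set" where
  "max_complex_atlas J M A =
     {c. chart_on M c \<and> (\<forall>d\<in>A. holo_compatible J c d \<and> holo_compatible J d c)}"

definition S2 :: "(real^3) set" where
  "S2 = sphere 0 1"

text \<open>The second stereographic chart is conjugated, so that the transition map is \<open>z \<mapsto> 1/z\<close>.\<close>

definition stereographic_charts :: "(real^3, complex) chart set" where
  "stereographic_charts =
     {(S2 - {x. x$3 = 1}, \<lambda>x. Complex (x$1 / (1 - x$3)) (x$2 / (1 - x$3))),
      (S2 - {x. x$3 = - 1}, \<lambda>x. Complex (x$1 / (1 + x$3)) (- x$2 / (1 + x$3)))}"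

text \<open>All local complex coordinates on the Riemann sphere.\<close>

definition S2_coords :: "(real^3, complex) chart set" where
  "S2_coords = max_complex_atlas ((*) \<i>) S2 stereographic_charts"


section \<open>Riemannian metrics, Levi-Civita connection, curvature\<close>

text \<open>\<open>g c q\<close> is the metric at the point with coordinates \<open>q\<close> in the chart \<open>c\<close>.\<close>

type_synonym ('m, 'a) metric = "('m, 'a) chart \<Rightarrow> 'a \<Rightarrow> 'a \<Rightarrow> 'a \<Rightarrow> real"

definition riemannian_metric ::
  "('m, 'a::euclidean_space) chart set \<Rightarrow> ('m, 'a) metric \<Rightarrow> bool" where
  "riemannian_metric A g \<longleftrightarrow>
     (\<forall>c\<in>A. \<forall>q \<in> snd c ` fst c. bilinear (g c q) \<and> (\<forall>X Y. g c q X Y = g c q Y X) \<and>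
        (\<forall>X. X \<noteq> 0 \<longrightarrow> g c q X X > 0)) \<and>
     (\<forall>c\<in>A. \<forall>X Y. smooth_on (\<lambda>q. g c q X Y) (snd c ` fst c)) \<and>
     (\<forall>c\<in>A. \<forall>d\<in>A. \<forall>q \<in> snd c ` (fst c \<inter> fst d). \<forall>X Y.
        g c q X Y =
        g d (transition c d q) (Dif (transition c d) q X) (Dif (transition c d) q Y))"

text \<open>In complex dimension one, the Hermitian metrics are exactly the Riemannian metrics that are
  compatible with (conformal for) the complex structure.\<close>

definition hermitian_metric ::
  "('a \<Rightarrow> 'a) \<Rightarrow> ('m, 'a::euclidean_space) chart set \<Rightarrow> ('m, 'a) metric \<Rightarrow> bool" where
  "hermitian_metric J A g \<longleftrightarrow> riemannian_metric A g \<and>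
     (\<forall>c\<in>A. \<forall>q \<in> snd c ` fst c. \<forall>X Y. g c q (J X) (J Y) = g c q X Y)"

text \<open>From here on a metric is given on an open subset of the model space, as
  \<open>g :: 'a \<Rightarrow> 'a \<Rightarrow> 'a \<Rightarrow> real\<close>. The Christoffel symbols are given by the Koszul formula for
  constant vector fields (which commute).\<close>

definition christoffel ::
  "('a \<Rightarrow> 'a \<Rightarrow> 'a \<Rightarrow> real) \<Rightarrow> 'a \<Rightarrow> 'a \<Rightarrow> 'a \<Rightarrow> 'a::euclidean_space" where
  "christoffel g q X Y = (THE W. \<forall>Z. g q W Z =
     (Dif (\<lambda>p. g p Y Z) q X + Dif (\<lambda>p. g p X Z) q Y - Dif (\<lambda>p. g p X Y) q Z) / 2)"

text \<open>Covariant derivative in the direction \<open>X\<close>, at \<open>\<zeta>\<close>, of a section \<open>W\<close> of the pull-back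
  by \<open>F\<close> of the tangent bundle, for the connection induced by the Levi-Civita connection of \<open>g\<close>.\<close>

definition cov :: "('b \<Rightarrow> 'b \<Rightarrow> 'b \<Rightarrow> real) \<Rightarrow> ('a \<Rightarrow> 'b) \<Rightarrow> 'a \<Rightarrow> ('a \<Rightarrow> 'b) \<Rightarrow>
    'a::euclidean_space \<Rightarrow> 'b::euclidean_space" where
  "cov g F X W \<zeta> = Dif W \<zeta> X + christoffel g (F \<zeta>) (Dif F \<zeta> X) (W \<zeta>)"

text \<open>The sign convention is \<open>R(X,Y) = -[\<nabla>\<^sub>X,\<nabla>\<^sub>Y] + \<nabla>\<^bsub>[X,Y]\<^esub>\<close>; the bracket vanishes for
  constant \<open>X\<close> and \<open>Y\<close>. Since \<open>R\<close> is a tensor, \<open>Z\<close> may be taken constant as well.\<close>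

definition curv ::
  "('a \<Rightarrow> 'a \<Rightarrow> 'a \<Rightarrow> real) \<Rightarrow> 'a \<Rightarrow> 'a \<Rightarrow> 'a \<Rightarrow> 'a \<Rightarrow> 'a::euclidean_space" where
  "curv g q X Y Z =
     - (cov g id X (cov g id Y (\<lambda>_. Z)) q - cov g id Y (cov g id X (\<lambda>_. Z)) q)"

text \<open>With the above sign of \<open>R\<close>, the round sphere has positive sectional curvature.\<close>

definition sec_curv :: "('a \<Rightarrow> 'a \<Rightarrow> 'a \<Rightarrow> real) \<Rightarrow> 'a \<Rightarrow> 'a \<Rightarrow> 'a::euclidean_space \<Rightarrow> real" where
  "sec_curv g q X Y = g q (curv g q X Y X) Y / (g q X X * g q Y Y - (g q X Y)\<^sup>2)"

text \<open>Trace of a bilinear map with respect to an inner product \<open>h\<close>, i.e. \<open>h\<^sup>i\<^sup>j B(e\<^sub>i, e\<^sub>j)\<close>.\<close>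

definition sharp :: "('a \<Rightarrow> 'a \<Rightarrow> real) \<Rightarrow> 'a \<Rightarrow> 'a::euclidean_space" where
  "sharp h b = (THE W. \<forall>Y. h W Y = b \<bullet> Y)"

definition metric_trace ::
  "('a::euclidean_space \<Rightarrow> 'a \<Rightarrow> real) \<Rightarrow> ('a \<Rightarrow> 'a \<Rightarrow> 'b) \<Rightarrow> 'b::real_vector" where
  "metric_trace h B = (\<Sum>b\<in>Basis. B b (sharp h b))"


section \<open>Complex space forms\<close>

abbreviation JC :: "complex^'n \<Rightarrow> complex^'n" where
  "JC \<equiv> (*s) \<i>"

text \<open>The last clause is \<open>d\<omega> = 0\<close> for the fundamental form \<open>\<omega>(X,Y) = g(JX,Y)\<close>, evaluated on
  constant vector fields.\<close>

definition kaehler_manifold ::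
  "'p::t2_space set \<Rightarrow> ('p, complex^'n) chart set \<Rightarrow> ('p, complex^'n) metric \<Rightarrow> bool" where
  "kaehler_manifold N A g \<longleftrightarrow> complex_atlas JC N A \<and> hermitian_metric JC A g \<and>
     (\<forall>d\<in>A. \<forall>q \<in> snd d ` fst d. \<forall>X Y Z.
        Dif (\<lambda>p. g d p (JC Y) Z) q X + Dif (\<lambda>p. g d p (JC Z) X) q Y +
        Dif (\<lambda>p. g d p (JC X) Y) q Z = 0)"

definition complex_space_form ::
  "'p::t2_space set \<Rightarrow> ('p, complex^'n) chart set \<Rightarrow> ('p, complex^'n) metric \<Rightarrow> bool" where
  "complex_space_form N A g \<longleftrightarrow> kaehler_manifold N A g \<and>
     (\<exists>\<kappa>. \<forall>d\<in>A. \<forall>q \<in> snd d ` fst d. \<forall>X. X \<noteq> 0 \<longrightarrow> sec_curv (g d) q X (JC X) = \<kappa>)"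


section \<open>Smooth maps, vector fields along maps, variations\<close>

text \<open>Coordinate expression of \<open>\<phi>\<close> in charts \<open>c\<close> of the domain and \<open>d\<close> of the target.\<close>

definition loc :: "('m, 'a) chart \<Rightarrow> ('p, 'b) chart \<Rightarrow> ('m \<Rightarrow> 'p) \<Rightarrow> 'a \<Rightarrow> 'b" where
  "loc c d \<phi> = snd d \<circ> \<phi> \<circ> inv_into (fst c) (snd c)"

definition loc_dom :: "('m, 'a) chart \<Rightarrow> ('p, 'b) chart \<Rightarrow> ('m \<Rightarrow> 'p) \<Rightarrow> 'a set" where
  "loc_dom c d \<phi> = snd c ` (fst c \<inter> \<phi> -` fst d)"

definition smooth_map ::
  "'m::t2_space set \<Rightarrow> ('m, 'a::euclidean_space) chart set \<Rightarrow>
   'p::t2_space set \<Rightarrow> ('p, 'b::euclidean_space) chart set \<Rightarrow> ('m \<Rightarrow> 'p) \<Rightarrow> bool" where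
  "smooth_map M AM N A \<phi> \<longleftrightarrow> \<phi> ` M \<subseteq> N \<and> continuous_on M \<phi> \<and>
     (\<forall>c\<in>AM. \<forall>d\<in>A. smooth_on (loc c d \<phi>) (loc_dom c d \<phi>))"

text \<open>A tangent vector at a point of the target is given by its components in all charts around
  the point: \<open>v d x\<close> are the components in the chart \<open>d\<close> of the value at \<open>x\<close>.\<close>

definition vector_field_along ::
  "'m set \<Rightarrow> ('m, 'a::euclidean_space) chart set \<Rightarrow> ('p, 'b::euclidean_space) chart set \<Rightarrow>
   ('m \<Rightarrow> 'p) \<Rightarrow> (('p, 'b) chart \<Rightarrow> 'm \<Rightarrow> 'b) \<Rightarrow> bool" where
  "vector_field_along M AM A \<phi> v \<longleftrightarrow>
     (\<forall>c\<in>AM. \<forall>d\<in>A. smooth_on (v d \<circ> inv_into (fst c) (snd c)) (loc_dom c d \<phi>)) \<and>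
     (\<forall>d\<in>A. \<forall>e\<in>A. \<forall>x\<in>M. \<phi> x \<in> fst d \<inter> fst e \<longrightarrow>
        v e x = Dif (transition d e) (snd d (\<phi> x)) (v d x))"

definition smooth_variation ::
  "'m::t2_space set \<Rightarrow> ('m, 'a::euclidean_space) chart set \<Rightarrow>
   'p::t2_space set \<Rightarrow> ('p, 'b::euclidean_space) chart set \<Rightarrow>
   ('m \<Rightarrow> 'p) \<Rightarrow> real set \<Rightarrow> (real \<Rightarrow> 'm \<Rightarrow> 'p) \<Rightarrow> bool" where
  "smooth_variation M AM N A \<phi> I \<Phi> \<longleftrightarrow>
     open I \<and> is_interval I \<and> 0 \<in> I \<and>
     (\<forall>t\<in>I. \<Phi> t ` M \<subseteq> N) \<and> continuous_on (I \<times> M) (\<lambda>(t, x). \<Phi> t x) \<and>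
     (\<forall>c\<in>AM. \<forall>d\<in>A. smooth_on (\<lambda>(t, \<zeta>). loc c d (\<Phi> t) \<zeta>) (SIGMA t:I. loc_dom c d (\<Phi> t))) \<and>
     (\<forall>x\<in>M. \<Phi> 0 x = \<phi> x)"

definition variation_tangent_to ::
  "'m set \<Rightarrow> ('p, 'b::euclidean_space) chart set \<Rightarrow> ('m \<Rightarrow> 'p) \<Rightarrow>
   (real \<Rightarrow> 'm \<Rightarrow> 'p) \<Rightarrow> (('p, 'b) chart \<Rightarrow> 'm \<Rightarrow> 'b) \<Rightarrow> bool" where
  "variation_tangent_to M A \<phi> \<Phi> v \<longleftrightarrow>
     (\<forall>d\<in>A. \<forall>x\<in>M. \<phi> x \<in> fst d \<longrightarrow>
        ((\<lambda>t. snd d (\<Phi> t x)) has_vector_derivative v d x) (at 0))"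


section \<open>Harmonic maps and Jacobi fields\<close>

text \<open>\<open>h\<close> and \<open>g\<close> are the coordinate expressions of the metrics of domain and target, \<open>F\<close> that
  of the map, and \<open>W\<close> that of a vector field along it. The arguments \<open>X\<close>, \<open>Y\<close> of \<open>\<nabla>d\<phi>\<close> and
  \<open>\<nabla>\<^sup>2W\<close> are constant vector fields.\<close>

definition second_ff ::
  "('a \<Rightarrow> 'a \<Rightarrow> 'a \<Rightarrow> real) \<Rightarrow> ('b \<Rightarrow> 'b \<Rightarrow> 'b \<Rightarrow> real) \<Rightarrow> ('a \<Rightarrow> 'b) \<Rightarrow>
   'a \<Rightarrow> 'a \<Rightarrow> 'a::euclidean_space \<Rightarrow> 'b::euclidean_space" where
  "second_ff h g F \<zeta> X Y =
     cov g F X (\<lambda>\<xi>. Dif F \<xi> Y) \<zeta> - Dif F \<zeta> (christoffel h \<zeta> X Y)"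

definition tension ::
  "('a \<Rightarrow> 'a \<Rightarrow> 'a \<Rightarrow> real) \<Rightarrow> ('b \<Rightarrow> 'b \<Rightarrow> 'b \<Rightarrow> real) \<Rightarrow> ('a \<Rightarrow> 'b) \<Rightarrow>
   'a::euclidean_space \<Rightarrow> 'b::euclidean_space" where
  "tension h g F \<zeta> = metric_trace (h \<zeta>) (second_ff h g F \<zeta>)"

definition harmonic_map ::
  "'m::t2_space set \<Rightarrow> ('m, 'a::euclidean_space) chart set \<Rightarrow> ('m, 'a) metric \<Rightarrow>
   'p::t2_space set \<Rightarrow> ('p, 'b::euclidean_space) chart set \<Rightarrow> ('p, 'b) metric \<Rightarrow>
   ('m \<Rightarrow> 'p) \<Rightarrow> bool" where
  "harmonic_map M AM h N A g \<phi> \<longleftrightarrow> smooth_map M AM N A \<phi> \<and>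
     (\<forall>c\<in>AM. \<forall>d\<in>A. \<forall>\<zeta> \<in> loc_dom c d \<phi>. tension (h c) (g d) (loc c d \<phi>) \<zeta> = 0)"

definition cov2 ::
  "('a \<Rightarrow> 'a \<Rightarrow> 'a \<Rightarrow> real) \<Rightarrow> ('b \<Rightarrow> 'b \<Rightarrow> 'b \<Rightarrow> real) \<Rightarrow> ('a \<Rightarrow> 'b) \<Rightarrow>
   ('a \<Rightarrow> 'b) \<Rightarrow> 'a \<Rightarrow> 'a \<Rightarrow> 'a::euclidean_space \<Rightarrow> 'b::euclidean_space" where
  "cov2 h g F W \<zeta> X Y = cov g F X (cov g F Y W) \<zeta> - cov g F (christoffel h \<zeta> X Y) W \<zeta>"

definition jacobi_operator ::
  "('a \<Rightarrow> 'a \<Rightarrow> 'a \<Rightarrow> real) \<Rightarrow> ('b \<Rightarrow> 'b \<Rightarrow> 'b \<Rightarrow> real) \<Rightarrow> ('a \<Rightarrow> 'b) \<Rightarrow>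
   ('a \<Rightarrow> 'b) \<Rightarrow> 'a::euclidean_space \<Rightarrow> 'b::euclidean_space" where
  "jacobi_operator h g F W \<zeta> =
     - metric_trace (h \<zeta>) (cov2 h g F W \<zeta>)
     - metric_trace (h \<zeta>) (\<lambda>X Y. curv g (F \<zeta>) (Dif F \<zeta> X) (W \<zeta>) (Dif F \<zeta> Y))"

definition jacobi_field ::
  "'m::t2_space set \<Rightarrow> ('m, 'a::euclidean_space) chart set \<Rightarrow> ('m, 'a) metric \<Rightarrow>
   ('p::t2_space, 'b::euclidean_space) chart set \<Rightarrow> ('p, 'b) metric \<Rightarrow>
   ('m \<Rightarrow> 'p) \<Rightarrow> (('p, 'b) chart \<Rightarrow> 'm \<Rightarrow> 'b) \<Rightarrow> bool" where
  "jacobi_field M AM h A g \<phi> v \<longleftrightarrow> vector_field_along M AM A \<phi> v \<and>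
     (\<forall>c\<in>AM. \<forall>d\<in>A. \<forall>\<zeta> \<in> loc_dom c d \<phi>.
        jacobi_operator (h c) (g d) (loc c d \<phi>) (v d \<circ> inv_into (fst c) (snd c)) \<zeta> = 0)"


section \<open>Complexified tangent vectors\<close>

text \<open>The pair \<open>(X, Y)\<close> stands for \<open>X + \<i>Y\<close> in the complexification of the real vector space
  \<open>'b\<close>. For \<open>'b = complex^'n\<close> its imaginary unit (see \<open>csmul\<close>) is thus distinct from the complex
  structure \<open>JC\<close> of \<open>'b\<close>, which is extended complex-linearly.\<close>

definition csmul :: "complex \<Rightarrow> 'b \<times> 'b \<Rightarrow> 'b \<times> 'b::real_vector" where
  "csmul a Z = (Re a *\<^sub>R fst Z - Im a *\<^sub>R snd Z, Re a *\<^sub>R snd Z + Im a *\<^sub>R fst Z)"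

definition cconj :: "'b \<times> 'b \<Rightarrow> 'b \<times> 'b::real_vector" where
  "cconj Z = (fst Z, - snd Z)"

definition bilC :: "('b \<Rightarrow> 'b \<Rightarrow> real) \<Rightarrow> 'b \<times> 'b \<Rightarrow> 'b \<times> 'b \<Rightarrow> complex" where
  "bilC b Z W = Complex (b (fst Z) (fst W) - b (snd Z) (snd W))
                        (b (fst Z) (snd W) + b (snd Z) (fst W))"

definition herm :: "('b \<Rightarrow> 'b \<Rightarrow> real) \<Rightarrow> 'b \<times> 'b \<Rightarrow> 'b \<times> 'b::real_vector \<Rightarrow> complex" where
  "herm b Z W = bilC b Z (cconj W)"

text \<open>Projection \<open>Z \<mapsto> (Z - \<i>JZ)/2\<close> of \<open>T\<^sup>cN\<close> onto \<open>T'N\<close>, the \<open>\<i>\<close>-eigenspace of \<open>J\<close>.\<close>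

definition proj10 :: "(complex^'n) \<times> (complex^'n) \<Rightarrow> (complex^'n) \<times> (complex^'n)" where
  "proj10 Z = csmul (1/2) (Z - csmul \<i> (JC (fst Z), JC (snd Z)))"

text \<open>In the real basis \<open>1, \<i>\<close> of \<open>complex\<close>, \<open>\<partial>/\<partial>z = (\<partial>\<^sub>x - \<i> \<partial>\<^sub>y)/2\<close> and
  \<open>\<partial>/\<partial>zbar = (\<partial>\<^sub>x + \<i> \<partial>\<^sub>y)/2\<close>.\<close>

definition d_z :: "(complex \<Rightarrow> complex^'n) \<Rightarrow> complex \<Rightarrow> (complex^'n) \<times> (complex^'n)" where
  "d_z F \<zeta> = proj10 (csmul (1/2) ((Dif F \<zeta> 1, 0) - csmul \<i> (Dif F \<zeta> \<i>, 0)))"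

definition d_zbar :: "(complex \<Rightarrow> complex^'n) \<Rightarrow> complex \<Rightarrow> (complex^'n) \<times> (complex^'n)" where
  "d_zbar F \<zeta> = proj10 (csmul (1/2) ((Dif F \<zeta> 1, 0) + csmul \<i> (Dif F \<zeta> \<i>, 0)))"

definition covC :: "('b \<Rightarrow> 'b \<Rightarrow> 'b \<Rightarrow> real) \<Rightarrow> ('a \<Rightarrow> 'b) \<Rightarrow> 'a \<Rightarrow> ('a \<Rightarrow> 'b \<times> 'b) \<Rightarrow>
    'a::euclidean_space \<Rightarrow> 'b \<times> 'b::euclidean_space" where
  "covC g F X Z \<zeta> = (cov g F X (fst \<circ> Z) \<zeta>, cov g F X (snd \<circ> Z) \<zeta>)"

definition nabla_z :: "('b \<Rightarrow> 'b \<Rightarrow> 'b \<Rightarrow> real) \<Rightarrow> (complex \<Rightarrow> 'b) \<Rightarrow>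
    (complex \<Rightarrow> 'b \<times> 'b) \<Rightarrow> complex \<Rightarrow> 'b \<times> 'b::euclidean_space" where
  "nabla_z g F Z \<zeta> = csmul (1/2) (covC g F 1 Z \<zeta> - csmul \<i> (covC g F \<i> Z \<zeta>))"

definition nabla_zbar :: "('b \<Rightarrow> 'b \<Rightarrow> 'b \<Rightarrow> real) \<Rightarrow> (complex \<Rightarrow> 'b) \<Rightarrow>
    (complex \<Rightarrow> 'b \<times> 'b) \<Rightarrow> complex \<Rightarrow> 'b \<times> 'b::euclidean_space" where
  "nabla_zbar g F Z \<zeta> = csmul (1/2) (covC g F 1 Z \<zeta> + csmul \<i> (covC g F \<i> Z \<zeta>))"


section \<open>Complex isotropy\<close>

text \<open>\<open>etaC\<close> and \<open>jC\<close> are only meant for \<open>r \<ge> 1\<close> and \<open>s \<ge> 1\<close>. They are computed at \<open>\<zeta>\<close> in the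
  coordinate \<open>c\<close> and a chart \<open>d\<close> of the target; the value does not depend on \<open>d\<close>.\<close>

definition etaC ::
  "('p, complex^'n) metric \<Rightarrow> ('m, complex) chart \<Rightarrow> ('p, complex^'n) chart \<Rightarrow>
   ('m \<Rightarrow> 'p) \<Rightarrow> nat \<Rightarrow> nat \<Rightarrow> complex \<Rightarrow> complex" where
  "etaC g c d \<phi> r s \<zeta> = (let F = loc c d \<phi> in
     herm (g d (F \<zeta>)) ((nabla_z (g d) F ^^ (r - 1)) (d_z F) \<zeta>)
                      ((nabla_zbar (g d) F ^^ (s - 1)) (d_zbar F) \<zeta>))"

definition jC ::
  "('p, complex^'n) metric \<Rightarrow> ('m, complex) chart \<Rightarrow> ('p, complex^'n) chart \<Rightarrow>
   ('m \<Rightarrow> 'p) \<Rightarrow> (('p, complex^'n) chart \<Rightarrow> 'm \<Rightarrow> complex^'n) \<Rightarrow>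
   nat \<Rightarrow> nat \<Rightarrow> complex \<Rightarrow> complex" where
  "jC g c d \<phi> v r s \<zeta> =
     (let F = loc c d \<phi>; V = (\<lambda>\<xi>. (v d (inv_into (fst c) (snd c) \<xi>), 0)) in
       herm (g d (F \<zeta>)) ((nabla_z (g d) F ^^ r) V \<zeta>)
                        ((nabla_zbar (g d) F ^^ (s - 1)) (d_zbar F) \<zeta>) +
       herm (g d (F \<zeta>)) ((nabla_z (g d) F ^^ (r - 1)) (d_z F) \<zeta>)
                        ((nabla_zbar (g d) F ^^ s) V \<zeta>))"

definition preserves_complex_isotropy ::
  "('m, complex) chart set \<Rightarrow> ('p, complex^'n) chart set \<Rightarrow> ('p, complex^'n) metric \<Rightarrow>
   ('m \<Rightarrow> 'p) \<Rightarrow> (('p, complex^'n) chart \<Rightarrow> 'm \<Rightarrow> complex^'n) \<Rightarrow> bool" where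
  "preserves_complex_isotropy AM A g \<phi> v \<longleftrightarrow>
     (\<forall>r\<ge>1. \<forall>s\<ge>1. \<forall>c\<in>AM. \<forall>d\<in>A. \<forall>\<zeta> \<in> loc_dom c d \<phi>. jC g c d \<phi> v r s \<zeta> = 0)"

definition complex_isotropic_to_first_order ::
  "('m, complex) chart set \<Rightarrow> ('p, complex^'n) chart set \<Rightarrow> ('p, complex^'n) metric \<Rightarrow>
   ('m \<Rightarrow> 'p) \<Rightarrow> (real \<Rightarrow> 'm \<Rightarrow> 'p) \<Rightarrow> bool" where
  "complex_isotropic_to_first_order AM A g \<phi> \<Phi> \<longleftrightarrow>
     (\<forall>r\<ge>1. \<forall>s\<ge>1. \<forall>c\<in>AM. \<forall>d\<in>A. \<forall>\<zeta> \<in> loc_dom c d \<phi>.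
        etaC g c d \<phi> r s \<zeta> = 0 \<and>
        ((\<lambda>t. etaC g c d (\<Phi> t) r s \<zeta>) has_vector_derivative 0) (at 0))"

end

theory Submission
  imports Defs "HOL-Complex_Analysis.Complex_Analysis"
begin

text \<open>Identify \<open>T'N\<close> with \<open>complex^'n\<close> and put \<open>a r = (\<nabla>/\<partial>z)\<^sup>r (\<partial>\<phi>/\<partial>z)\<close>, \<open>b s = (\<nabla>/\<partial>zbar)\<^sup>s (\<partial>\<phi>/\<partial>zbar)\<close>.
  For a complex space form, \<open>[\<nabla>/\<partial>z, \<nabla>/\<partial>zbar] Z\<close> is a combination of \<open>Z\<close>, \<open>a 0\<close> and \<open>b 0\<close> whose last
  coefficient is a multiple of \<open>\<langle>Z, b 0\<rangle>\<close>. Since \<open>\<phi>\<close> is harmonic, \<open>\<nabla>/\<partial>zbar (a r)\<close> therefore lies in the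
  span of the \<open>a i\<close> with \<open>i < r\<close>, as long as \<open>\<langle>a i, b 0\<rangle> = 0\<close> for these \<open>i\<close>. By induction on \<open>r + s\<close>,
  \<open>\<langle>a r, b s\<rangle>\<close> is a holomorphic differential of positive degree on the sphere, hence zero.

  The same scheme runs on first-order deformations: with \<open>\<alpha> r = (\<nabla>/\<partial>z)\<^sup>r\<^sup>+\<^sup>1 v\<close> and
  \<open>\<beta> s = (\<nabla>/\<partial>zbar)\<^sup>s\<^sup>+\<^sup>1 v\<close>, the pairs \<open>(a r, \<alpha> r)\<close> satisfy the linearised recursion up to curvature terms
  that cancel in \<open>\<langle>\<alpha> r, b s\<rangle> + \<langle>a r, \<beta> s\<rangle>\<close>, which is again a holomorphic differential. For a variation,
  \<open>\<nabla>/\<partial>t (a r)\<close> agrees with \<open>\<alpha> r\<close> modulo the span of the \<open>a i\<close>, so that this expression is the derivative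
  of \<open>\<langle>a r, b s\<rangle>\<close>.\<close>

text \<open>The induction on r + s is forced twice. Under a change of coordinate with complex
  derivative \<open>\<tau>\<close>, the section \<open>a r\<close> is multiplied by the power r + 1
  of \<open>\<tau>\<close> only modulo the \<open>a i\<close> with i < r, because each further
  derivative also hits the powers of \<open>\<tau>\<close> already present. So the pairing of
  \<open>a r\<close> with \<open>b s\<close> is a differential, of degree (r + 1) + (s + 1), only
  once the pairings with smaller r + s vanish; the same vanishing makes it holomorphic.

  The linearised run is the same argument over dual numbers: the pair (Z, Y) of
  \<open>span_pair\<close> stands for Z + eps Y with eps^2 = 0. Multiples of eps \<open>a i\<close>
  that arise on the way are harmless, because isotropy of \<phi> is known in all orders before the
  Jacobi field is treated.

  Only one half of each computation is carried out. Reversing the second coordinate direction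
  exchanges \<open>a\<close> with \<open>b\<close> and \<alpha> with \<beta>, and the locales are
  set up with free directions \<open>e1\<close>, \<open>e2\<close> so that the conjugate half is
  another instance.\<close>

section \<open>Calculus of smooth maps on open sets\<close>

lemma Dif_eqI: "(f has_derivative f') (at x) \<Longrightarrow> Dif f x = f'"
  by (metis frechet_derivative_at)

lemma Dif_works: "f differentiable (at x) \<Longrightarrow> (f has_derivative Dif f x) (at x)"
  by (simp add: frechet_derivative_works)

lemma Dif_cong:
  assumes "open S" "x \<in> S" "\<And>y. y \<in> S \<Longrightarrow> f y = g y"
  shows "Dif f x = Dif g x"
proof -
  have "(f has_derivative D) (at x) \<longleftrightarrow> (g has_derivative D) (at x)" for D
    using assms has_derivative_transform_within_open[of f D x UNIV S g]
      has_derivative_transform_within_open[of g D x UNIV S f] by auto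
  then show ?thesis unfolding frechet_derivative_def by simp
qed

lemma differentiable_cong_open:
  assumes "open S" "x \<in> S" "\<And>y. y \<in> S \<Longrightarrow> f y = g y"
  shows "f differentiable (at x) \<longleftrightarrow> g differentiable (at x)"
proof -
  have "(f has_derivative D) (at x) \<longleftrightarrow> (g has_derivative D) (at x)" for D
    using assms has_derivative_transform_within_open[of f D x UNIV S g]
      has_derivative_transform_within_open[of g D x UNIV S f] by auto
  then show ?thesis unfolding differentiable_def by simp
qed

lemma differentiable_on_open_iff:
  "open S \<Longrightarrow> f differentiable_on S \<longleftrightarrow> (\<forall>x\<in>S. f differentiable (at x))"
  by (rule differentiable_on_eq_differentiable_at)

lemma Dif_linear: "f differentiable (at x) \<Longrightarrow> linear (Dif f x)"
  by (rule linear_frechet_derivative)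

lemma Ck_on_cong:
  assumes "open S"
  shows "(\<And>x. x \<in> S \<Longrightarrow> f x = g x) \<Longrightarrow> Ck_on k f S \<longleftrightarrow> Ck_on k g S"
proof (induction k arbitrary: f g)
  case 0
  then show ?case by (simp cong: continuous_on_cong)
next
  case (Suc k)
  have "f differentiable_on S \<longleftrightarrow> g differentiable_on S"
    using Suc.prems assms differentiable_cong_open[of S _ f g] by (simp add: differentiable_on_open_iff)
  moreover have "Ck_on k (\<lambda>x. Dif f x b) S \<longleftrightarrow> Ck_on k (\<lambda>x. Dif g x b) S" for b
    by (rule Suc.IH, rule fun_cong, rule Dif_cong[OF assms _ Suc.prems])
  ultimately show ?case by simp
qed

lemma Ck_on_SucD: "Ck_on (Suc k) f S \<Longrightarrow> Ck_on k f S"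
proof (induction k arbitrary: f)
  case 0
  then show ?case by (simp add: differentiable_imp_continuous_on)
qed auto

lemma Ck_on_subset: "Ck_on k f S \<Longrightarrow> T \<subseteq> S \<Longrightarrow> Ck_on k f T"
proof (induction k arbitrary: f)
  case 0
  then show ?case by (simp add: continuous_on_subset)
next
  case (Suc k)
  then show ?case by (auto intro: differentiable_on_subset)
qed

lemma Ck_on_const: "Ck_on k (\<lambda>x. c) S"
proof (induction k arbitrary: c)
  case (Suc k)
  then show ?case by simp
qed auto

lemma Ck_on_add:
  assumes "open S"
  shows "Ck_on k f S \<Longrightarrow> Ck_on k g S \<Longrightarrow> Ck_on k (\<lambda>x. f x + g x) S"
proof (induction k arbitrary: f g)
  case 0
  then show ?case by (simp add: continuous_on_add)
next
  case (Suc k)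
  have d: "((\<lambda>x. f x + g x) has_derivative (\<lambda>X. Dif f x X + Dif g x X)) (at x)"
    if "x \<in> S" for x
    using Suc.prems that assms
    by (intro has_derivative_add Dif_works) (auto simp: differentiable_on_open_iff)
  have "Ck_on k (\<lambda>x. Dif (\<lambda>x. f x + g x) x b) S" if "b \<in> Basis" for b
    using Suc that by (subst Ck_on_cong[OF assms, OF fun_cong[OF Dif_eqI[OF d]]]) auto
  then show ?case using d assms by (auto simp: differentiable_on_open_iff differentiable_def)
qed

lemma Ck_on_bilinear:
  assumes "bounded_bilinear p" "open S"
  shows "Ck_on k f S \<Longrightarrow> Ck_on k g S \<Longrightarrow> Ck_on k (\<lambda>x. p (f x) (g x)) S"
proof (induction k arbitrary: f g)
  case 0
  then show ?case using bounded_bilinear.continuous_on[OF assms(1)] by simp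
next
  case (Suc k)
  interpret bounded_bilinear p by fact
  have d: "((\<lambda>x. p (f x) (g x)) has_derivative (\<lambda>X. p (f x) (Dif g x X) + p (Dif f x X) (g x))) (at x)"
    if "x \<in> S" for x
    using Suc.prems that assms(2)
    by (intro FDERIV Dif_works) (auto simp: differentiable_on_open_iff)
  have "Ck_on k (\<lambda>x. Dif (\<lambda>x. p (f x) (g x)) x b) S" if b: "b \<in> Basis" for b
  proof -
    have 1: "Ck_on k (\<lambda>x. p (f x) (Dif g x b)) S" "Ck_on k (\<lambda>x. p (Dif f x b) (g x)) S"
      using Suc.prems b by (auto intro!: Suc.IH Ck_on_SucD[OF Suc.prems(1)] Ck_on_SucD[OF Suc.prems(2)])
    show ?thesis using Ck_on_add[OF assms(2) 1]
      by (subst Ck_on_cong[OF assms(2), OF fun_cong[OF Dif_eqI[OF d]]]) auto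
  qed
  then show ?case using d assms(2) by (auto simp: differentiable_on_open_iff differentiable_def)
qed

lemma Ck_on_linear:
  assumes "bounded_linear L" "open S"
  shows "Ck_on k f S \<Longrightarrow> Ck_on k (\<lambda>x. L (f x)) S"
proof (induction k arbitrary: f)
  case 0
  then show ?case using bounded_linear.continuous_on[OF assms(1)] by simp
next
  case (Suc k)
  have d: "((\<lambda>x. L (f x)) has_derivative (\<lambda>X. L (Dif f x X))) (at x)" if "x \<in> S" for x
    using Suc.prems that assms
    by (intro bounded_linear.has_derivative[OF assms(1)] Dif_works) (auto simp: differentiable_on_open_iff)
  have "Ck_on k (\<lambda>x. Dif (\<lambda>x. L (f x)) x b) S" if "b \<in> Basis" for b
    using Suc that by (subst Ck_on_cong[OF assms(2), OF fun_cong[OF Dif_eqI[OF d]]]) auto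
  then show ?case using d assms(2) by (auto simp: differentiable_on_open_iff differentiable_def)
qed

lemma Ck_on_sum:
  assumes "open S"
  shows "(\<And>i. i \<in> I \<Longrightarrow> Ck_on k (f i) S) \<Longrightarrow> Ck_on k (\<lambda>x. \<Sum>i\<in>I. f i x) S"
  by (induction I rule: infinite_finite_induct) (auto intro: Ck_on_const Ck_on_add[OF assms])

lemma Dif_basis_sum:
  fixes f :: "'a::euclidean_space \<Rightarrow> 'b::real_normed_vector"
  assumes "f differentiable (at x)"
  shows "Dif f x X = (\<Sum>b\<in>Basis. (X \<bullet> b) *\<^sub>R Dif f x b)"
proof -
  interpret linear "Dif f x" using assms by (rule Dif_linear)
  have "Dif f x X = Dif f x (\<Sum>b\<in>Basis. (X \<bullet> b) *\<^sub>R b)" by (simp add: euclidean_representation)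
  also have "\<dots> = (\<Sum>b\<in>Basis. (X \<bullet> b) *\<^sub>R Dif f x b)" by (simp add: sum scale)
  finally show ?thesis .
qed

lemma Ck_on_compose:
  fixes f :: "'b::euclidean_space \<Rightarrow> 'c::real_normed_vector" and F :: "'a::euclidean_space \<Rightarrow> 'b"
  assumes "open S" "open T" "F ` T \<subseteq> S"
  shows "Ck_on k f S \<Longrightarrow> Ck_on k F T \<Longrightarrow> Ck_on k (\<lambda>x. f (F x)) T"
proof (induction k arbitrary: f)
  case 0
  then show ?case using assms(3) by (auto intro: continuous_on_compose2)
next
  case (Suc k)
  have dF: "F differentiable at x" if "x \<in> T" for x
    using Suc.prems that assms by (auto simp: differentiable_on_open_iff)
  have df: "f differentiable at (F x)" if "x \<in> T" for x
    using Suc.prems that assms by (auto simp: differentiable_on_open_iff)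
  have d: "((\<lambda>x. f (F x)) has_derivative (\<lambda>X. Dif f (F x) (Dif F x X))) (at x)" if "x \<in> T" for x
    using has_derivative_compose[OF Dif_works[OF dF] Dif_works[OF df]] that by blast
  have "Ck_on k (\<lambda>x. Dif (\<lambda>x. f (F x)) x b) T" if b: "b \<in> Basis" for b
  proof -
    \<comment> \<open>The induction hypothesis covers derivatives of \<open>f\<close> in fixed
      directions only, so the moving direction \<open>Dif F x b\<close> is expanded in the
      basis.\<close>
    have "Dif (\<lambda>x. f (F x)) x b = (\<Sum>e\<in>Basis. (Dif F x b \<bullet> e) *\<^sub>R Dif f (F x) e)" if "x \<in> T" for x
      unfolding Dif_eqI[OF d[OF that]] by (rule Dif_basis_sum[OF df[OF that]])
    moreover have "Ck_on k (\<lambda>x. (\<Sum>e\<in>Basis. (Dif F x b \<bullet> e) *\<^sub>R Dif f (F x) e)) T"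
    proof (intro Ck_on_sum[OF assms(2)] Ck_on_bilinear[OF bounded_bilinear_scaleR assms(2)])
      fix e :: 'b assume e: "e \<in> Basis"
      show "Ck_on k (\<lambda>x. Dif F x b \<bullet> e) T"
        using Suc.prems b by (intro Ck_on_linear[OF bounded_linear_inner_left assms(2)]) auto
      show "Ck_on k (\<lambda>x. Dif f (F x) e) T"
        using Suc.prems Suc.IH[of "\<lambda>y. Dif f y e"] e Ck_on_SucD[OF Suc.prems(2)] by auto
    qed
    ultimately show ?thesis by (subst Ck_on_cong[OF assms(2)]) auto
  qed
  then show ?case using d assms by (auto simp: differentiable_on_open_iff differentiable_def)
qed

lemma Ck_on_inverse:
  fixes f :: "'a::euclidean_space \<Rightarrow> 'b::real_normed_field"
  assumes "open S"
  shows "Ck_on k f S \<Longrightarrow> (\<And>x. x \<in> S \<Longrightarrow> f x \<noteq> 0) \<Longrightarrow> Ck_on k (\<lambda>x. inverse (f x)) S"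
proof (induction k)
  case 0
  then show ?case by (auto intro: continuous_on_inverse)
next
  case (Suc k)
  have d: "((\<lambda>x. inverse (f x)) has_derivative (\<lambda>X. - (inverse (f x) * Dif f x X * inverse (f x)))) (at x)" if "x \<in> S" for x
    using Suc.prems that assms
    by (intro Deriv.has_derivative_inverse Dif_works) (auto simp: differentiable_on_open_iff)
  have "Ck_on k (\<lambda>x. Dif (\<lambda>x. inverse (f x)) x b) S" if b: "b \<in> Basis" for b
  proof -
    have i: "Ck_on k (\<lambda>x. inverse (f x)) S" by (rule Suc.IH[OF Ck_on_SucD[OF Suc.prems(1)] Suc.prems(2)])
    have "Ck_on k (\<lambda>x. - (inverse (f x) * Dif f x b * inverse (f x))) S"
      using Suc.prems b i
      by (intro Ck_on_linear[OF bounded_linear_minus[OF bounded_linear_ident] assms] 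
          Ck_on_bilinear[OF bounded_bilinear_mult assms]) auto
    then show ?thesis 
      by (subst Ck_on_cong[OF assms, OF fun_cong[OF Dif_eqI[OF d]]]) auto
  qed
  then show ?case using d assms by (auto simp: differentiable_on_open_iff differentiable_def)
qed

lemma smooth_on_cong:
  assumes "open S" "\<And>x. x \<in> S \<Longrightarrow> f x = g x"
  shows "smooth_on f S \<longleftrightarrow> smooth_on g S"
  using Ck_on_cong[OF assms] by (simp add: smooth_on_def)

lemma smooth_on_subset: "smooth_on f S \<Longrightarrow> T \<subseteq> S \<Longrightarrow> smooth_on f T"
  by (auto simp: smooth_on_def intro: Ck_on_subset)

lemma smooth_on_const [simp]: "smooth_on (\<lambda>x. c) S"
  by (simp add: smooth_on_def Ck_on_const)

lemma smooth_on_differentiable: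
  "smooth_on f S \<Longrightarrow> open S \<Longrightarrow> x \<in> S \<Longrightarrow> f differentiable (at x)"
  unfolding smooth_on_def using Ck_on.simps(2)[of 0 f S] differentiable_on_open_iff by blast

lemma smooth_on_Dif_works:
  "smooth_on f S \<Longrightarrow> open S \<Longrightarrow> x \<in> S \<Longrightarrow> (f has_derivative Dif f x) (at x)"
  using smooth_on_differentiable Dif_works by blast

lemma smooth_on_continuous: "smooth_on f S \<Longrightarrow> continuous_on S f"
  unfolding smooth_on_def by (metis Ck_on.simps(1))

lemma smooth_on_linear:
  "bounded_linear L \<Longrightarrow> open S \<Longrightarrow> smooth_on f S \<Longrightarrow> smooth_on (\<lambda>x. L (f x)) S"
  by (simp add: smooth_on_def Ck_on_linear)

lemma smooth_on_bilinear:
  "bounded_bilinear p \<Longrightarrow> open S \<Longrightarrow> smooth_on f S \<Longrightarrow> smooth_on g S \<Longrightarrow> smooth_on (\<lambda>x. p (f x) (g x)) S"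
  by (simp add: smooth_on_def Ck_on_bilinear)

lemma smooth_on_add:
  "open S \<Longrightarrow> smooth_on f S \<Longrightarrow> smooth_on g S \<Longrightarrow> smooth_on (\<lambda>x. f x + g x) S"
  by (simp add: smooth_on_def Ck_on_add)

lemma smooth_on_minus: "open S \<Longrightarrow> smooth_on f S \<Longrightarrow> smooth_on (\<lambda>x. - f x) S"
  using smooth_on_linear[OF bounded_linear_minus[OF bounded_linear_ident]] by auto

lemma smooth_on_diff:
  "open S \<Longrightarrow> smooth_on f S \<Longrightarrow> smooth_on g S \<Longrightarrow> smooth_on (\<lambda>x. f x - g x) S"
  using smooth_on_add[of S f "\<lambda>x. - g x"] smooth_on_minus by auto

lemma smooth_on_scaleR:
  "open S \<Longrightarrow> smooth_on f S \<Longrightarrow> smooth_on g S \<Longrightarrow> smooth_on (\<lambda>x. f x *\<^sub>R g x) S"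
  by (rule smooth_on_bilinear[OF bounded_bilinear_scaleR])

lemma smooth_on_mult:
  fixes f g :: "'a::euclidean_space \<Rightarrow> 'b::real_normed_algebra"
  shows "open S \<Longrightarrow> smooth_on f S \<Longrightarrow> smooth_on g S \<Longrightarrow> smooth_on (\<lambda>x. f x * g x) S"
  by (rule smooth_on_bilinear[OF bounded_bilinear_mult])

lemma smooth_on_power:
  fixes f :: "'a::euclidean_space \<Rightarrow> 'b::real_normed_algebra_1"
  shows "open S \<Longrightarrow> smooth_on f S \<Longrightarrow> smooth_on (\<lambda>x. f x ^ n) S"
  by (induction n) (auto intro: smooth_on_mult)

lemma smooth_on_sum:
  "open S \<Longrightarrow> (\<And>i. i \<in> I \<Longrightarrow> smooth_on (f i) S) \<Longrightarrow> smooth_on (\<lambda>x. \<Sum>i\<in>I. f i x) S"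
  by (simp add: smooth_on_def Ck_on_sum)

lemma smooth_on_prod:
  fixes f :: "'i \<Rightarrow> 'a::euclidean_space \<Rightarrow> 'b::{real_normed_algebra,comm_ring_1}"
  assumes "open S"
  shows "(\<And>i. i \<in> I \<Longrightarrow> smooth_on (f i) S) \<Longrightarrow> smooth_on (\<lambda>x. \<Prod>i\<in>I. f i x) S"
  by (induction I rule: infinite_finite_induct) (auto intro: smooth_on_mult[OF assms])

lemma smooth_on_inverse:
  fixes f :: "'a::euclidean_space \<Rightarrow> 'b::real_normed_field"
  shows "open S \<Longrightarrow> smooth_on f S \<Longrightarrow> (\<And>x. x \<in> S \<Longrightarrow> f x \<noteq> 0) \<Longrightarrow> smooth_on (\<lambda>x. inverse (f x)) S"
  by (simp add: smooth_on_def Ck_on_inverse)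

lemma smooth_on_compose:
  "open S \<Longrightarrow> open T \<Longrightarrow> F ` T \<subseteq> S \<Longrightarrow> smooth_on f S \<Longrightarrow> smooth_on F T \<Longrightarrow> smooth_on (\<lambda>x. f (F x)) T"
  by (simp add: smooth_on_def Ck_on_compose)

lemma smooth_on_ident: "open S \<Longrightarrow> smooth_on (\<lambda>x::'a::euclidean_space. x) S"
proof -
  assume S: "open S"
  have "Ck_on k (\<lambda>x::'a. x) S" for k
    by (cases k) (auto simp: Ck_on_const differentiable_on_def continuous_on_id)
  then show ?thesis by (simp add: smooth_on_def)
qed

lemma smooth_on_Dif:
  fixes f :: "'a::euclidean_space \<Rightarrow> 'b::real_normed_vector"
  assumes "open S" "smooth_on f S"
  shows "smooth_on (\<lambda>x. Dif f x X) S"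
proof -
  have "smooth_on (\<lambda>x. Dif f x b) S" if "b \<in> Basis" for b
    unfolding smooth_on_def
  proof
    fix k show "Ck_on k (\<lambda>x. Dif f x b) S"
      using assms(2)[unfolded smooth_on_def, rule_format, of "Suc k"] that by simp
  qed
  then have "smooth_on (\<lambda>x. (\<Sum>b\<in>Basis. (X \<bullet> b) *\<^sub>R Dif f x b)) S"
    using assms by (intro smooth_on_sum smooth_on_scaleR) auto
  moreover have "Dif f x X = (\<Sum>b\<in>Basis. (X \<bullet> b) *\<^sub>R Dif f x b)" if "x \<in> S" for x
    using Dif_basis_sum smooth_on_differentiable[OF assms(2,1) that] by blast
  ultimately show ?thesis by (subst smooth_on_cong[OF assms(1)])
qed

section \<open>Symmetry of second derivatives\<close>

text \<open>The mean value theorem is applied twice, along \<open>X\<close> and then along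
  \<open>Y\<close>. The second difference is symmetric in \<open>X\<close> and \<open>Y\<close>, so
  using this with the roles exchanged compares the two mixed derivatives.\<close>

lemma second_difference_mvt:
  fixes f :: "'a::euclidean_space \<Rightarrow> real"
  assumes S: "open S" "smooth_on f S" and s: "0 < s"
    and in_S: "\<And>a b. 0 \<le> a \<Longrightarrow> a \<le> s \<Longrightarrow> 0 \<le> b \<Longrightarrow> b \<le> s \<Longrightarrow> x + a *\<^sub>R X + b *\<^sub>R Y \<in> S"
  shows "\<exists>a b. 0 < a \<and> a < s \<and> 0 < b \<and> b < s \<and>
    f (x + s *\<^sub>R X + s *\<^sub>R Y) - f (x + s *\<^sub>R X) - f (x + s *\<^sub>R Y) + f x =
      s\<^sup>2 * Dif (\<lambda>y. Dif f y X) (x + a *\<^sub>R X + b *\<^sub>R Y) Y"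
proof -
  have d: "((\<lambda>a. u (p + a *\<^sub>R W)) has_real_derivative Dif u (p + a *\<^sub>R W) W) (at a)"
    if "smooth_on u S" "p + a *\<^sub>R W \<in> S" for u :: "'a \<Rightarrow> real" and p W a
  proof -
    have "((\<lambda>a. u (p + a *\<^sub>R W)) has_derivative (\<lambda>h. Dif u (p + a *\<^sub>R W) (h *\<^sub>R W))) (at a)"
      by (rule has_derivative_compose[where f = "\<lambda>a. p + a *\<^sub>R W" and g = u,
            OF _ smooth_on_Dif_works[OF that(1) S(1) that(2)]])
         (auto intro!: derivative_eq_intros)
    moreover have lin: "linear (Dif u (p + a *\<^sub>R W))"
      using Dif_linear smooth_on_differentiable S(1) that by blast
    have "(\<lambda>h. Dif u (p + a *\<^sub>R W) (h *\<^sub>R W)) = (*) (Dif u (p + a *\<^sub>R W) W)"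
      using linear_cmul[OF lin] by (auto simp: fun_eq_iff)
    ultimately show ?thesis by (simp add: has_field_derivative_def)
  qed
  \<comment> \<open>The difference of \<open>f\<close> across the side \<open>s *\<^sub>R Y\<close>,
    as a function of the position along \<open>X\<close>; its increment from 0 to \<open>s\<close>
    is the second difference.\<close>
  define k where "k a = f (x + s *\<^sub>R Y + a *\<^sub>R X) - f (x + a *\<^sub>R X)" for a
  have "(k has_real_derivative Dif f (x + s *\<^sub>R Y + a *\<^sub>R X) X - Dif f (x + a *\<^sub>R X) X) (at a)"
    if "0 \<le> a" "a \<le> s" for a
    unfolding k_def using in_S[of a s] in_S[of a 0] that s
    by (intro DERIV_diff d S(2)) (auto simp: algebra_simps)
  from MVT2[OF s this] obtain a where a: "0 < a" "a < s"
    and ka: "k s - k 0 = s * (Dif f (x + s *\<^sub>R Y + a *\<^sub>R X) X - Dif f (x + a *\<^sub>R X) X)" by auto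
  have "((\<lambda>b. Dif f (x + a *\<^sub>R X + b *\<^sub>R Y) X) has_real_derivative
      Dif (\<lambda>y. Dif f y X) (x + a *\<^sub>R X + b *\<^sub>R Y) Y) (at b)" if "0 \<le> b" "b \<le> s" for b
    using in_S[of a b] that a by (intro d smooth_on_Dif S) auto
  from MVT2[OF s this] obtain b where b: "0 < b" "b < s"
    "Dif f (x + a *\<^sub>R X + s *\<^sub>R Y) X - Dif f (x + a *\<^sub>R X) X = s * Dif (\<lambda>y. Dif f y X) (x + a *\<^sub>R X + b *\<^sub>R Y) Y"
    by auto
  then have "k s - k 0 = s\<^sup>2 * Dif (\<lambda>y. Dif f y X) (x + a *\<^sub>R X + b *\<^sub>R Y) Y"
    using ka by (simp add: algebra_simps power2_eq_square)
  then show ?thesis using a b(1,2) unfolding k_def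
    by (intro exI[of _ a] exI[of _ b]) (simp add: algebra_simps)
qed

text \<open>The second difference, evaluated in both orders, makes the two mixed derivatives agree
  at points arbitrarily close to \<open>x\<close>. If they differed at \<open>x\<close>, continuity
  with tolerance half their distance would contradict the triangle inequality.\<close>

lemma Dif_commute_real:
  fixes f :: "'a::euclidean_space \<Rightarrow> real"
  assumes S: "open S" "smooth_on f S" and x: "x \<in> S"
  shows "Dif (\<lambda>y. Dif f y X) x Y = Dif (\<lambda>y. Dif f y Y) x X"
proof (rule ccontr)
  define P where "P = (\<lambda>y. Dif (\<lambda>y. Dif f y X) y Y)"
  define Q where "Q = (\<lambda>y. Dif (\<lambda>y. Dif f y Y) y X)"
  assume "\<not> ?thesis"
  then have ne: "dist (P x) (Q x) / 2 > 0" by (simp add: P_def Q_def)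
  have cont: "isCont P x" "isCont Q x" unfolding P_def Q_def
    using smooth_on_continuous[OF smooth_on_Dif[OF S(1) smooth_on_Dif[OF S]]] S(1) x
    by (simp_all add: continuous_on_eq_continuous_at)
  obtain e1 where e1: "e1 > 0" "\<And>y. dist y x < e1 \<Longrightarrow> dist (P y) (P x) < dist (P x) (Q x) / 2"
    using cont(1)[unfolded continuous_at_eps_delta, rule_format, OF ne] by blast
  obtain e2 where e2: "e2 > 0" "\<And>y. dist y x < e2 \<Longrightarrow> dist (Q y) (Q x) < dist (P x) (Q x) / 2"
    using cont(2)[unfolded continuous_at_eps_delta, rule_format, OF ne] by blast
  obtain e3 where e3: "e3 > 0" "ball x e3 \<subseteq> S" using S(1) x open_contains_ball by blast
  define e where "e = min e1 (min e2 e3)"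
  \<comment> \<open>Small enough that the parallelogram with sides \<open>s *\<^sub>R X\<close> and
    \<open>s *\<^sub>R Y\<close> stays within \<open>e\<close> of \<open>x\<close>; the summand 1
    keeps the denominator positive when both vectors vanish.\<close>
  define s where "s = e / (2 * (norm X + norm Y + 1))"
  have e0: "e > 0" using e1 e2 e3 by (simp add: e_def)
  have s: "s > 0" unfolding s_def using e0 by (auto intro!: divide_pos_pos add_nonneg_pos)
  have near: "dist (x + a *\<^sub>R X + b *\<^sub>R Y) x < e" if "0 \<le> a" "a \<le> s" "0 \<le> b" "b \<le> s" for a b
  proof -
    have "norm (a *\<^sub>R X + b *\<^sub>R Y) \<le> a * norm X + b * norm Y"
      using that by (metis abs_of_nonneg norm_scaleR norm_triangle_ineq)
    also have "\<dots> \<le> s * norm X + s * norm Y" using that by (intro add_mono mult_right_mono) auto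
    also have "\<dots> < s * (2 * (norm X + norm Y + 1))"
    proof -
      have "0 \<le> s * norm X" "0 \<le> s * norm Y" using s by auto
      then show ?thesis using s by (auto simp: algebra_simps intro!: add_nonneg_pos)
    qed
    also have "\<dots> = e"
    proof -
      have "norm X + norm Y + 1 > 0" using norm_ge_zero[of X] norm_ge_zero[of Y] by linarith
      then show ?thesis unfolding s_def by simp
    qed
    finally show ?thesis by (simp add: dist_norm)
  qed
  have inS: "x + a *\<^sub>R X + b *\<^sub>R Y \<in> S" if "0 \<le> a" "a \<le> s" "0 \<le> b" "b \<le> s" for a b
    using near[OF that] e3(2) by (auto simp: e_def dist_commute)
  obtain a b where 1: "0 < a" "a < s" "0 < b" "b < s"
    "f (x + s *\<^sub>R X + s *\<^sub>R Y) - f (x + s *\<^sub>R X) - f (x + s *\<^sub>R Y) + f x = s\<^sup>2 * P (x + a *\<^sub>R X + b *\<^sub>R Y)"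
    using second_difference_mvt[OF S s inS] unfolding P_def by blast
  have inS': "x + a *\<^sub>R Y + b *\<^sub>R X \<in> S" if "0 \<le> a" "a \<le> s" "0 \<le> b" "b \<le> s" for a b
    using inS[OF that(3,4,1,2)] by (simp add: add_ac)
  obtain c d where 2: "0 < c" "c < s" "0 < d" "d < s"
    "f (x + s *\<^sub>R Y + s *\<^sub>R X) - f (x + s *\<^sub>R Y) - f (x + s *\<^sub>R X) + f x = s\<^sup>2 * Q (x + c *\<^sub>R Y + d *\<^sub>R X)"
    using second_difference_mvt[OF S s inS'] unfolding Q_def by blast
  have "s\<^sup>2 * P (x + a *\<^sub>R X + b *\<^sub>R Y) = s\<^sup>2 * Q (x + d *\<^sub>R X + c *\<^sub>R Y)"
  proof -
    have *: "x + s *\<^sub>R Y + s *\<^sub>R X = x + s *\<^sub>R X + s *\<^sub>R Y"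
      "x + d *\<^sub>R X + c *\<^sub>R Y = x + c *\<^sub>R Y + d *\<^sub>R X" by (simp_all add: add_ac)
    show ?thesis using 1(5) 2(5) unfolding * by linarith
  qed
  then have "P (x + a *\<^sub>R X + b *\<^sub>R Y) = Q (x + d *\<^sub>R X + c *\<^sub>R Y)" using s by simp
  moreover have "dist (P (x + a *\<^sub>R X + b *\<^sub>R Y)) (P x) < dist (P x) (Q x) / 2"
    using near[of a b] 1 by (intro e1(2)) (auto simp: e_def)
  moreover have "dist (Q (x + d *\<^sub>R X + c *\<^sub>R Y)) (Q x) < dist (P x) (Q x) / 2"
    using near[of d c] 2 by (intro e2(2)) (auto simp: e_def)
  ultimately have "dist (P x) (Q x) < dist (P x) (Q x)"
    by (metis dist_triangle_half_r)
  then show False by simp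
qed

lemma Dif_inner:
  assumes "f differentiable (at x)"
  shows "Dif (\<lambda>y. f y \<bullet> b) x X = Dif f x X \<bullet> b"
  using Dif_eqI[OF has_derivative_inner_left[OF Dif_works[OF assms], of b]] by simp

lemma Dif_commute:
  fixes f :: "'a::euclidean_space \<Rightarrow> 'b::euclidean_space"
  assumes S: "open S" "smooth_on f S" and x: "x \<in> S"
  shows "Dif (\<lambda>y. Dif f y X) x Y = Dif (\<lambda>y. Dif f y Y) x X"
proof (rule euclidean_eqI)
  fix b :: 'b
  have *: "Dif (\<lambda>y. Dif f y X) x Y \<bullet> b = Dif (\<lambda>y. Dif (\<lambda>y. f y \<bullet> b) y X) x Y" for X Y
  proof -
    have "Dif (\<lambda>y. Dif (\<lambda>y. f y \<bullet> b) y X) x Y = Dif (\<lambda>y. Dif f y X \<bullet> b) x Y"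
      by (intro fun_cong[OF Dif_cong[OF S(1) x]] Dif_inner smooth_on_differentiable[OF S(2,1)])
    also have "\<dots> = Dif (\<lambda>y. Dif f y X) x Y \<bullet> b"
      by (rule Dif_inner[OF smooth_on_differentiable[OF smooth_on_Dif[OF S] S(1) x]])
    finally show ?thesis by simp
  qed
  have "smooth_on (\<lambda>y. f y \<bullet> b) S"
    by (rule smooth_on_linear[OF bounded_linear_inner_left S])
  then show "Dif (\<lambda>y. Dif f y X) x Y \<bullet> b = Dif (\<lambda>y. Dif f y Y) x X \<bullet> b"
    unfolding * by (rule Dif_commute_real[OF S(1) _ x])
qed

section \<open>Smooth families of bilinear maps\<close>

text \<open>Smoothness in the base point is required for fixed arguments only; expansion in bases
  upgrades it to moving arguments. Metrics, Hermitian forms, Christoffel symbols and the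
  differential of a chart transition all get their product rule from this one notion.\<close>

definition smooth_bil ::
  "('q::euclidean_space \<Rightarrow> 'u::euclidean_space \<Rightarrow> 'w::euclidean_space \<Rightarrow> 'c::real_normed_vector) \<Rightarrow> 'q set \<Rightarrow> bool" where
  "smooth_bil B Q \<longleftrightarrow> (\<forall>q\<in>Q. bilinear (B q)) \<and> (\<forall>u w. smooth_on (\<lambda>q. B q u w) Q)"

lemma bilinear_expand:
  fixes B :: "'u::euclidean_space \<Rightarrow> 'w::euclidean_space \<Rightarrow> 'c::real_vector"
  assumes "bilinear B"
  shows "B u w = (\<Sum>a\<in>Basis. \<Sum>b\<in>Basis. ((u \<bullet> a) * (w \<bullet> b)) *\<^sub>R B a b)"
proof -
  have l: "linear (\<lambda>x. B x y)" "linear (B x)" for x y using assms by (auto simp: bilinear_def)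
  have "B u w = B (\<Sum>a\<in>Basis. (u \<bullet> a) *\<^sub>R a) (\<Sum>b\<in>Basis. (w \<bullet> b) *\<^sub>R b)"
    by (simp add: euclidean_representation)
  also have "\<dots> = (\<Sum>a\<in>Basis. \<Sum>b\<in>Basis. ((u \<bullet> a) * (w \<bullet> b)) *\<^sub>R B a b)"
    by (simp add: linear_sum[OF l(1)] linear_sum[OF l(2)] linear_cmul[OF l(1)] linear_cmul[OF l(2)] scaleR_sum_right mult.commute)
       (rule sum.swap)
  finally show ?thesis .
qed

lemma linear_expand:
  fixes L :: "'u::euclidean_space \<Rightarrow> 'c::real_vector"
  assumes "linear L"
  shows "L u = (\<Sum>a\<in>Basis. (u \<bullet> a) *\<^sub>R L a)"
proof -
  have "L u = L (\<Sum>a\<in>Basis. (u \<bullet> a) *\<^sub>R a)" by (simp add: euclidean_representation)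
  then show ?thesis by (simp add: linear_sum[OF assms] linear_cmul[OF assms])
qed

context
  fixes B :: "'q::euclidean_space \<Rightarrow> 'u::euclidean_space \<Rightarrow> 'w::euclidean_space \<Rightarrow> 'c::real_normed_vector" and Q
  assumes Q: "open Q" and B: "smooth_bil B Q"
begin

lemma smooth_bil_Dif_expand:
  assumes "q \<in> Q"
  shows "Dif (\<lambda>p. B p u w) q X = (\<Sum>a\<in>Basis. \<Sum>b\<in>Basis. ((u \<bullet> a) * (w \<bullet> b)) *\<^sub>R Dif (\<lambda>p. B p a b) q X)"
proof -
  have "Dif (\<lambda>p. B p u w) q = Dif (\<lambda>p. \<Sum>a\<in>Basis. \<Sum>b\<in>Basis. ((u \<bullet> a) * (w \<bullet> b)) *\<^sub>R B p a b) q"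
    by (rule Dif_cong[OF Q assms]) (use B in \<open>auto simp: smooth_bil_def intro: bilinear_expand\<close>)
  also have "\<dots> = (\<lambda>X. \<Sum>a\<in>Basis. \<Sum>b\<in>Basis. ((u \<bullet> a) * (w \<bullet> b)) *\<^sub>R Dif (\<lambda>p. B p a b) q X)"
    using B by (intro Dif_eqI has_derivative_sum bounded_linear.has_derivative[OF bounded_linear_scaleR_right]
        smooth_on_Dif_works[OF _ Q assms]) (auto simp: smooth_bil_def)
  finally show ?thesis by simp
qed

lemma smooth_bil_Dif_bilinear:
  assumes "q \<in> Q"
  shows "bilinear (\<lambda>u w. Dif (\<lambda>p. B p u w) q X)"
proof -
  have "bilinear (\<lambda>u w. \<Sum>a\<in>Basis. \<Sum>b\<in>Basis. ((u \<bullet> a) * (w \<bullet> b)) *\<^sub>R Dif (\<lambda>p. B p a b) q X)"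
    unfolding bilinear_def
    by (auto intro!: linearI simp: inner_add_left distrib_left distrib_right scaleR_left_distrib
        sum.distrib scaleR_sum_right mult_ac)
  moreover have "(\<lambda>u w. Dif (\<lambda>p. B p u w) q X) =
      (\<lambda>u w. \<Sum>a\<in>Basis. \<Sum>b\<in>Basis. ((u \<bullet> a) * (w \<bullet> b)) *\<^sub>R Dif (\<lambda>p. B p a b) q X)"
    by (intro ext smooth_bil_Dif_expand[OF assms])
  ultimately show ?thesis by simp
qed

lemma smooth_bil_has_derivative:
  fixes F :: "'a::euclidean_space \<Rightarrow> 'q"
  assumes F: "(F has_derivative F') (at x)" and Z: "(Z has_derivative Z') (at x)"
    and W: "(W has_derivative W') (at x)" and FQ: "F x \<in> Q"
  shows "((\<lambda>y. B (F y) (Z y) (W y)) has_derivative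
    (\<lambda>X. Dif (\<lambda>p. B p (Z x) (W x)) (F x) (F' X) + B (F x) (Z' X) (W x) + B (F x) (Z x) (W' X))) (at x)"
proof -
  have bil: "bilinear (B q)" if "q \<in> Q" for q using B that by (simp add: smooth_bil_def)
  define D where "D a b X = (Z x \<bullet> a * (W x \<bullet> b)) *\<^sub>R Dif (\<lambda>p. B p a b) (F x) (F' X) +
      ((Z x \<bullet> a) * (W' X \<bullet> b) + (Z' X \<bullet> a) * (W x \<bullet> b)) *\<^sub>R B (F x) a b" for a b X
  have comp: "((\<lambda>y. B (F y) a b) has_derivative (\<lambda>X. Dif (\<lambda>p. B p a b) (F x) (F' X))) (at x)" for a b
    by (rule has_derivative_compose[OF F, where g = "\<lambda>q. B q a b"])
      (use B in \<open>auto intro!: smooth_on_Dif_works[OF _ Q FQ] simp: smooth_bil_def\<close>)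
  have D: "((\<lambda>y. ((Z y \<bullet> a) * (W y \<bullet> b)) *\<^sub>R B (F y) a b) has_derivative D a b) (at x)" for a b
    by (rule has_derivative_eq_rhs[OF has_derivative_scaleR[OF has_derivative_mult[OF
            has_derivative_inner_left[OF Z] has_derivative_inner_left[OF W]] comp]])
       (simp add: D_def fun_eq_iff)
  have "((\<lambda>y. \<Sum>a\<in>Basis. \<Sum>b\<in>Basis. ((Z y \<bullet> a) * (W y \<bullet> b)) *\<^sub>R B (F y) a b) has_derivative
      (\<lambda>X. \<Sum>a\<in>Basis. \<Sum>b\<in>Basis. D a b X)) (at x)"
    by (rule has_derivative_sum, rule has_derivative_sum, rule D)
  moreover have "(\<lambda>X. \<Sum>a\<in>Basis. \<Sum>b\<in>Basis. D a b X) = (\<lambda>X. Dif (\<lambda>p. B p (Z x) (W x)) (F x) (F' X) + B (F x) (Z' X) (W x) + B (F x) (Z x) (W' X))"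
  proof
    fix X
    show "(\<Sum>a\<in>Basis. \<Sum>b\<in>Basis. D a b X) = Dif (\<lambda>p. B p (Z x) (W x)) (F x) (F' X) + B (F x) (Z' X) (W x) + B (F x) (Z x) (W' X)"
      unfolding bilinear_expand[OF bil[OF FQ], of "Z' X"] bilinear_expand[OF bil[OF FQ], of "Z x" "W' X"]
        smooth_bil_Dif_expand[OF FQ, of "Z x" "W x" "F' X"]
      by (simp add: D_def scaleR_left_distrib sum.distrib add_ac)
  qed
  \<comment> \<open>The basis expansion is available only where \<open>F y\<close> lies in
    \<open>Q\<close>, so the derivative is transferred from the sum on a neighbourhood of
    \<open>x\<close>.\<close>
  moreover obtain T where "open T" "x \<in> T" "\<And>y. y \<in> T \<Longrightarrow> F y \<in> Q"
  proof -
    have "isCont F x" using F by (rule has_derivative_continuous)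
    then have "\<forall>\<^sub>F y in nhds x. F y \<in> Q" 
      using Q FQ by (simp add: continuous_at tendsto_def eventually_at_topological eventually_nhds)
         (metis)
    then show ?thesis using that unfolding eventually_nhds by blast
  qed
  ultimately show ?thesis
    using bilinear_expand[OF bil] by (auto elim!: has_derivative_transform_within_open)
qed

lemma smooth_bil_Dif:
  fixes F :: "'a::euclidean_space \<Rightarrow> 'q"
  assumes "F differentiable (at x)" "Z differentiable (at x)" "W differentiable (at x)" "F x \<in> Q"
  shows "Dif (\<lambda>y. B (F y) (Z y) (W y)) x X =
    Dif (\<lambda>p. B p (Z x) (W x)) (F x) (Dif F x X) + B (F x) (Dif Z x X) (W x) + B (F x) (Z x) (Dif W x X)"
  by (subst Dif_eqI[OF smooth_bil_has_derivative]) (use assms in \<open>auto intro: Dif_works\<close>)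

lemma smooth_bil_smooth:
  fixes F :: "'a::euclidean_space \<Rightarrow> 'q"
  assumes "open U" "smooth_on F U" "smooth_on Z U" "smooth_on W U" "F ` U \<subseteq> Q"
  shows "smooth_on (\<lambda>y. B (F y) (Z y) (W y)) U"
proof -
  have "smooth_on (\<lambda>y. \<Sum>a\<in>Basis. \<Sum>b\<in>Basis. ((Z y \<bullet> a) * (W y \<bullet> b)) *\<^sub>R B (F y) a b) U"
  proof (rule smooth_on_sum[OF assms(1)], rule smooth_on_sum[OF assms(1)])
    fix a :: 'u and b :: 'w
    have "smooth_on (\<lambda>q. B q a b) Q" using B by (simp add: smooth_bil_def)
    note comp = smooth_on_compose[OF Q assms(1,5) this assms(2)]
    show "smooth_on (\<lambda>y. ((Z y \<bullet> a) * (W y \<bullet> b)) *\<^sub>R B (F y) a b) U"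
      by (rule smooth_on_scaleR[OF assms(1) smooth_on_mult[OF assms(1)] comp])
         (rule smooth_on_linear[OF bounded_linear_inner_left assms(1)], rule assms)+
  qed
  moreover have "B (F y) (Z y) (W y) = (\<Sum>a\<in>Basis. \<Sum>b\<in>Basis. ((Z y \<bullet> a) * (W y \<bullet> b)) *\<^sub>R B (F y) a b)" if "y \<in> U" for y
    using B that assms by (intro bilinear_expand) (auto simp: smooth_bil_def)
  ultimately show ?thesis by (subst smooth_on_cong[OF assms(1)])
qed

end

section \<open>Riemannian metrics in a chart\<close>

text \<open>Positive definiteness makes the linear map \<open>T\<close> that represents
  \<open>b\<close> in the Euclidean basis injective, hence surjective in finite dimension. This
  gives the description by \<open>THE\<close> in \<open>christoffel\<close> its meaning.\<close>

lemma riesz_unique: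
  fixes b :: "'a::euclidean_space \<Rightarrow> 'a \<Rightarrow> real"
  assumes b: "bilinear b" and pos: "\<And>X. X \<noteq> 0 \<Longrightarrow> b X X > 0" and L: "linear L"
  shows "\<exists>!W. \<forall>Z. b W Z = L Z"
proof -
  have l: "linear (\<lambda>x. b x y)" "linear (b x)" for x y using b by (auto simp: bilinear_def)
  define T where "T W = (\<Sum>e\<in>Basis. b W e *\<^sub>R e)" for W
  have T: "linear T" unfolding T_def
    by (auto intro!: linearI simp: linear_add[OF l(1)] linear_cmul[OF l(1)] scaleR_left_distrib sum.distrib scaleR_sum_right)
  have T_inner: "T W \<bullet> e = b W e" if "e \<in> Basis" for W e
    using that by (simp add: T_def inner_sum_left inner_Basis if_distrib if_distribR sum.delta cong: if_cong)
  have ext: "b W Z = L Z" if "\<And>e. e \<in> Basis \<Longrightarrow> b W e = L e" for W Z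
    by (subst linear_expand[OF l(2)], subst linear_expand[OF L]) (simp add: that)
  have "W = 0" if "T W = 0" for W
  proof (rule ccontr)
    assume "W \<noteq> 0"
    have "b W e = 0" if "e \<in> Basis" for e using T_inner[OF that, of W] \<open>T W = 0\<close> by simp
    then have "b W W = 0" by (subst linear_expand[OF l(2)]) simp
    with pos[OF \<open>W \<noteq> 0\<close>] show False by simp
  qed
  then have inj: "inj T" using T by (simp add: linear_injective_0)
  then have "surj T" using T by (simp add: linear_injective_imp_surjective)
  then obtain W where W: "T W = (\<Sum>e\<in>Basis. L e *\<^sub>R e)" by (metis surjD)
  have "b W e = L e" if "e \<in> Basis" for e
    using that T_inner[OF that, of W] unfolding W
    by (simp add: inner_sum_left inner_Basis if_distrib if_distribR sum.delta cong: if_cong)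
  then have ex: "\<forall>Z. b W Z = L Z" using ext by blast
  moreover have "W' = W" if "\<forall>Z. b W' Z = L Z" for W'
    using inj ex that by (auto simp: T_def inj_def)
  ultimately show ?thesis by blast
qed

locale riemannian_chart =
  fixes g :: "'a::euclidean_space \<Rightarrow> 'a \<Rightarrow> 'a \<Rightarrow> real" and Q :: "'a set"
  assumes open_Q: "open Q"
    and bilinear_g: "\<And>q. q \<in> Q \<Longrightarrow> bilinear (g q)"
    and sym_g: "\<And>q X Y. q \<in> Q \<Longrightarrow> g q X Y = g q Y X"
    and pos_g: "\<And>q X. q \<in> Q \<Longrightarrow> X \<noteq> 0 \<Longrightarrow> g q X X > 0"
    and smooth_g: "\<And>X Y. smooth_on (\<lambda>q. g q X Y) Q"
begin

lemma smooth_bil_g: "smooth_bil g Q"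
  using bilinear_g smooth_g by (simp add: smooth_bil_def)

lemma g_simps:
  assumes "q \<in> Q"
  shows "g q (X + Y) Z = g q X Z + g q Y Z" "g q Z (X + Y) = g q Z X + g q Z Y"
    "g q (X - Y) Z = g q X Z - g q Y Z" "g q Z (X - Y) = g q Z X - g q Z Y"
    "g q (c *\<^sub>R X) Z = c * g q X Z" "g q Z (c *\<^sub>R X) = c * g q Z X"
    "g q (- X) Z = - g q X Z" "g q Z (- X) = - g q Z X" "g q 0 Z = 0" "g q Z 0 = 0"
  using bilinear_g[OF assms]
  by (auto simp: bilinear_ladd bilinear_radd bilinear_lsub bilinear_rsub bilinear_lmul bilinear_rmul
      bilinear_lneg bilinear_rneg bilinear_lzero bilinear_rzero)

lemma g_eqI:
  assumes "q \<in> Q" "\<And>Z. g q W Z = g q W' Z"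
  shows "W = W'"
proof (rule ccontr)
  assume "W \<noteq> W'"
  then have "g q (W - W') (W - W') > 0" using pos_g[OF assms(1)] by simp
  then show False using assms by (simp add: g_simps)
qed

abbreviation "\<Gamma> \<equiv> christoffel g"

definition dg :: "'a \<Rightarrow> 'a \<Rightarrow> 'a \<Rightarrow> 'a \<Rightarrow> real" where
  "dg q X Y Z = Dif (\<lambda>p. g p Y Z) q X"

lemma dg_linear:
  assumes "q \<in> Q"
  shows "linear (\<lambda>X. dg q X Y Z)" "linear (\<lambda>Y. dg q X Y Z)" "linear (\<lambda>Z. dg q X Y Z)"
  using smooth_bil_Dif_bilinear[OF open_Q smooth_bil_g assms, of X]
    Dif_linear[OF smooth_on_differentiable[OF smooth_g open_Q assms], of Y Z]
  by (auto simp: dg_def bilinear_def)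

lemma dg_simps:
  assumes "q \<in> Q"
  shows "dg q (X + X') Y Z = dg q X Y Z + dg q X' Y Z" "dg q X (Y + Y') Z = dg q X Y Z + dg q X Y' Z"
    "dg q X Y (Z + Z') = dg q X Y Z + dg q X Y Z'"
    "dg q (c *\<^sub>R X) Y Z = c * dg q X Y Z" "dg q X (c *\<^sub>R Y) Z = c * dg q X Y Z"
    "dg q X Y (c *\<^sub>R Z) = c * dg q X Y Z"
    "dg q (- X) Y Z = - dg q X Y Z" "dg q X (- Y) Z = - dg q X Y Z"
    "dg q X Y (- Z) = - dg q X Y Z"
  using linear_add[OF dg_linear(1)[OF assms]] linear_add[OF dg_linear(2)[OF assms]]
    linear_add[OF dg_linear(3)[OF assms]] linear_cmul[OF dg_linear(1)[OF assms]]
    linear_cmul[OF dg_linear(2)[OF assms]] linear_cmul[OF dg_linear(3)[OF assms]]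
    linear_neg[OF dg_linear(1)[OF assms]] linear_neg[OF dg_linear(2)[OF assms]]
    linear_neg[OF dg_linear(3)[OF assms]]
  by simp_all

lemma dg_sym: "q \<in> Q \<Longrightarrow> dg q X Y Z = dg q X Z Y"
  unfolding dg_def by (intro fun_cong[OF Dif_cong[OF open_Q]]) (auto simp: sym_g)

lemma christoffel_koszul:
  assumes "q \<in> Q"
  shows "g q (\<Gamma> q X Y) Z = (dg q X Y Z + dg q Y X Z - dg q Z X Y) / 2"
proof -
  have "linear (\<lambda>Z. (dg q X Y Z + dg q Y X Z - dg q Z X Y) / 2)"
    by (rule linearI) (auto simp: dg_simps[OF assms] algebra_simps add_divide_distrib diff_divide_distrib)
  from riesz_unique[OF bilinear_g[OF assms] pos_g[OF assms] this]
  have "\<exists>!W. \<forall>Z. g q W Z = (dg q X Y Z + dg q Y X Z - dg q Z X Y) / 2" .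
  from theI'[OF this] show ?thesis unfolding christoffel_def dg_def by blast
qed

lemma christoffel_unique:
  assumes "q \<in> Q" "\<And>Z. g q W Z = (dg q X Y Z + dg q Y X Z - dg q Z X Y) / 2"
  shows "\<Gamma> q X Y = W"
  by (rule g_eqI[OF assms(1)]) (simp add: assms christoffel_koszul)

lemma christoffel_sym: "q \<in> Q \<Longrightarrow> \<Gamma> q X Y = \<Gamma> q Y X"
  by (rule christoffel_unique) (auto simp: christoffel_koszul dg_sym[of q _ X Y])

lemma christoffel_bilinear:
  assumes "q \<in> Q"
  shows "bilinear (\<Gamma> q)"
proof -
  have *: "linear (\<Gamma> q X)" for X
    by (rule linearI; rule g_eqI[OF assms])
       (simp_all add: christoffel_koszul g_simps dg_simps assms algebra_simps add_divide_distrib diff_divide_distrib)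
  moreover have "(\<lambda>X. \<Gamma> q X Y) = \<Gamma> q Y" for Y
    by (rule ext) (rule christoffel_sym[OF assms])
  ultimately show ?thesis by (simp add: bilinear_def)
qed

lemma christoffel_simps:
  assumes "q \<in> Q"
  shows "\<Gamma> q (X + Y) Z = \<Gamma> q X Z + \<Gamma> q Y Z" "\<Gamma> q Z (X + Y) = \<Gamma> q Z X + \<Gamma> q Z Y"
    "\<Gamma> q (X - Y) Z = \<Gamma> q X Z - \<Gamma> q Y Z" "\<Gamma> q Z (X - Y) = \<Gamma> q Z X - \<Gamma> q Z Y"
    "\<Gamma> q (c *\<^sub>R X) Z = c *\<^sub>R \<Gamma> q X Z" "\<Gamma> q Z (c *\<^sub>R X) = c *\<^sub>R \<Gamma> q Z X"
    "\<Gamma> q (- X) Z = - \<Gamma> q X Z" "\<Gamma> q Z (- X) = - \<Gamma> q Z X" "\<Gamma> q 0 Z = 0" "\<Gamma> q Z 0 = 0"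
  using christoffel_bilinear[OF assms]
  by (auto simp: bilinear_ladd bilinear_radd bilinear_lsub bilinear_rsub bilinear_lmul bilinear_rmul
      bilinear_lneg bilinear_rneg bilinear_lzero bilinear_rzero)

lemma metric_compatible:
  assumes "q \<in> Q"
  shows "dg q X Y Z = g q (\<Gamma> q X Y) Z + g q Y (\<Gamma> q X Z)"
  using sym_g[OF assms, of Y "\<Gamma> q X Z"] christoffel_koszul[OF assms, of X Y Z]
    christoffel_koszul[OF assms, of X Z Y] dg_sym[OF assms, of X Y Z] dg_sym[OF assms, of Y X Z]
    dg_sym[OF assms, of Z X Y]
  by simp

end

section \<open>Polarisation of curvature-like forms\<close>

text \<open>Complex polarisation: since slots 1 and 3 are linear and slots 2 and 4 antilinear,
  inserting multiples by roots of unity separates the terms by type, and the two symmetries then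
  recover all values from the diagonal. It reduces the curvature tensor to holomorphic sectional
  curvature.\<close>

lemma sesquilinear_polarization:
  fixes f :: "'v::ab_group_add \<Rightarrow> 'v \<Rightarrow> 'v \<Rightarrow> 'v \<Rightarrow> complex"
  assumes add: "\<And>X X' Y Z W. f (X + X') Y Z W = f X Y Z W + f X' Y Z W"
    "\<And>X Y Y' Z W. f X (Y + Y') Z W = f X Y Z W + f X Y' Z W"
    "\<And>X Y Z Z' W. f X Y (Z + Z') W = f X Y Z W + f X Y Z' W"
    "\<And>X Y Z W W'. f X Y Z (W + W') = f X Y Z W + f X Y Z W'"
    and J: "\<And>X Y Z W. f (J X) Y Z W = \<i> * f X Y Z W"
      "\<And>X Y Z W. f X (J Y) Z W = - \<i> * f X Y Z W"
      "\<And>X Y Z W. f X Y (J Z) W = \<i> * f X Y Z W"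
      "\<And>X Y Z W. f X Y Z (J W) = - \<i> * f X Y Z W"
    and sym: "\<And>X Y Z W. f X Y Z W = f Z Y X W" "\<And>X Y Z W. f X Y Z W = f X W Z Y"
    and diag: "\<And>X. f X X X X = 0"
  shows "f X Y Z W = 0"
proof -
  have zero: "f 0 Y Z W = 0" "f Y 0 Z W = 0" "f Y Z 0 W = 0" "f Y Z W 0 = 0" for Y Z W
    using add(1)[of 0 0 Y Z W] add(2)[of Y 0 0 Z W] add(3)[of Y Z 0 0 W] add(4)[of Y Z W 0 0] by simp_all
  have neg: "f (- X) Y Z W = - f X Y Z W" "f X (- Y) Z W = - f X Y Z W"
    "f X Y (- Z) W = - f X Y Z W" "f X Y Z (- W) = - f X Y Z W" for X Y Z W
    using add(1)[of X "- X" Y Z W] add(2)[of X Y "- Y" Z W]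
      add(3)[of X Y Z "- Z" W] add(4)[of X Y Z W "- W"]
    unfolding eq_neg_iff_add_eq_0 by (simp_all add: zero add.commute)
  have *: "f Y X Y X + f X Y X Y = 0" for X Y
  proof -
    \<comment> \<open>With u running over the fourth roots of unity, X + u Y is weighted by u^2.
      This keeps exactly the terms whose numbers of \<open>Y\<close> in the linear and in the
      antilinear slots differ by two.\<close>
    have "f (X + Y) (X + Y) (X + Y) (X + Y) + f (X + - Y) (X + - Y) (X + - Y) (X + - Y)
      - f (X + J Y) (X + J Y) (X + J Y) (X + J Y) - f (X + - J Y) (X + - J Y) (X + - J Y) (X + - J Y) = 0"
      by (simp only: diag) simp
    then have "4 * (f Y X Y X + f X Y X Y) = 0" unfolding add neg J by (simp add: algebra_simps)
    then show ?thesis by (metis mult_eq_0_iff zero_neq_numeral)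
  qed
  have d: "f Y X Y X = 0" for X Y
  proof -
    \<comment> \<open>Passing from \<open>Y\<close> to \<open>Y + J Y\<close> scales the two terms
      by (1 + i)^2 = 2i and (1 - i)^2 = -2i, so their difference vanishes along with their
      sum.\<close>
    have "f (Y + J Y) X (Y + J Y) X + f X (Y + J Y) X (Y + J Y) = 0" by (rule *)
    then have "2 * \<i> * (f Y X Y X - f X Y X Y) = 0" unfolding add J by (simp add: algebra_simps)
    then have "f Y X Y X - f X Y X Y = 0" by (metis mult_eq_0_iff zero_neq_numeral complex_i_not_zero)
    then have "f Y X Y X = f X Y X Y" by simp
    then have "2 * f Y X Y X = 0" using *[of Y X] by simp
    then show ?thesis by simp
  qed
  have e: "f Y X Z X = 0" for X Y Z
  proof -
    have "f (Y + Z) X (Y + Z) X = f Y X Y X + f Z X Z X + (f Y X Z X + f Z X Y X)"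
      unfolding add by (simp add: algebra_simps)
    then have "2 * f Y X Z X = 0" unfolding d sym(1)[of Z X Y X] by simp
    then show ?thesis by (metis mult_eq_0_iff zero_neq_numeral)
  qed
  have "f X (Y + W) Z (Y + W) = f X Y Z Y + f X W Z W + (f X Y Z W + f X W Z Y)"
    unfolding add by (simp add: algebra_simps)
  then have "2 * f X Y Z W = 0" unfolding e sym(2)[of X W Z Y] by simp
  then show ?thesis by (metis mult_eq_0_iff zero_neq_numeral)
qed

section \<open>Complex vectors\<close>

lemma JC_simps:
  fixes X Y :: "complex^'n"
  shows "JC (X + Y) = JC X + JC Y" "JC (X - Y) = JC X - JC Y" "JC (- X) = - JC X"
    "JC (r *\<^sub>R X) = r *\<^sub>R JC X" "JC (JC X) = - X" "JC (0::complex^'n) = 0"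
  by (simp_all add: vec_eq_iff algebra_simps)

lemma scalar_eq_JC: "c *s (X::complex^'n) = Re c *\<^sub>R X + Im c *\<^sub>R JC X"
  by (auto simp: vec_eq_iff complex_eq_iff algebra_simps)

lemma bounded_linear_JC: "bounded_linear (JC :: complex^'n \<Rightarrow> complex^'n)"
  by (intro linear_conv_bounded_linear[THEN iffD1] linearI) (simp_all add: JC_simps)

lemma bounded_bilinear_scalar: "bounded_bilinear ((*s) :: complex \<Rightarrow> complex^'n \<Rightarrow> complex^'n)"
  unfolding bilinear_conv_bounded_bilinear[symmetric] bilinear_def
  by (auto intro!: linearI simp: vec_eq_iff algebra_simps)

lemma smooth_on_JC: "open S \<Longrightarrow> smooth_on f S \<Longrightarrow> smooth_on (\<lambda>x. JC (f x :: complex^'n)) S"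
  by (rule smooth_on_linear[OF bounded_linear_JC])

lemma smooth_on_scalar:
  "open S \<Longrightarrow> smooth_on f S \<Longrightarrow> smooth_on g S \<Longrightarrow> smooth_on (\<lambda>x. f x *s (g x :: complex^'n)) S"
  by (rule smooth_on_bilinear[OF bounded_bilinear_scalar])

text \<open>For a metric preserved by \<open>JC\<close> this is linear in \<open>X\<close> and
  antilinear in \<open>Y\<close>. Under the identification of T'N with the real tangent space it is
  twice the Hermitian form of T'N, see \<open>herm_emb\<close>.\<close>

definition hform :: "(complex^'n \<Rightarrow> complex^'n \<Rightarrow> real) \<Rightarrow> complex^'n \<Rightarrow> complex^'n \<Rightarrow> complex" where
  "hform b X Y = Complex (b X Y) (b X (JC Y))"

section \<open>Kaehler metrics of constant holomorphic sectional curvature in a chart\<close>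

locale kaehler_chart = riemannian_chart g Q
  for g :: "complex^'n \<Rightarrow> complex^'n \<Rightarrow> complex^'n \<Rightarrow> real" and Q +
  fixes \<kappa> :: real
  assumes J_g: "\<And>q X Y. q \<in> Q \<Longrightarrow> g q (JC X) (JC Y) = g q X Y"
    and closed_form: "\<And>q X Y Z. q \<in> Q \<Longrightarrow>
        Dif (\<lambda>p. g p (JC Y) Z) q X + Dif (\<lambda>p. g p (JC Z) X) q Y + Dif (\<lambda>p. g p (JC X) Y) q Z = 0"
    and sec_curv: "\<And>q X. q \<in> Q \<Longrightarrow> X \<noteq> 0 \<Longrightarrow> sec_curv g q X (JC X) = \<kappa>"
begin

abbreviation "H q \<equiv> hform (g q)"

lemma g_J_left: "q \<in> Q \<Longrightarrow> g q (JC X) Y = - g q X (JC Y)"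
  using J_g[of q X "JC Y"] by (simp add: JC_simps g_simps)

lemma H_simps:
  assumes "q \<in> Q"
  shows "H q (X + Y) Z = H q X Z + H q Y Z" "H q Z (X + Y) = H q Z X + H q Z Y"
    "H q (X - Y) Z = H q X Z - H q Y Z" "H q Z (X - Y) = H q Z X - H q Z Y"
    "H q (c *s X) Z = c * H q X Z" "H q Z (c *s X) = cnj c * H q Z X"
    "H q (r *\<^sub>R X) Z = r * H q X Z" "H q Z (r *\<^sub>R X) = r * H q Z X"
    "H q (- X) Z = - H q X Z" "H q Z (- X) = - H q Z X" "H q 0 Z = 0" "H q Z 0 = 0"
  unfolding scalar_eq_JC[of c]
  by (simp_all add: assms hform_def complex_eq_iff g_simps JC_simps g_J_left)

lemma H_J:
  assumes "q \<in> Q"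
  shows "H q (JC X) Z = \<i> * H q X Z" "H q Z (JC X) = - \<i> * H q Z X"
  using H_simps(5,6)[OF assms, where c = \<i>] by simp_all

lemma H_cnj: "q \<in> Q \<Longrightarrow> cnj (H q X Y) = H q Y X"
  using sym_g[of q] g_J_left[of q X Y] by (auto simp: hform_def complex_eq_iff)

lemma H_eqI:
  assumes "q \<in> Q" "\<And>Z. H q W Z = H q W' Z"
  shows "W = W'"
  using g_eqI[OF assms(1)] assms(2) by (auto simp: hform_def)

lemma H_bilinear: "q \<in> Q \<Longrightarrow> bilinear (H q)"
  unfolding bilinear_def by (auto intro!: linearI simp: H_simps scaleR_conv_of_real[where 'a = complex])

lemma smooth_bil_H: "smooth_bil (\<lambda>q. H q) Q"
proof -
  have "smooth_on (\<lambda>q. H q X Y) Q" for X Y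
  proof -
    have "smooth_on (\<lambda>q. g q X Y *\<^sub>R (1::complex) + g q X (JC Y) *\<^sub>R \<i>) Q"
      by (intro smooth_on_add smooth_on_scaleR smooth_g open_Q smooth_on_const)
    moreover have "(\<lambda>q. H q X Y) = (\<lambda>q. g q X Y *\<^sub>R (1::complex) + g q X (JC Y) *\<^sub>R \<i>)"
      by (simp add: fun_eq_iff hform_def complex_eq_iff)
    ultimately show ?thesis by simp
  qed
  then show ?thesis using H_bilinear by (simp add: smooth_bil_def)
qed

lemma dg_J: "q \<in> Q \<Longrightarrow> dg q X (JC Y) (JC Z) = dg q X Y Z"
  unfolding dg_def by (intro fun_cong[OF Dif_cong[OF open_Q]]) (auto simp: J_g)

lemma dg_J_left: "q \<in> Q \<Longrightarrow> dg q X (JC Y) Z = - dg q X Y (JC Z)"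
  using dg_J[of q X Y "JC Z"] by (simp add: JC_simps dg_simps)

text \<open>The holomorphic charts make the complex structure constant, so that the closedness of the
  fundamental form says that it is parallel.\<close>

lemma christoffel_J:
  assumes q: "q \<in> Q"
  shows "\<Gamma> q X (JC Y) = JC (\<Gamma> q X Y)" "\<Gamma> q (JC Y) X = JC (\<Gamma> q Y X)"
proof -
  show *: "\<Gamma> q X (JC Y) = JC (\<Gamma> q X Y)" for X Y
  proof (rule christoffel_unique[OF q])
    fix Z
    \<comment> \<open>Closedness is used for (X, Y, Z) and for (X, JY, JZ); the two instances
      convert the Koszul formula of \<open>JC (\<Gamma> q X Y)\<close> into that of
      \<open>\<Gamma> q X (JC Y)\<close>.\<close>
    have 1: "dg q X (JC Y) Z + dg q Y (JC Z) X + dg q Z (JC X) Y = 0"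
      using closed_form[OF q, of Y Z X] by (simp add: dg_def)
    have 2: "dg q X (JC (JC Y)) (JC Z) + dg q (JC Y) (JC (JC Z)) X + dg q (JC Z) (JC X) (JC Y) = 0"
      using closed_form[OF q, of "JC Y" "JC Z" X] by (simp add: dg_def)
    have "g q (JC (\<Gamma> q X Y)) Z = - (dg q X Y (JC Z) + dg q Y X (JC Z) - dg q (JC Z) X Y) / 2"
      by (simp add: g_J_left q christoffel_koszul field_simps)
    moreover have "x = (d + e - f) / 2"
      if "x = - (a + b - c) / 2" "d + b + - f = 0" "- a + - e + c = 0" "d = - a" for a b c d e f x :: real
      using that by simp
    ultimately show "g q (JC (\<Gamma> q X Y)) Z = (dg q X (JC Y) Z + dg q (JC Y) X Z - dg q Z X (JC Y)) / 2"
      using 1[unfolded dg_sym[OF q, of Y "JC Z" X] dg_J_left[OF q, of Z X Y]]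
        2[unfolded JC_simps dg_simps[OF q] dg_J[OF q] dg_sym[OF q, of "JC Y" Z X]]
        dg_J_left[OF q, of X Y Z]
      by blast
  qed
  show "\<Gamma> q (JC Y) X = JC (\<Gamma> q Y X)"
    using *[of X Y] christoffel_sym[OF q] by simp
qed

lemma christoffel_scalar:
  assumes "q \<in> Q"
  shows "\<Gamma> q X (c *s Y) = c *s \<Gamma> q X Y" "\<Gamma> q (c *s X) Y = c *s \<Gamma> q X Y"
  unfolding scalar_eq_JC[of c] by (simp_all add: christoffel_simps christoffel_J assms)

text \<open>Cramer's rule for the Gram matrix of the Hermitian form expresses the Christoffel symbols
  through derivatives of the metric.\<close>

lemma smooth_christoffel: "smooth_on (\<lambda>q. \<Gamma> q X Y) Q"
proof -
  define e :: "'n \<Rightarrow> complex^'n" where "e i = axis i 1" for i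
  define G :: "complex^'n \<Rightarrow> complex^'n^'n" where "G q = (\<chi> i j. H q (e i) (e j))" for q
  define K where "K q Z = (dg q X Y Z + dg q Y X Z - dg q Z X Y) / 2" for q Z
  \<comment> \<open>The Koszul values on \<open>e j\<close> and \<open>JC (e j)\<close> are the real
    and imaginary parts of the pairing of \<open>\<Gamma> q X Y\<close> with \<open>e j\<close>
    under \<open>H q\<close>, so \<open>b\<close> is the right-hand side of a complex linear
    system.\<close>
  define b :: "complex^'n \<Rightarrow> complex^'n" where "b q = (\<chi> j. Complex (K q (e j)) (K q (JC (e j))))" for q
  have expand: "(\<Sum>i\<in>UNIV. W$i *s e i) = W" for W :: "complex^'n"
    unfolding e_def by (rule basis_expansion)
  have H_expand: "H q W Z = (\<Sum>i\<in>UNIV. W$i * H q (e i) Z)" if "q \<in> Q" for q W Z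
  proof -
    have "linear (\<lambda>W. H q W Z)" using H_bilinear[OF that] by (simp add: bilinear_def)
    then have "H q (\<Sum>i\<in>UNIV. W$i *s e i) Z = (\<Sum>i\<in>UNIV. H q (W$i *s e i) Z)" by (rule linear_sum)
    then show ?thesis by (simp add: expand H_simps that)
  qed
  have det: "det (G q) \<noteq> 0" if q: "q \<in> Q" for q
  proof -
    \<comment> \<open>A kernel vector of the transposed Gram matrix is orthogonal to every
      \<open>e j\<close>, hence to itself.\<close>
    have "W = 0" if "transpose (G q) *v W = 0" for W
    proof -
      have 0: "H q W (e j) = 0" for j
      proof -
        have "(transpose (G q) *v W) $ j = H q W (e j)"
          unfolding H_expand[OF q, of W] by (simp add: matrix_vector_mult_def transpose_def G_def mult.commute)
        then show ?thesis using that by simp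
      qed
      have "H q (e j) W = 0" for j using 0[of j] H_cnj[OF q, of W "e j"] by simp
      then have "H q W W = 0" unfolding H_expand[OF q, of W W] by simp
      then show "W = 0" using pos_g[OF q, of W] by (auto simp: hform_def complex_eq_iff)
    qed
    then have "invertible (transpose (G q))"
      using matrix_left_invertible_ker[of "transpose (G q)"] invertible_left_inverse by blast
    then show ?thesis by (simp add: invertible_det_nz det_transpose)
  qed
  have comp: "\<Gamma> q X Y $ k = det (\<chi> i j. if i = k then b q $ j else G q $ i $ j) * inverse (det (G q))"
    if q: "q \<in> Q" for q k
  proof -
    let ?W = "\<Gamma> q X Y"
    have 1: "(\<Sum>i\<in>UNIV. ?W$i *s row i (G q)) = b q"
    proof (rule vec_eq_iff[THEN iffD2, rule_format])
      fix j
      have "(\<Sum>i\<in>UNIV. ?W$i *s row i (G q)) $ j = H q ?W (e j)"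
        unfolding H_expand[OF q, of ?W] by (simp add: row_def G_def)
      also have "\<dots> = b q $ j" by (simp add: b_def hform_def christoffel_koszul q K_def)
      finally show "(\<Sum>i\<in>UNIV. ?W$i *s row i (G q)) $ j = b q $ j" .
    qed
    have 2: "(\<chi> i. if i = k then b q else row i (G q)) = (\<chi> i j. if i = k then b q $ j else G q $ i $ j)"
      by (simp add: vec_eq_iff row_def)
    have "det (\<chi> i j. if i = k then b q $ j else G q $ i $ j) = ?W $ k * det (G q)"
      using cramer_lemma_transpose[of k ?W "G q"] unfolding 1 2 .
    then show ?thesis using det[OF q] by simp
  qed
  have smooth_det: "smooth_on (\<lambda>q. det (M q)) Q"
    if "\<And>i j. smooth_on (\<lambda>q. M q $ i $ j) Q" for M :: "complex^'n \<Rightarrow> complex^'n^'n"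
    unfolding det_def
    by (rule smooth_on_sum[OF open_Q], rule smooth_on_mult[OF open_Q smooth_on_const],
        rule smooth_on_prod[OF open_Q], rule that)
  have G: "smooth_on (\<lambda>q. G q $ i $ j) Q" for i j
    using smooth_bil_H by (simp add: G_def smooth_bil_def)
  have K: "smooth_on (\<lambda>q. K q Z) Q" for Z
  proof -
    have "smooth_on (\<lambda>q. dg q X Y Z + dg q Y X Z - dg q Z X Y) Q"
      unfolding dg_def
      by (intro smooth_on_add smooth_on_diff smooth_on_Dif smooth_g open_Q)
    from smooth_on_linear[OF bounded_linear_divide open_Q this, of 2] show ?thesis by (simp add: K_def)
  qed
  have b: "smooth_on (\<lambda>q. b q $ j) Q" for j
  proof -
    have "smooth_on (\<lambda>q. K q (e j) *\<^sub>R (1::complex) + K q (JC (e j)) *\<^sub>R \<i>) Q"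
      by (intro smooth_on_add smooth_on_scaleR K open_Q smooth_on_const)
    moreover have "(\<lambda>q. b q $ j) = (\<lambda>q. K q (e j) *\<^sub>R (1::complex) + K q (JC (e j)) *\<^sub>R \<i>)"
      by (simp add: fun_eq_iff b_def complex_eq_iff)
    ultimately show ?thesis by simp
  qed
  have "smooth_on (\<lambda>q. det (\<chi> i j. if i = k then b q $ j else G q $ i $ j) * inverse (det (G q))) Q" for k
  proof (rule smooth_on_mult[OF open_Q smooth_det smooth_on_inverse[OF open_Q smooth_det[OF G] det]])
    show "smooth_on (\<lambda>q. (\<chi> i j. if i = k then b q $ j else G q $ i $ j) $ i $ j) Q" for i j
      by (cases "i = k") (simp_all add: G b)
  qed
  then have "smooth_on (\<lambda>q. \<Sum>k\<in>UNIV. (det (\<chi> i j. if i = k then b q $ j else G q $ i $ j) * inverse (det (G q))) *s e k) Q"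
    by (intro smooth_on_sum open_Q smooth_on_scalar smooth_on_const)
  moreover have "\<Gamma> q X Y = (\<Sum>k\<in>UNIV. (det (\<chi> i j. if i = k then b q $ j else G q $ i $ j) * inverse (det (G q))) *s e k)" if "q \<in> Q" for q
    using expand[of "\<Gamma> q X Y"] comp[OF that] by simp
  ultimately show ?thesis by (subst smooth_on_cong[OF open_Q])
qed

lemma smooth_bil_christoffel: "smooth_bil \<Gamma> Q"
  using christoffel_bilinear smooth_christoffel by (simp add: smooth_bil_def)

end

section \<open>Covariant derivatives along a map\<close>

text \<open>The domain is an arbitrary Euclidean space because the same calculus is applied to a
  coordinate patch of the sphere, to the identity of a target chart, and to a variation as a map of
  time and coordinate jointly.\<close>

locale kaehler_map = kaehler_chart g Q \<kappa>
  for g :: "complex^'n \<Rightarrow> complex^'n \<Rightarrow> complex^'n \<Rightarrow> real" and Q \<kappa> +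
  fixes F :: "'a::euclidean_space \<Rightarrow> complex^'n" and U :: "'a set"
  assumes open_U: "open U" and smooth_F: "smooth_on F U" and F_Q: "F ` U \<subseteq> Q"
begin

lemma F_in: "x \<in> U \<Longrightarrow> F x \<in> Q"
  using F_Q by blast

lemma diff_F: "x \<in> U \<Longrightarrow> F differentiable (at x)"
  by (rule smooth_on_differentiable[OF smooth_F open_U])

lemma diff_sec: "smooth_on Z U \<Longrightarrow> x \<in> U \<Longrightarrow> Z differentiable (at x)"
  by (rule smooth_on_differentiable[OF _ open_U])

lemma smooth_DF: "smooth_on (\<lambda>x. Dif F x X) U"
  by (rule smooth_on_Dif[OF open_U smooth_F])

lemma smooth_cov: "smooth_on Z U \<Longrightarrow> smooth_on (cov g F X Z) U"
  unfolding cov_def[abs_def]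
  by (rule smooth_on_add[OF open_U smooth_on_Dif[OF open_U]
      smooth_bil_smooth[OF open_Q smooth_bil_christoffel open_U smooth_F smooth_DF _ F_Q]])

lemma cov_cong:
  assumes "x \<in> U" "\<And>y. y \<in> U \<Longrightarrow> Z y = W y"
  shows "cov g F X Z x = cov g F X W x"
  using Dif_cong[OF open_U assms, of "\<lambda>y. y"] assms by (simp add: cov_def)

lemma cov_add:
  assumes "smooth_on Z U" "smooth_on W U" "x \<in> U"
  shows "cov g F X (\<lambda>y. Z y + W y) x = cov g F X Z x + cov g F X W x"
  unfolding cov_def
  by (subst Dif_eqI[OF has_derivative_add[OF smooth_on_Dif_works[OF assms(1) open_U assms(3)]
          smooth_on_Dif_works[OF assms(2) open_U assms(3)]]])
     (simp add: christoffel_simps F_in assms)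

lemma cov_linear:
  assumes "bounded_linear L" "smooth_on Z U" "x \<in> U"
    and "\<And>q Y W. q \<in> Q \<Longrightarrow> christoffel g q Y (L W) = L (christoffel g q Y W)"
  shows "cov g F X (\<lambda>y. L (Z y)) x = L (cov g F X Z x)"
  unfolding cov_def
  by (subst Dif_eqI[OF bounded_linear.has_derivative[OF assms(1) smooth_on_Dif_works[OF assms(2) open_U assms(3)]]])
     (simp add: assms(3,4) F_in linear_add[OF bounded_linear.linear[OF assms(1)]])

lemma cov_JC:
  assumes "smooth_on Z U" "x \<in> U"
  shows "cov g F X (\<lambda>y. JC (Z y)) x = JC (cov g F X Z x)"
  by (rule cov_linear[OF bounded_linear_JC assms]) (rule christoffel_J)

lemma cov_scaleR:
  assumes "smooth_on Z U" "x \<in> U"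
  shows "cov g F X (\<lambda>y. r *\<^sub>R Z y) x = r *\<^sub>R cov g F X Z x"
  by (rule cov_linear[OF bounded_linear_scaleR_right assms]) (rule christoffel_simps)

lemma cov_minus:
  assumes "smooth_on Z U" "x \<in> U"
  shows "cov g F X (\<lambda>y. - Z y) x = - cov g F X Z x"
  by (rule cov_linear[OF bounded_linear_minus[OF bounded_linear_ident] assms]) (rule christoffel_simps)

lemma cov_diff:
  assumes "smooth_on Z U" "smooth_on W U" "x \<in> U"
  shows "cov g F X (\<lambda>y. Z y - W y) x = cov g F X Z x - cov g F X W x"
  using cov_add[OF assms(1) smooth_on_minus[OF open_U assms(2)] assms(3)] cov_minus[OF assms(2,3)] by simp

lemma cov_scalar:
  assumes "smooth_on f U" "smooth_on Z U" "x \<in> U"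
  shows "cov g F X (\<lambda>y. f y *s Z y) x = Dif f x X *s Z x + f x *s cov g F X Z x"
  unfolding cov_def
  by (subst Dif_eqI[OF bounded_bilinear.FDERIV[OF bounded_bilinear_scalar smooth_on_Dif_works[OF assms(1) open_U assms(3)]
          smooth_on_Dif_works[OF assms(2) open_U assms(3)]]])
     (simp add: christoffel_scalar F_in assms vector_add_ldistrib)

lemma cov_dir:
  assumes "smooth_on Z U" "x \<in> U"
  shows "cov g F (X + Y) Z x = cov g F X Z x + cov g F Y Z x"
    "cov g F (r *\<^sub>R X) Z x = r *\<^sub>R cov g F X Z x"
    "cov g F (- X) Z x = - cov g F X Z x"
  using Dif_linear[OF diff_sec[OF assms]] Dif_linear[OF diff_F[OF assms(2)]] F_in[OF assms(2)]
  by (simp_all add: cov_def linear_add linear_cmul linear_neg christoffel_simps scaleR_add_right)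

text \<open>Two sign changes cancel, so a second derivative in direction \<open>e2\<close> survives
  the replacement of \<open>e2\<close> by \<open>- e2\<close> that defines the conjugate
  operators.\<close>

lemma cov_neg_neg:
  assumes "smooth_on Z U" "x \<in> U" "\<And>y. y \<in> U \<Longrightarrow> W y = - Z y"
  shows "cov g F (- X) W x = cov g F X Z x"
proof -
  have "cov g F (- X) W x = cov g F (- X) (\<lambda>y. - Z y) x" by (rule cov_cong[OF assms(2,3)])
  then show ?thesis by (simp add: cov_minus[OF assms(1,2)] cov_dir(3)[OF assms(1,2)])
qed

text \<open>The real part is metric compatibility; the imaginary part is the same identity with
  \<open>JC W\<close>, because \<open>JC\<close> is parallel.\<close>

lemma Dif_H_const:
  assumes "q \<in> Q"
  shows "Dif (\<lambda>p. H p Z W) q X = H q (\<Gamma> q X Z) W + H q Z (\<Gamma> q X W)"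
proof -
  have d: "((\<lambda>p. g p Y Y') has_derivative (\<lambda>X. dg q X Y Y')) (at q)" for Y Y'
    using smooth_on_Dif_works[OF smooth_g open_Q assms] by (simp add: dg_def)
  have "((\<lambda>p. g p Z W *\<^sub>R (1::complex) + g p Z (JC W) *\<^sub>R \<i>) has_derivative
     (\<lambda>X. dg q X Z W *\<^sub>R (1::complex) + dg q X Z (JC W) *\<^sub>R \<i>)) (at q)"
    by (rule has_derivative_add[OF has_derivative_scaleR_left[OF d] has_derivative_scaleR_left[OF d]])
  from fun_cong[OF Dif_eqI[OF this], of X]
  have "Dif (\<lambda>p. g p Z W *\<^sub>R (1::complex) + g p Z (JC W) *\<^sub>R \<i>) q X =
      dg q X Z W *\<^sub>R (1::complex) + dg q X Z (JC W) *\<^sub>R \<i>" .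
  moreover have "(\<lambda>p. H p Z W) = (\<lambda>p. g p Z W *\<^sub>R (1::complex) + g p Z (JC W) *\<^sub>R \<i>)"
    by (simp add: fun_eq_iff hform_def complex_eq_iff)
  ultimately have "Dif (\<lambda>p. H p Z W) q X = dg q X Z W *\<^sub>R (1::complex) + dg q X Z (JC W) *\<^sub>R \<i>"
    by simp
  then show ?thesis
    unfolding metric_compatible[OF assms] christoffel_J[OF assms] by (simp add: hform_def complex_eq_iff)
qed

lemma Dif_H:
  assumes "smooth_on Z U" "smooth_on W U" "x \<in> U"
  shows "Dif (\<lambda>y. H (F y) (Z y) (W y)) x X = H (F x) (cov g F X Z x) (W x) + H (F x) (Z x) (cov g F X W x)"
  using assms
  by (simp add: smooth_bil_Dif[OF open_Q smooth_bil_H diff_F diff_sec diff_sec F_in] Dif_H_const F_in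
      cov_def H_simps)

lemma smooth_H:
  assumes "smooth_on Z U" "smooth_on W U"
  shows "smooth_on (\<lambda>y. H (F y) (Z y) (W y)) U"
  by (rule smooth_bil_smooth[OF open_Q smooth_bil_H open_U smooth_F assms F_Q])

end

section \<open>Curvature tensor in a chart and along a map\<close>

context kaehler_chart
begin

definition d\<Gamma> :: "complex^'n \<Rightarrow> complex^'n \<Rightarrow> complex^'n \<Rightarrow> complex^'n \<Rightarrow> complex^'n" where
  "d\<Gamma> q X Y Z = Dif (\<lambda>p. \<Gamma> p Y Z) q X"

lemma d\<Gamma>_linear:
  assumes "q \<in> Q"
  shows "linear (\<lambda>X. d\<Gamma> q X Y Z)" "linear (\<lambda>Y. d\<Gamma> q X Y Z)" "linear (\<lambda>Z. d\<Gamma> q X Y Z)"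
  using smooth_bil_Dif_bilinear[OF open_Q smooth_bil_christoffel assms, of X]
    Dif_linear[OF smooth_on_differentiable[OF smooth_christoffel open_Q assms], of Y Z]
  by (auto simp: d\<Gamma>_def bilinear_def)

lemma d\<Gamma>_add:
  assumes "q \<in> Q"
  shows "d\<Gamma> q (X + X') Y Z = d\<Gamma> q X Y Z + d\<Gamma> q X' Y Z" "d\<Gamma> q X (Y + Y') Z = d\<Gamma> q X Y Z + d\<Gamma> q X Y' Z"
    "d\<Gamma> q X Y (Z + Z') = d\<Gamma> q X Y Z + d\<Gamma> q X Y Z'"
  using linear_add[OF d\<Gamma>_linear(1)[OF assms]] linear_add[OF d\<Gamma>_linear(2)[OF assms]]
    linear_add[OF d\<Gamma>_linear(3)[OF assms]] by simp_all

lemma d\<Gamma>_sym: "q \<in> Q \<Longrightarrow> d\<Gamma> q X Y Z = d\<Gamma> q X Z Y"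
  unfolding d\<Gamma>_def by (intro fun_cong[OF Dif_cong[OF open_Q]]) (auto simp: christoffel_sym)

lemma d\<Gamma>_J:
  assumes "q \<in> Q"
  shows "d\<Gamma> q X Y (JC Z) = JC (d\<Gamma> q X Y Z)"
proof -
  have "d\<Gamma> q X Y (JC Z) = Dif (\<lambda>p. JC (\<Gamma> p Y Z)) q X"
    unfolding d\<Gamma>_def by (intro fun_cong[OF Dif_cong[OF open_Q assms]]) (auto simp: christoffel_J)
  also have "\<dots> = JC (d\<Gamma> q X Y Z)"
    by (subst Dif_eqI[OF bounded_linear.has_derivative[OF bounded_linear_JC
            smooth_on_Dif_works[OF smooth_christoffel open_Q assms]]]) (simp add: d\<Gamma>_def)
  finally show ?thesis .
qed

lemma curv_eq:
  "curv g q X Y Z = - (d\<Gamma> q X Y Z + \<Gamma> q X (\<Gamma> q Y Z) - (d\<Gamma> q Y X Z + \<Gamma> q Y (\<Gamma> q X Z)))"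
proof -
  have *: "cov g id Y (\<lambda>_. Z) = (\<lambda>p. \<Gamma> p Y Z)" for Y by (simp add: fun_eq_iff cov_def)
  show ?thesis unfolding curv_def * by (simp add: cov_def d\<Gamma>_def)
qed

lemma curv_add:
  assumes "q \<in> Q"
  shows "curv g q (X + X') Y Z = curv g q X Y Z + curv g q X' Y Z"
    "curv g q X (Y + Y') Z = curv g q X Y Z + curv g q X Y' Z"
    "curv g q X Y (Z + Z') = curv g q X Y Z + curv g q X Y Z'"
  by (simp_all add: curv_eq d\<Gamma>_add christoffel_simps assms)

lemma curv_skew: "curv g q Y X Z = - curv g q X Y Z"
  by (simp add: curv_eq)

lemma curv_J: "q \<in> Q \<Longrightarrow> curv g q X Y (JC Z) = JC (curv g q X Y Z)"
  by (simp add: curv_eq d\<Gamma>_J christoffel_J JC_simps)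

lemma curv_bianchi:
  assumes q: "q \<in> Q"
  shows "curv g q X Y Z + curv g q Y Z X + curv g q Z X Y = 0"
  unfolding curv_eq d\<Gamma>_sym[OF q, of X Z Y] d\<Gamma>_sym[OF q, of Y X Z] d\<Gamma>_sym[OF q, of Z Y X]
    christoffel_sym[OF q, of Z Y] christoffel_sym[OF q, of X Z] christoffel_sym[OF q, of Y X]
  by simp

end

context kaehler_map
begin

lemma cov_torsion_free:
  assumes x: "x \<in> U"
  shows "cov g F X (\<lambda>y. Dif F y Y) x = cov g F Y (\<lambda>y. Dif F y X) x"
  using Dif_commute[OF open_U smooth_F x, of X Y] christoffel_sym[OF F_in[OF x]]
  by (simp add: cov_def)

text \<open>All terms containing a derivative of \<open>Z\<close> or a second derivative of
  \<open>F\<close> are symmetric in \<open>X\<close> and \<open>Y\<close> and drop out. What remains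
  is the target curvature, with the minus sign of the convention in \<open>curv\<close>.\<close>

lemma cov_commutator:
  assumes Z: "smooth_on Z U" and x: "x \<in> U"
  shows "cov g F X (cov g F Y Z) x - cov g F Y (cov g F X Z) x =
    - curv g (F x) (Dif F x X) (Dif F x Y) (Z x)"
proof -
  have *: "cov g F X (cov g F Y Z) x = Dif (\<lambda>y. Dif Z y Y) x X +
      (d\<Gamma> (F x) (Dif F x X) (Dif F x Y) (Z x) + \<Gamma> (F x) (Dif (\<lambda>y. Dif F y Y) x X) (Z x) +
       \<Gamma> (F x) (Dif F x Y) (Dif Z x X)) +
      (\<Gamma> (F x) (Dif F x X) (Dif Z x Y) + \<Gamma> (F x) (Dif F x X) (\<Gamma> (F x) (Dif F x Y) (Z x)))" for X Y
  proof -
    have 1: "(\<lambda>y. Dif Z y Y) differentiable (at x)"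
      by (rule diff_sec[OF smooth_on_Dif[OF open_U Z] x])
    have "smooth_on (\<lambda>y. \<Gamma> (F y) (Dif F y Y) (Z y)) U"
      by (rule smooth_bil_smooth[OF open_Q smooth_bil_christoffel open_U smooth_F smooth_DF Z F_Q])
    from diff_sec[OF this x] have 2: "(\<lambda>y. \<Gamma> (F y) (Dif F y Y) (Z y)) differentiable (at x)" .
    have "Dif (cov g F Y Z) x X = Dif (\<lambda>y. Dif Z y Y) x X + Dif (\<lambda>y. \<Gamma> (F y) (Dif F y Y) (Z y)) x X"
      unfolding cov_def[abs_def]
      by (subst Dif_eqI[OF has_derivative_add[OF Dif_works[OF 1] Dif_works[OF 2]]]) simp
    also have "Dif (\<lambda>y. \<Gamma> (F y) (Dif F y Y) (Z y)) x X =
      d\<Gamma> (F x) (Dif F x X) (Dif F x Y) (Z x) + \<Gamma> (F x) (Dif (\<lambda>y. Dif F y Y) x X) (Z x) +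
       \<Gamma> (F x) (Dif F x Y) (Dif Z x X)"
      unfolding d\<Gamma>_def
      by (rule smooth_bil_Dif[OF open_Q smooth_bil_christoffel diff_F[OF x] diff_sec[OF smooth_DF x]
            diff_sec[OF Z x] F_in[OF x]])
    finally show ?thesis
      unfolding cov_def[of g F X "cov g F Y Z" x] cov_def[of g F Y Z x] christoffel_simps(2)[OF F_in[OF x]]
      by simp
  qed
  show ?thesis
    unfolding * curv_eq Dif_commute[OF open_U Z x, of X Y] Dif_commute[OF open_U smooth_F x, of X Y]
    by (simp add: algebra_simps)
qed

end

section \<open>The curvature of constant holomorphic sectional curvature\<close>

text \<open>The classical octahedron argument: the Bianchi identities for the four cyclic rotations
  of (X, Y, Z, W) combine linearly once the antisymmetries have identified equal terms.\<close>

lemma curvature_pair_symmetry: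
  fixes r :: "'v \<Rightarrow> 'v \<Rightarrow> 'v \<Rightarrow> 'v \<Rightarrow> real"
  assumes "\<And>X Y Z W. r Y X Z W = - r X Y Z W" "\<And>X Y Z W. r X Y W Z = - r X Y Z W"
    and bianchi: "\<And>X Y Z W. r X Y Z W + r Y Z X W + r Z X Y W = 0"
  shows "r X Y Z W = r Z W X Y"
  using bianchi[of X Y Z W] bianchi[of Y Z W X] bianchi[of Z W X Y] bianchi[of W X Y Z]
    assms(1)[of Z X Y W] assms(1)[of W Y Z X] assms(2)[of X Y Z W] assms(2)[of X Z Y W]
    assms(2)[of Y W Z X] assms(2)[of Z W X Y] assms(2)[of Y Z W X] assms(2)[of W X Y Z]
    assms(1)[of X Z W Y] assms(1)[of Y W X Z] assms(2)[of Z W Y X] 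
    assms(2)[of Y Z X W] assms(2)[of W X Z Y] assms(2)[of W Y X Z] assms(1)[of W Y X Z]
    assms(2)[of Z X W Y] assms(2)[of Z X Y W]
  by linarith

context kaehler_chart
begin

text \<open>For constant fields \<open>Z\<close> and \<open>W\<close>, the second derivatives of the
  function \<open>H p Z W\<close> commute. Expanding both orders by the product rule, the mixed
  terms match and the curvature terms are left.\<close>

lemma curv_metric:
  assumes q: "q \<in> Q"
  shows "H q (curv g q X Y Z) W = - H q Z (curv g q X Y W)"
proof -
  interpret I: kaehler_map g Q \<kappa> id Q
    by unfold_locales (auto simp: open_Q id_def intro: smooth_on_ident open_Q)
  define D where "D X Z = cov g id X Z" for X and Z :: "complex^'n \<Rightarrow> complex^'n"
  have sm: "smooth_on (D X (\<lambda>_. Z)) Q" for X Z unfolding D_def by (rule I.smooth_cov[OF smooth_on_const])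
  have *: "Dif (\<lambda>p. Dif (\<lambda>p. H p Z W) p Y) q X =
    H q (D X (D Y (\<lambda>_. Z)) q) W + H q (D Y (\<lambda>_. Z) q) (D X (\<lambda>_. W) q) +
    (H q (D X (\<lambda>_. Z) q) (D Y (\<lambda>_. W) q) + H q Z (D X (D Y (\<lambda>_. W)) q))" for X Y
  proof -
    let ?a = "\<lambda>p. H (id p) (D Y (\<lambda>_. Z) p) W" and ?b = "\<lambda>p. H (id p) Z (D Y (\<lambda>_. W) p)"
    have "Dif (\<lambda>p. Dif (\<lambda>p. H p Z W) p Y) q X = Dif (\<lambda>p. ?a p + ?b p) q X"
      using I.Dif_H[OF smooth_on_const smooth_on_const, of _ Z W Y]
      by (intro fun_cong[OF Dif_cong[OF open_Q q]]) (simp add: D_def)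
    also have "\<dots> = Dif ?a q X + Dif ?b q X"
      by (subst Dif_eqI[OF has_derivative_add[OF
            smooth_on_Dif_works[OF I.smooth_H[OF sm smooth_on_const] open_Q q]
            smooth_on_Dif_works[OF I.smooth_H[OF smooth_on_const sm] open_Q q]]]) simp
    finally show ?thesis
      unfolding I.Dif_H[OF sm smooth_on_const q] I.Dif_H[OF smooth_on_const sm q] by (simp add: D_def)
  qed
  have s: "smooth_on (\<lambda>p. H p Z W) Q" using smooth_bil_H by (simp add: smooth_bil_def)
  have c: "curv g q X Y Z = D Y (D X (\<lambda>_. Z)) q - D X (D Y (\<lambda>_. Z)) q" for Z
    by (simp add: curv_def D_def)
  show ?thesis
    using Dif_commute[OF open_Q s q, of Y X] unfolding * c[of Z] c[of W] 
    by (simp add: H_simps q algebra_simps)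
qed

lemma curv_metric_real: "q \<in> Q \<Longrightarrow> g q (curv g q X Y Z) W = - g q Z (curv g q X Y W)"
  using curv_metric[of q X Y Z W] by (simp add: hform_def complex_eq_iff)

text \<open>Pair symmetry moves the first two arguments into the slots where \<open>JC\<close>
  commutes with the curvature and is an isometry.\<close>

lemma curv_JJ:
  assumes q: "q \<in> Q"
  shows "curv g q (JC X) (JC Y) Z = curv g q X Y Z"
proof (rule g_eqI[OF q])
  fix W
  have pair: "g q (curv g q X Y Z) W = g q (curv g q Z W X) Y" for X Y Z W
  proof (rule curvature_pair_symmetry[where r = "\<lambda>X Y Z W. g q (curv g q X Y Z) W"])
    show "g q (curv g q Y X Z) W = - g q (curv g q X Y Z) W" for X Y Z W
      by (simp add: curv_skew[of q X Y] g_simps q)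
    show "g q (curv g q X Y W) Z = - g q (curv g q X Y Z) W" for X Y Z W
      by (simp add: curv_metric_real[OF q, of X Y W] sym_g[OF q, of W])
    show "g q (curv g q X Y Z) W + g q (curv g q Y Z X) W + g q (curv g q Z X Y) W = 0" for X Y Z W
      using curv_bianchi[OF q, of X Y Z] by (metis g_simps(1,9) q)
  qed
  have "g q (curv g q (JC X) (JC Y) Z) W = g q (JC (curv g q Z W X)) (JC Y)"
    by (simp only: pair[of "JC X"] curv_J[OF q])
  also have "\<dots> = g q (curv g q X Y Z) W" by (simp only: J_g[OF q] pair[of X])
  finally show "g q (curv g q (JC X) (JC Y) Z) W = g q (curv g q X Y Z) W" .
qed

lemma curv_minus_middle:
  assumes "q \<in> Q"
  shows "curv g q X (- Y) Z = - curv g q X Y Z"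
  using linear_neg[OF d\<Gamma>_linear(1)[OF assms]] linear_neg[OF d\<Gamma>_linear(2)[OF assms]]
  by (simp add: curv_eq christoffel_simps assms)

lemma curv_J_swap: "q \<in> Q \<Longrightarrow> curv g q (JC X) Y Z = - curv g q X (JC Y) Z"
  using curv_JJ[of q X "JC Y" Z] by (metis JC_simps(5) curv_minus_middle minus_minus)

text \<open>The part of the curvature that is complex linear in its first and antilinear in its second
  argument; it is the curvature of \<open>T'N\<close> on vectors of type (1,0) and (0,1).\<close>

definition curv11 :: "complex^'n \<Rightarrow> complex^'n \<Rightarrow> complex^'n \<Rightarrow> complex^'n \<Rightarrow> complex^'n" where
  "curv11 q X Y Z = curv g q X Y Z + JC (curv g q X (JC Y) Z)"

lemma curv11_add:
  assumes "q \<in> Q"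
  shows "curv11 q (X + X') Y Z = curv11 q X Y Z + curv11 q X' Y Z"
    "curv11 q X (Y + Y') Z = curv11 q X Y Z + curv11 q X Y' Z"
    "curv11 q X Y (Z + Z') = curv11 q X Y Z + curv11 q X Y Z'"
  by (simp_all add: curv11_def curv_add JC_simps assms)

lemma curv11_J:
  assumes q: "q \<in> Q"
  shows "curv11 q (JC X) Y Z = JC (curv11 q X Y Z)"
    "curv11 q X (JC Y) Z = - JC (curv11 q X Y Z)"
    "curv11 q X Y (JC Z) = JC (curv11 q X Y Z)"
  by (simp_all add: curv11_def JC_simps curv_JJ curv_J_swap curv_J curv_minus_middle q)

text \<open>By the Bianchi identity the two sides differ by \<open>curv g q Z X Y\<close> plus
  \<open>JC\<close> of its value at \<open>JC Y\<close>, and these cancel because the curvature is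
  \<open>JC\<close>-linear in its last argument.\<close>

lemma curv11_sym:
  assumes q: "q \<in> Q"
  shows "curv11 q X Y Z = curv11 q Z Y X"
proof -
  have 1: "curv g q X Y Z = curv g q Z Y X - curv g q Z X Y" for Y
    using curv_bianchi[OF q, of X Y Z] curv_skew[of q Y Z X] by (simp add: algebra_simps)
  show ?thesis unfolding curv11_def 1[of Y] 1[of "JC Y"] by (simp add: curv_J q JC_simps)
qed

lemma curv11_adjoint:
  assumes q: "q \<in> Q"
  shows "H q (curv11 q X Y Z) W = H q Z (curv11 q Y X W)"
proof -
  have 1: "curv g q Y (JC X) W = curv g q X (JC Y) W"
    using curv_J_swap[OF q, of X Y W] curv_skew[of q "JC X" Y W] by simp
  show ?thesis
    unfolding curv11_def 1 curv_skew[of q X Y]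
    by (simp add: H_simps H_J q curv_metric)
qed

text \<open>Paired with \<open>W\<close>, the difference of both sides satisfies the symmetries of
  \<open>sesquilinear_polarization\<close>, so only equal arguments matter. There the left side is
  -\<kappa> times the square of \<open>H q X X\<close>; the two equal terms on the right account for
  the factor 1/2.\<close>

lemma curv11_eq:
  assumes q: "q \<in> Q"
  shows "curv11 q X Y Z = of_real (- \<kappa> / 2) *s (H q X Y *s Z + H q Z Y *s X)"
proof (rule H_eqI[OF q])
  fix W
  define f where "f X Y Z W = H q (curv11 q X Y Z) W + of_real (\<kappa> / 2) * (H q X Y * H q Z W + H q Z Y * H q X W)" for X Y Z W
  have "f X Y Z W = 0"
  proof (rule sesquilinear_polarization[where J = JC])
    fix X Y Z W
    show "f X Y Z W = f Z Y X W" by (simp add: f_def curv11_sym[OF q, of X] algebra_simps)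
    have "H q (curv11 q X Y Z) W = cnj (H q (curv11 q Y X W) Z)"
      by (simp add: curv11_adjoint q H_cnj)
    also have "\<dots> = cnj (H q (curv11 q W X Y) Z)" by (simp only: curv11_sym[OF q, of Y])
    also have "\<dots> = H q (curv11 q X W Z) Y"
      by (simp add: curv11_adjoint q H_cnj)
    finally show "f X Y Z W = f X W Z Y" by (simp add: f_def algebra_simps)
    have "H q (curv11 q X X X) X = - of_real \<kappa> * H q X X * H q X X"
    proof (cases "X = 0")
      case False
      have o: "g q X (JC X) = 0" using g_J_left[OF q, of X X] sym_g[OF q, of "JC X" X] by simp
      have "g q (curv g q X (JC X) X) (JC X) = \<kappa> * (g q X X * g q X X)"
        using sec_curv[OF q False] pos_g[OF q False] unfolding Defs.sec_curv_def by (simp add: o J_g q field_simps)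
      moreover have "g q (curv g q X (JC X) X) X = 0"
        using curv_metric_real[OF q, of X "JC X" X X] sym_g[OF q, of X "curv g q X (JC X) X"] by simp
      moreover have "curv g q X X X = 0" by (simp add: curv_eq)
      ultimately show ?thesis
        by (simp add: curv11_def H_J q) (simp add: hform_def o complex_eq_iff)
    qed (simp add: H_simps q)
    then show "f X X X X = 0" by (simp add: f_def)
  qed (simp_all add: f_def curv11_add curv11_J H_simps H_J q algebra_simps)
  then have "H q (curv11 q X Y Z) W = - (of_real (\<kappa> / 2) * (H q X Y * H q Z W + H q Z Y * H q X W))"
    by (simp only: f_def eq_neg_iff_add_eq_0)
  also have "\<dots> = H q (of_real (- \<kappa> / 2) *s (H q X Y *s Z + H q Z Y *s X)) W"
    by (simp add: H_simps q algebra_simps add_divide_distrib)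
  finally show "H q (curv11 q X Y Z) W = H q (of_real (- \<kappa> / 2) *s (H q X Y *s Z + H q Z Y *s X)) W" .
qed

text \<open>Antisymmetrising \<open>curv11\<close> in its first two arguments cancels the parts with
  \<open>JC\<close> and doubles \<open>curv\<close>, which turns \<kappa>/2 into \<kappa>/4.\<close>

lemma curv_formula:
  assumes q: "q \<in> Q"
  shows "curv g q X Y Z = of_real (- \<kappa> / 4) *s
    (H q X Y *s Z + H q Z Y *s X - H q Y X *s Z - H q Z X *s Y)"
proof -
  have 1: "curv g q Y (JC X) Z = curv g q X (JC Y) Z"
    using curv_J_swap[OF q, of X Y Z] curv_skew[of q "JC X" Y Z] by simp
  have "curv g q X Y Z + curv g q X Y Z = curv11 q X Y Z - curv11 q Y X Z"
    unfolding curv11_def 1 curv_skew[of q X Y] by simp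
  then have "2 * curv g q X Y Z $ i = curv11 q X Y Z $ i - curv11 q Y X Z $ i" for i
    by (metis mult_2 vector_add_component vector_minus_component)
  then have "curv g q X Y Z $ i = (curv11 q X Y Z $ i - curv11 q Y X Z $ i) / 2" for i
    by (metis nonzero_mult_div_cancel_left zero_neq_numeral)
  from this[unfolded curv11_eq[OF q]] show ?thesis
    unfolding vec_eq_iff by (simp add: algebra_simps diff_divide_distrib add_divide_distrib)
qed

end

section \<open>Wirtinger derivatives\<close>

text \<open>With \<open>T'N\<close> identified with \<open>complex^'n\<close>, and \<open>e1, e2\<close> in the roles of \<open>1, \<i>\<close>, these are
  \<open>\<partial>/\<partial>z\<close> on functions (\<open>dz\<close>), \<open>\<partial>\<phi>/\<partial>z\<close> (\<open>vz\<close>), and \<open>\<nabla>/\<partial>z\<close> on sections of \<open>T'N\<close> (\<open>wz\<close>). Replacing \<open>e2\<close>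
  by \<open>- e2\<close> gives the conjugate operators. The indices of \<open>eta\<close> and \<open>jac\<close> start at 0, one below
  those of \<open>etaC\<close> and \<open>jC\<close>.\<close>

definition dz :: "'a \<Rightarrow> 'a \<Rightarrow> ('a::euclidean_space \<Rightarrow> complex) \<Rightarrow> 'a \<Rightarrow> complex" where
  "dz e1 e2 f x = (Dif f x e1 - \<i> * Dif f x e2) / 2"

definition vz :: "'a \<Rightarrow> 'a \<Rightarrow> ('a::euclidean_space \<Rightarrow> complex^'n) \<Rightarrow> 'a \<Rightarrow> complex^'n" where
  "vz e1 e2 F x = (1/2::complex) *s (Dif F x e1 - JC (Dif F x e2))"

definition wz :: "(complex^'n \<Rightarrow> complex^'n \<Rightarrow> complex^'n \<Rightarrow> real) \<Rightarrow> ('a::euclidean_space \<Rightarrow> complex^'n) \<Rightarrow>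
    'a \<Rightarrow> 'a \<Rightarrow> ('a \<Rightarrow> complex^'n) \<Rightarrow> 'a \<Rightarrow> complex^'n" where
  "wz g F e1 e2 Z x = (1/2::complex) *s (cov g F e1 Z x - JC (cov g F e2 Z x))"

definition va :: "(complex^'n \<Rightarrow> complex^'n \<Rightarrow> complex^'n \<Rightarrow> real) \<Rightarrow> ('a::euclidean_space \<Rightarrow> complex^'n) \<Rightarrow>
    'a \<Rightarrow> 'a \<Rightarrow> nat \<Rightarrow> 'a \<Rightarrow> complex^'n" where
  "va g F e1 e2 r = (wz g F e1 e2 ^^ r) (vz e1 e2 F)"

definition wa :: "(complex^'n \<Rightarrow> complex^'n \<Rightarrow> complex^'n \<Rightarrow> real) \<Rightarrow> ('a::euclidean_space \<Rightarrow> complex^'n) \<Rightarrow>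
    'a \<Rightarrow> 'a \<Rightarrow> ('a \<Rightarrow> complex^'n) \<Rightarrow> nat \<Rightarrow> 'a \<Rightarrow> complex^'n" where
  "wa g F e1 e2 V r = (wz g F e1 e2 ^^ Suc r) V"

definition eta :: "(complex^'n \<Rightarrow> complex^'n \<Rightarrow> complex^'n \<Rightarrow> real) \<Rightarrow> ('a::euclidean_space \<Rightarrow> complex^'n) \<Rightarrow>
    'a \<Rightarrow> 'a \<Rightarrow> nat \<Rightarrow> nat \<Rightarrow> 'a \<Rightarrow> complex" where
  "eta g F e1 e2 r s x = hform (g (F x)) (va g F e1 e2 r x) (va g F e1 (- e2) s x)"

definition jac :: "(complex^'n \<Rightarrow> complex^'n \<Rightarrow> complex^'n \<Rightarrow> real) \<Rightarrow> ('a::euclidean_space \<Rightarrow> complex^'n) \<Rightarrow>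
    'a \<Rightarrow> 'a \<Rightarrow> ('a \<Rightarrow> complex^'n) \<Rightarrow> nat \<Rightarrow> nat \<Rightarrow> 'a \<Rightarrow> complex" where
  "jac g F e1 e2 V r s x = hform (g (F x)) (wa g F e1 e2 V r x) (va g F e1 (- e2) s x) +
     hform (g (F x)) (va g F e1 e2 r x) (wa g F e1 (- e2) V s x)"

lemma va_simps: "va g F e1 e2 0 = vz e1 e2 F" "va g F e1 e2 (Suc r) = wz g F e1 e2 (va g F e1 e2 r)"
  by (simp_all add: va_def)

lemma wa_simps: "wa g F e1 e2 V 0 = wz g F e1 e2 V" "wa g F e1 e2 V (Suc r) = wz g F e1 e2 (wa g F e1 e2 V r)"
  by (simp_all add: wa_def)

lemma scalar_simps:
  fixes X Y :: "complex^'n"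
  shows "c *s (X + Y) = c *s X + c *s Y" "c *s (X - Y) = c *s X - c *s Y" "c *s (- X) = - (c *s X)"
    "c *s (d *s X) = (c * d) *s X" "c *s (0::complex^'n) = 0" "1 *s X = X" "0 *s X = 0"
  by (simp_all add: vec_eq_iff algebra_simps)

context kaehler_map
begin

lemma smooth_vz: "smooth_on (vz e1 e2 F) U"
  unfolding vz_def[abs_def]
  by (rule smooth_on_scalar[OF open_U smooth_on_const smooth_on_diff[OF open_U smooth_DF smooth_on_JC[OF open_U smooth_DF]]])

lemma smooth_wz: "smooth_on Z U \<Longrightarrow> smooth_on (wz g F e1 e2 Z) U"
  unfolding wz_def[abs_def]
  by (rule smooth_on_scalar[OF open_U smooth_on_const smooth_on_diff[OF open_U smooth_cov smooth_on_JC[OF open_U smooth_cov]]])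

lemma smooth_va: "smooth_on (va g F e1 e2 r) U"
  by (induction r) (simp_all add: va_simps smooth_vz smooth_wz)

lemma smooth_wa: "smooth_on V U \<Longrightarrow> smooth_on (wa g F e1 e2 V r) U"
  by (induction r) (simp_all add: wa_simps smooth_wz)

lemma smooth_dz: "smooth_on f U \<Longrightarrow> smooth_on (dz e1 e2 f) U"
proof -
  assume f: "smooth_on f U"
  have "smooth_on (\<lambda>x. (1/2) * (Dif f x e1 - \<i> * Dif f x e2)) U"
    by (intro smooth_on_mult smooth_on_diff smooth_on_Dif smooth_on_const open_U f)
  then show ?thesis by (simp add: dz_def[abs_def])
qed

lemma wz_cong: "x \<in> U \<Longrightarrow> (\<And>y. y \<in> U \<Longrightarrow> Z y = W y) \<Longrightarrow> wz g F e1 e2 Z x = wz g F e1 e2 W x"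
  unfolding wz_def using cov_cong[of x Z W] by simp

lemma wz_add:
  assumes "smooth_on Z U" "smooth_on W U" "x \<in> U"
  shows "wz g F e1 e2 (\<lambda>y. Z y + W y) x = wz g F e1 e2 Z x + wz g F e1 e2 W x"
  unfolding wz_def cov_add[OF assms] by (simp add: scalar_simps)

lemma wz_diff:
  assumes "smooth_on Z U" "smooth_on W U" "x \<in> U"
  shows "wz g F e1 e2 (\<lambda>y. Z y - W y) x = wz g F e1 e2 Z x - wz g F e1 e2 W x"
  unfolding wz_def cov_diff[OF assms] by (simp add: scalar_simps)

lemma wz_scalar:
  assumes "smooth_on f U" "smooth_on Z U" "x \<in> U"
  shows "wz g F e1 e2 (\<lambda>y. f y *s Z y) x = dz e1 e2 f x *s Z x + f x *s wz g F e1 e2 Z x"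
  unfolding wz_def dz_def cov_scalar[OF assms] by (simp add: vec_eq_iff field_simps)

lemma wz_zero: "x \<in> U \<Longrightarrow> wz g F e1 e2 (\<lambda>_. 0) x = 0"
  by (simp add: wz_def cov_def christoffel_simps F_in JC_simps)

text \<open>Antilinearity in the second slot turns the operator into its conjugate there, hence
  \<open>- e2\<close>.\<close>

lemma dz_H:
  assumes "smooth_on Z U" "smooth_on W U" "x \<in> U"
  shows "dz e1 e2 (\<lambda>y. H (F y) (Z y) (W y)) x =
    H (F x) (wz g F e1 e2 Z x) (W x) + H (F x) (Z x) (wz g F e1 (- e2) W x)"
  unfolding dz_def wz_def Dif_H[OF assms] cov_dir(3)[OF assms(2,3)]
  by (simp add: H_simps H_J F_in assms(3) JC_simps field_simps)

text \<open>In \<open>curv_formula\<close>, the direction d/dz enters through \<open>a\<close> in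
  the linear slots and through \<open>b\<close> in the antilinear ones. With \<open>X\<close> a time
  direction, this moves the time derivative past d/dz along a variation.\<close>

lemma cov_wz_commutator:
  fixes e1 e2 X :: 'a and Z x
  defines "a \<equiv> vz e1 e2 F x" and "b \<equiv> vz e1 (- e2) F x" and "V \<equiv> Dif F x X"
  assumes Z: "smooth_on Z U" and x: "x \<in> U"
  shows "cov g F X (wz g F e1 e2 Z) x - wz g F e1 e2 (cov g F X Z) x =
    of_real (\<kappa> / 4) *s (H (F x) V b *s Z x + H (F x) (Z x) b *s V - H (F x) a V *s Z x - H (F x) (Z x) V *s a)"
proof -
  have "cov g F X (wz g F e1 e2 Z) x =
      (1/2::complex) *s (cov g F X (cov g F e1 Z) x - JC (cov g F X (cov g F e2 Z) x))"
  proof -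
    have s: "smooth_on (\<lambda>y. cov g F e1 Z y - JC (cov g F e2 Z y)) U"
      by (rule smooth_on_diff[OF open_U smooth_cov[OF Z] smooth_on_JC[OF open_U smooth_cov[OF Z]]])
    show ?thesis
      unfolding wz_def[abs_def] cov_scalar[OF smooth_on_const s x]
        cov_diff[OF smooth_cov[OF Z] smooth_on_JC[OF open_U smooth_cov[OF Z]] x] cov_JC[OF smooth_cov[OF Z] x]
      by (simp add: scalar_simps)
  qed
  moreover have "cov g F X (cov g F e Z) x = cov g F e (cov g F X Z) x - curv g (F x) V (Dif F x e) (Z x)" for e
    using cov_commutator[OF Z x, of X e] by (simp add: V_def algebra_simps)
  ultimately have *: "cov g F X (wz g F e1 e2 Z) x - wz g F e1 e2 (cov g F X Z) x =
    (- 1/2::complex) *s (curv g (F x) V (Dif F x e1) (Z x) - JC (curv g (F x) V (Dif F x e2) (Z x)))"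
    by (simp add: wz_def vec_eq_iff algebra_simps diff_divide_distrib add_divide_distrib)
  have lin: "linear (Dif F x)" by (rule Dif_linear[OF diff_F[OF x]])
  show ?thesis
    unfolding * curv_formula[OF F_in[OF x]] a_def b_def vz_def linear_neg[OF lin]
    by (simp add: vec_eq_iff H_simps H_J F_in x JC_simps field_simps)
qed

end

section \<open>Modules generated by the derivatives\<close>

text \<open>Read (Z, Y) as Z + eps Y with eps^2 = 0. This is the module over smooth functions
  generated by \<open>A i\<close> + eps \<open>\<alpha> i\<close> for i in \<open>I\<close> and by
  eps \<open>A i\<close> for i in \<open>K\<close>; the latter absorb the eps-parts of coefficients.
  Rule \<open>cong\<close> makes membership depend on the values on \<open>U\<close> only.\<close>

inductive span_pair :: "'a::euclidean_space set \<Rightarrow> (nat \<Rightarrow> 'a \<Rightarrow> complex^'n) \<Rightarrow> (nat \<Rightarrow> 'a \<Rightarrow> complex^'n) \<Rightarrow>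
    nat set \<Rightarrow> nat set \<Rightarrow> ('a \<Rightarrow> complex^'n) \<Rightarrow> ('a \<Rightarrow> complex^'n) \<Rightarrow> bool"
  for U A \<alpha> I K where
  zero: "span_pair U A \<alpha> I K (\<lambda>_. 0) (\<lambda>_. 0)"
| gen: "i \<in> I \<Longrightarrow> span_pair U A \<alpha> I K (A i) (\<alpha> i)"
| gen0: "i \<in> K \<Longrightarrow> span_pair U A \<alpha> I K (\<lambda>_. 0) (A i)"
| add: "span_pair U A \<alpha> I K Z Y \<Longrightarrow> span_pair U A \<alpha> I K Z' Y' \<Longrightarrow>
    span_pair U A \<alpha> I K (\<lambda>x. Z x + Z' x) (\<lambda>x. Y x + Y' x)"
| scalar: "smooth_on f U \<Longrightarrow> span_pair U A \<alpha> I K Z Y \<Longrightarrow>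
    span_pair U A \<alpha> I K (\<lambda>x. f x *s Z x) (\<lambda>x. f x *s Y x)"
| cong: "span_pair U A \<alpha> I K Z Y \<Longrightarrow> (\<And>x. x \<in> U \<Longrightarrow> Z' x = Z x) \<Longrightarrow> (\<And>x. x \<in> U \<Longrightarrow> Y' x = Y x) \<Longrightarrow>
    span_pair U A \<alpha> I K Z' Y'"

lemma span_pair_mono:
  "span_pair U A \<alpha> I K Z Y \<Longrightarrow> I \<subseteq> I' \<Longrightarrow> K \<subseteq> K' \<Longrightarrow> span_pair U A \<alpha> I' K' Z Y"
proof (induction rule: span_pair.induct)
  case (cong Z Y Z' Y')
  then show ?case by (blast intro: span_pair.cong)
qed (auto intro: span_pair.intros)

lemma span_pair_smooth:
  assumes "span_pair U A \<alpha> I K Z Y" "open U" "\<And>i. smooth_on (A i) U" "\<And>i. smooth_on (\<alpha> i) U"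
  shows "smooth_on Z U \<and> smooth_on Y U"
  using assms(1)
proof (induction rule: span_pair.induct)
  case (cong Z Y Z' Y')
  then show ?case using smooth_on_cong[OF assms(2), of Z' Z] smooth_on_cong[OF assms(2), of Y' Y] by simp
qed (auto intro: assms smooth_on_add smooth_on_scalar)

context kaehler_map
begin

lemma span_pair_H_fst:
  assumes "span_pair U A \<alpha> I K Z Y" "x \<in> U" "\<And>i. i \<in> I \<Longrightarrow> H (F x) (A i x) B = 0"
  shows "H (F x) (Z x) B = 0"
  using assms(1)
  by (induction rule: span_pair.induct) (simp_all add: assms(2,3) H_simps F_in)

text \<open>The expression is the eps-coefficient of the pairing of Z + eps Y with B + eps \<beta>.
  A generator eps \<open>A i\<close> contributes only its pairing with \<open>B\<close>, so for
  \<open>K\<close> the second hypothesis is not asked.\<close>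

lemma span_pair_H:
  assumes "span_pair U A \<alpha> I K Z Y" "x \<in> U" "\<And>i. i \<in> I \<union> K \<Longrightarrow> H (F x) (A i x) B = 0"
    "\<And>i. i \<in> I \<Longrightarrow> H (F x) (\<alpha> i x) B + H (F x) (A i x) \<beta> = 0"
  shows "H (F x) (Y x) B + H (F x) (Z x) \<beta> = 0"
  using assms(1)
proof (induction rule: span_pair.induct)
  case (add Z Y Z' Y')
  have "H (F x) (Y x + Y' x) B + H (F x) (Z x + Z' x) \<beta> =
    (H (F x) (Y x) B + H (F x) (Z x) \<beta>) + (H (F x) (Y' x) B + H (F x) (Z' x) \<beta>)"
    by (simp add: assms(2) H_simps F_in)
  then show ?case using add by simp
next
  case (scalar f Z Y)
  have "H (F x) (f x *s Y x) B + H (F x) (f x *s Z x) \<beta> =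
    f x * (H (F x) (Y x) B + H (F x) (Z x) \<beta>)"
    by (simp add: assms(2) H_simps F_in algebra_simps)
  then show ?case using scalar by simp
qed (simp_all add: assms(2-4) H_simps F_in)

text \<open>Differentiating a generator raises its index, and differentiating a coefficient keeps
  it, so the new index sets must contain the old ones and their shifts. The factor
  \<open>\<tau>\<close> is 1 in a fixed coordinate and the derivative of the transition when the
  generators are pulled back.\<close>

lemma span_pair_wz:
  assumes "span_pair U A \<alpha> I K Z Y"
    and A: "\<And>i. smooth_on (A i) U" and \<alpha>: "\<And>i. smooth_on (\<alpha> i) U" and \<tau>: "smooth_on \<tau> U"
    and wA: "\<And>i x. x \<in> U \<Longrightarrow> wz g F e1 e2 (A i) x = \<tau> x *s A (Suc i) x"
    and w\<alpha>: "\<And>i x. x \<in> U \<Longrightarrow> wz g F e1 e2 (\<alpha> i) x = \<tau> x *s \<alpha> (Suc i) x"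
    and I: "I \<subseteq> I'" "Suc ` I \<subseteq> I'" "K \<subseteq> K'" "Suc ` K \<subseteq> K'"
  shows "span_pair U A \<alpha> I' K' (wz g F e1 e2 Z) (wz g F e1 e2 Y)"
  using assms(1)
proof (induction rule: span_pair.induct)
  case zero
  then show ?case by (rule span_pair.cong[OF span_pair.zero]) (simp_all add: wz_zero)
next
  case (gen i)
  then have "Suc i \<in> I'" using I by blast
  then show ?case
    by (rule span_pair.cong[OF span_pair.scalar[OF \<tau> span_pair.gen]]) (simp_all add: wA w\<alpha>)
next
  case (gen0 i)
  then have "Suc i \<in> K'" using I by blast
  then show ?case
    by (rule span_pair.cong[OF span_pair.scalar[OF \<tau> span_pair.gen0]]) (simp_all add: wA wz_zero)
next
  case (add Z Y Z' Y')
  have s: "smooth_on Z U" "smooth_on Y U" "smooth_on Z' U" "smooth_on Y' U"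
    using span_pair_smooth[OF add.hyps(1) open_U A \<alpha>] span_pair_smooth[OF add.hyps(2) open_U A \<alpha>] by auto
  show ?case
    by (rule span_pair.cong[OF span_pair.add[OF add.IH]]) (simp_all add: wz_add s)
next
  case (scalar f Z Y)
  have s: "smooth_on Z U" "smooth_on Y U"
    using span_pair_smooth[OF scalar.hyps(2) open_U A \<alpha>] by auto
  have f: "smooth_on (dz e1 e2 f) U" by (rule smooth_dz[OF scalar.hyps(1)])
  show ?case
    by (rule span_pair.cong[OF span_pair.add[OF span_pair.scalar[OF f span_pair_mono[OF scalar.hyps(2) I(1,3)]]
            span_pair.scalar[OF scalar.hyps(1) scalar.IH]]])
       (simp_all add: wz_scalar s scalar.hyps)
next
  case (cong Z Y Z' Y')
  show ?case
    by (rule span_pair.cong[OF cong.IH]; rule wz_cong) (simp_all add: cong.hyps)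
qed

end

section \<open>Harmonic maps and Jacobi fields in charts\<close>

text \<open>Both equations are in the form they take in a conformal coordinate, free of the domain
  metric; \<open>harmonic_jacobi_local\<close> derives them from the tension field and the Jacobi
  operator.\<close>

locale harmonic_jacobi = kaehler_map g Q \<kappa> F U
  for g :: "complex^'n \<Rightarrow> complex^'n \<Rightarrow> complex^'n \<Rightarrow> real" and Q \<kappa>
    and F :: "'a::euclidean_space \<Rightarrow> complex^'n" and U +
  fixes e1 e2 :: 'a and V :: "'a \<Rightarrow> complex^'n"
  assumes smooth_V: "smooth_on V U"
    and harmonic: "\<And>x. x \<in> U \<Longrightarrow> cov g F e1 (\<lambda>y. Dif F y e1) x + cov g F e2 (\<lambda>y. Dif F y e2) x = 0"
    and jacobi: "\<And>x. x \<in> U \<Longrightarrow> cov g F e1 (cov g F e1 V) x + cov g F e2 (cov g F e2 V) x +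
      curv g (F x) (Dif F x e1) (V x) (Dif F x e1) + curv g (F x) (Dif F x e2) (V x) (Dif F x e2) = 0"
begin

abbreviation "D \<equiv> wz g F e1 e2"
abbreviation "D' \<equiv> wz g F e1 (- e2)"
abbreviation "a \<equiv> va g F e1 e2"
abbreviation "b \<equiv> va g F e1 (- e2)"
abbreviation "\<alpha> \<equiv> wa g F e1 e2 V"
abbreviation "\<beta> \<equiv> wa g F e1 (- e2) V"
abbreviation "c \<equiv> complex_of_real (\<kappa> / 4)"

lemma linear_DF: "x \<in> U \<Longrightarrow> linear (Dif F x)"
  by (rule Dif_linear[OF diff_F])

lemma DF_neg: "x \<in> U \<Longrightarrow> Dif F x (- X) = - Dif F x X"
  by (rule linear_neg[OF linear_DF])

text \<open>Exchanges \<open>a\<close> with \<open>b\<close>, \<open>\<alpha>\<close> with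
  \<open>\<beta>\<close> and \<open>D\<close> with \<open>D'\<close>, so that each result about the
  first of these yields its mirror image.\<close>

lemma conjugate: "harmonic_jacobi g Q \<kappa> F U e1 (- e2) V"
proof
  show "smooth_on V U" by (rule smooth_V)
  fix x assume x: "x \<in> U"
  have "cov g F (- e2) (\<lambda>y. Dif F y (- e2)) x = cov g F e2 (\<lambda>y. Dif F y e2) x"
    by (rule cov_neg_neg[OF smooth_DF x]) (rule DF_neg)
  then show "cov g F e1 (\<lambda>y. Dif F y e1) x + cov g F (- e2) (\<lambda>y. Dif F y (- e2)) x = 0"
    using harmonic[OF x] by simp
  have "cov g F (- e2) (cov g F (- e2) V) x = cov g F e2 (cov g F e2 V) x"
    by (rule cov_neg_neg[OF smooth_cov[OF smooth_V] x]) (rule cov_dir(3)[OF smooth_V])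
  then show "cov g F e1 (cov g F e1 V) x + cov g F (- e2) (cov g F (- e2) V) x +
      curv g (F x) (Dif F x e1) (V x) (Dif F x e1) + curv g (F x) (Dif F x (- e2)) (V x) (Dif F x (- e2)) = 0"
    using jacobi[OF x] by (simp add: DF_neg x curv_formula F_in H_simps)
qed

text \<open>With the zero field, statements about pairs specialise to the harmonic map alone, so
  isotropy of \<phi> needs no separate recursion.\<close>

lemma zero_section: "harmonic_jacobi g Q \<kappa> F U e1 e2 (\<lambda>_. 0)"
proof
  fix x assume x: "x \<in> U"
  have "cov g F X (cov g F X (\<lambda>_. 0)) x = cov g F X (\<lambda>_. 0) x" for X
    by (rule cov_cong[OF x]) (simp add: cov_def christoffel_simps F_in)
  then show "cov g F e1 (cov g F e1 (\<lambda>_. 0)) x + cov g F e2 (cov g F e2 (\<lambda>_. 0)) x +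
      curv g (F x) (Dif F x e1) 0 (Dif F x e1) + curv g (F x) (Dif F x e2) 0 (Dif F x e2) = 0"
    by (simp add: curv_formula F_in x H_simps cov_def christoffel_simps)
qed (simp_all add: harmonic)

lemma smooth_sections: "smooth_on (a r) U" "smooth_on (b r) U" "smooth_on (\<alpha> r) U" "smooth_on (\<beta> r) U"
  by (simp_all add: smooth_va smooth_wa smooth_V)

text \<open>As for scalar Wirtinger operators this is a quarter of the Laplacian, here with the
  curvature left over by the mixed second derivatives.\<close>

lemma D'_D:
  assumes Z: "smooth_on Z U" and x: "x \<in> U"
  shows "D' (D Z) x = (1/4::complex) *s (cov g F e1 (cov g F e1 Z) x + cov g F e2 (cov g F e2 Z) x
      + JC (curv g (F x) (Dif F x e1) (Dif F x e2) (Z x)))"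
proof -
  have s: "smooth_on (cov g F e Z) U" "smooth_on (\<lambda>y. JC (cov g F e Z y)) U" for e
    using smooth_cov[OF Z] smooth_on_JC[OF open_U] by auto
  have *: "cov g F e (D Z) x = (1/2::complex) *s (cov g F e (cov g F e1 Z) x - JC (cov g F e (cov g F e2 Z) x))" for e
    unfolding wz_def[abs_def] cov_scalar[OF smooth_on_const smooth_on_diff[OF open_U s] x]
      cov_diff[OF s x] cov_JC[OF s(1) x] by (simp add: scalar_simps)
  have eq: "cov g F e1 (cov g F e2 Z) x = cov g F e2 (cov g F e1 Z) x - curv g (F x) (Dif F x e1) (Dif F x e2) (Z x)"
    using cov_commutator[OF Z x, of e1 e2] by (simp add: algebra_simps)
  show ?thesis
    unfolding wz_def[of g F e1 "- e2" "D Z" x] cov_dir(3)[OF smooth_wz[OF Z] x] *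
      cov_dir(3)[OF s(1) x] eq
    by (simp add: vec_eq_iff field_simps)
qed

text \<open>The Laplacians cancel between \<open>D'_D\<close> and its conjugate instance;
  \<open>curv_formula\<close> evaluates the remaining curvature.\<close>

lemma D_D':
  assumes Z: "smooth_on Z U" and x: "x \<in> U"
  shows "D (D' Z) x = D' (D Z) x + c *s (H (F x) (a 0 x) (a 0 x) *s Z x + H (F x) (Z x) (a 0 x) *s a 0 x
    - H (F x) (b 0 x) (b 0 x) *s Z x - H (F x) (Z x) (b 0 x) *s b 0 x)"
proof -
  interpret C: harmonic_jacobi g Q \<kappa> F U e1 "- e2" V by (rule conjugate)
  have 1: "cov g F (- e2) (cov g F (- e2) Z) x = cov g F e2 (cov g F e2 Z) x"
    by (rule cov_neg_neg[OF smooth_cov[OF Z] x]) (rule cov_dir(3)[OF Z])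
  show ?thesis
    unfolding D'_D[OF Z x] C.D'_D[OF Z x, unfolded minus_minus 1] va_simps vz_def DF_neg[OF x]
      curv_formula[OF F_in[OF x]]
    by (simp add: vec_eq_iff H_simps H_J F_in x JC_simps field_simps)
qed

text \<open>Harmonicity in complex form: the pure second derivatives add up to the tension field,
  and the mixed ones cancel since the connection is torsion free.\<close>

lemma D'_a0: "x \<in> U \<Longrightarrow> D' (a 0) x = 0"
proof -
  assume x: "x \<in> U"
  have s: "smooth_on (\<lambda>y. JC (Dif F y e)) U" for e by (rule smooth_on_JC[OF open_U smooth_DF])
  have *: "cov g F e (a 0) x = (1/2::complex) *s (cov g F e (\<lambda>y. Dif F y e1) x - JC (cov g F e (\<lambda>y. Dif F y e2) x))" for e
    unfolding va_simps vz_def[abs_def] cov_scalar[OF smooth_on_const smooth_on_diff[OF open_U smooth_DF s] x]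
      cov_diff[OF smooth_DF s x] cov_JC[OF smooth_DF x] by (simp add: scalar_simps)
  have "cov g F e1 (\<lambda>y. Dif F y e1) x = - cov g F e2 (\<lambda>y. Dif F y e2) x"
    using harmonic[OF x] by (simp add: eq_neg_iff_add_eq_0)
  note eq = this
  show ?thesis
    unfolding wz_def cov_dir(3)[OF smooth_sections(1) x] * cov_dir(3)[OF smooth_DF x]
      cov_torsion_free[OF x, of e1 e2] eq
    by (simp add: vec_eq_iff field_simps)
qed

lemma D_b0: "x \<in> U \<Longrightarrow> D (b 0) x = 0"
proof -
  interpret C: harmonic_jacobi g Q \<kappa> F U e1 "- e2" V by (rule conjugate)
  show "x \<in> U \<Longrightarrow> D (b 0) x = 0" using C.D'_a0 by simp
qed

text \<open>The Jacobi equation in complex form: it trades the Laplacian in \<open>D'_D\<close> for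
  curvature, which \<open>curv_formula\<close> makes explicit.\<close>

lemma D'_\<alpha>0:
  assumes x: "x \<in> U"
  shows "D' (\<alpha> 0) x = - c *s (H (F x) (V x) (a 0 x) *s a 0 x + H (F x) (a 0 x) (a 0 x) *s V x
    - H (F x) (b 0 x) (V x) *s a 0 x - H (F x) (a 0 x) (V x) *s b 0 x)"
proof -
  have 1: "cov g F e1 (cov g F e1 V) x + cov g F e2 (cov g F e2 V) x =
      - (curv g (F x) (Dif F x e1) (V x) (Dif F x e1) + curv g (F x) (Dif F x e2) (V x) (Dif F x e2))"
    unfolding eq_neg_iff_add_eq_0 using jacobi[OF x] by (simp only: add.assoc)
  show ?thesis
    unfolding wa_simps D'_D[OF smooth_V x] 1 curv_formula[OF F_in[OF x]] va_simps vz_def DF_neg[OF x]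
    by (simp add: vec_eq_iff H_simps H_J F_in x JC_simps field_simps)
qed

end

section \<open>Holomorphy of the isotropy pairings\<close>

lemma (in kaehler_chart) H_zero_sym: "q \<in> Q \<Longrightarrow> H q X Y = 0 \<Longrightarrow> H q Y X = 0"
  using H_cnj[of q X Y] by simp

context kaehler_map
begin

lemma eta_conj: "x \<in> U \<Longrightarrow> eta g F e1 (- e2) s r x = cnj (eta g F e1 e2 r s x)"
  by (simp add: eta_def H_cnj F_in)

lemma jac_conj: "x \<in> U \<Longrightarrow> jac g F e1 (- e2) V s r x = cnj (jac g F e1 e2 V r s x)"
  by (simp add: jac_def H_cnj F_in add.commute)

lemma smooth_eta: "smooth_on (eta g F e1 e2 r s) U"
  unfolding eta_def[abs_def] by (rule smooth_H[OF smooth_va smooth_va])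

lemma smooth_jac: "smooth_on V U \<Longrightarrow> smooth_on (jac g F e1 e2 V r s) U"
  unfolding jac_def[abs_def]
  by (rule smooth_on_add[OF open_U smooth_H[OF smooth_wa smooth_va] smooth_H[OF smooth_va smooth_wa]])

lemma wa_zero: "x \<in> U \<Longrightarrow> wa g F e1 e2 (\<lambda>_. 0) r x = 0"
proof (induction r arbitrary: x)
  case 0
  then show ?case by (simp add: wa_simps wz_zero)
next
  case (Suc r)
  then show ?case using wz_cong[of x "wa g F e1 e2 (\<lambda>_. 0) r" "\<lambda>_. 0"] by (simp add: wa_simps wz_zero)
qed

lemma jac_zero: "x \<in> U \<Longrightarrow> jac g F e1 e2 (\<lambda>_. 0) r s x = 0"
  by (simp add: jac_def wa_zero H_simps F_in)

lemma dz_add: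
  assumes "smooth_on f U" "smooth_on h U" "x \<in> U"
  shows "dz e1 e2 (\<lambda>y. f y + h y) x = dz e1 e2 f x + dz e1 e2 h x"
  unfolding dz_def
  by (subst (1 2) Dif_eqI[OF has_derivative_add[OF smooth_on_Dif_works[OF assms(1) open_U assms(3)]
          smooth_on_Dif_works[OF assms(2) open_U assms(3)]]])
     (simp add: field_simps)

end

context harmonic_jacobi
begin

abbreviation "\<eta> \<equiv> eta g F e1 e2"
abbreviation "\<j> \<equiv> jac g F e1 e2 V"

text \<open>The terms in \<open>V\<close> and \<open>b 0\<close> are the curvature terms that cancel in the pairing with the
  conjugate equation for \<open>\<beta>\<close>.\<close>

lemma D'_span:
  assumes "\<And>i x. i < r \<Longrightarrow> x \<in> U \<Longrightarrow> \<eta> i 0 x = 0" "\<And>i x. i < r \<Longrightarrow> x \<in> U \<Longrightarrow> \<j> i 0 x = 0"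
  shows "span_pair U a \<alpha> {..<r} {..r} (D' (a r))
    (\<lambda>x. D' (\<alpha> r) x + c *s (H (F x) (a r x) (a 0 x) *s V x) - c *s (H (F x) (a r x) (V x) *s b 0 x))"
  using assms
proof (induction r)
  case 0
  \<comment> \<open>Once the \<open>V\<close> and \<open>b 0\<close> terms of
    \<open>D'_\<alpha>0\<close> are moved to the left-hand side, this multiple of \<open>a 0\<close>
    is all that remains.\<close>
  let ?q = "\<lambda>x. c * (H (F x) (b 0 x) (V x) - H (F x) (V x) (a 0 x))"
  have q: "smooth_on ?q U"
    by (intro smooth_on_mult smooth_on_diff smooth_on_const smooth_H smooth_sections smooth_V open_U)
  have "span_pair U a \<alpha> {..<0} {..0} (\<lambda>_. 0) (a 0)" by (rule span_pair.gen0) simp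
  from span_pair.scalar[OF q this] show ?case
  proof (rule span_pair.cong)
    fix x assume x: "x \<in> U"
    show "D' (a 0) x = ?q x *s 0" by (simp add: D'_a0[OF x] scalar_simps)
    show "D' (\<alpha> 0) x + c *s (H (F x) (a 0 x) (a 0 x) *s V x) - c *s (H (F x) (a 0 x) (V x) *s b 0 x) = ?q x *s a 0 x"
      unfolding D'_\<alpha>0[OF x] by (simp add: vec_eq_iff algebra_simps)
  qed
next
  case (Suc r)
  define Y where "Y = (\<lambda>x. D' (\<alpha> r) x + c *s (H (F x) (a r x) (a 0 x) *s V x) - c *s (H (F x) (a r x) (V x) *s b 0 x))"
  have IH: "span_pair U a \<alpha> {..<r} {..r} (D' (a r)) Y"
    unfolding Y_def using Suc by simp
  have "span_pair U a \<alpha> {..<Suc r} {..Suc r} (D (D' (a r))) (D Y)"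
    by (rule span_pair_wz[where \<tau> = "\<lambda>_. 1", OF IH smooth_sections(1,3) smooth_on_const])
       (auto simp: va_simps wa_simps scalar_simps)
  note S1 = this
  \<comment> \<open>Coefficients from commuting \<open>D'\<close> past \<open>D\<close>:
    \<open>l\<close> belongs to the generator of index r, and \<open>m\<close> + eps
    \<open>n\<close> to the one of index 0.\<close>
  define l where "l = (\<lambda>x. - c * (H (F x) (a 0 x) (a 0 x) - H (F x) (b 0 x) (b 0 x)))"
  define m where "m = (\<lambda>x. - c * H (F x) (a r x) (a 0 x))"
  define n where "n = (\<lambda>x. - c * H (F x) (\<alpha> r x) (a 0 x))"
  have smooth: "smooth_on l U" "smooth_on m U" "smooth_on n U"
    unfolding l_def m_def n_def
    by (intro smooth_on_mult smooth_on_diff smooth_on_const smooth_H smooth_sections open_U)+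
  have S2: "span_pair U a \<alpha> {..<Suc r} {..Suc r} (a r) (\<alpha> r)" "span_pair U a \<alpha> {..<Suc r} {..Suc r} (a 0) (\<alpha> 0)"
    "span_pair U a \<alpha> {..<Suc r} {..Suc r} (\<lambda>_. 0) (a 0)"
    by (auto intro: span_pair.gen span_pair.gen0)
  show ?case
  proof (rule span_pair.cong[OF span_pair.add[OF S1 span_pair.add[OF span_pair.scalar[OF smooth(1) S2(1)]
          span_pair.add[OF span_pair.scalar[OF smooth(2) S2(2)] span_pair.scalar[OF smooth(3) S2(3)]]]]])
    fix x assume x: "x \<in> U"
    have e: "H (F x) (a r x) (b 0 x) = 0" using Suc.prems(1)[of r x] x by (simp add: eta_def)
    \<comment> \<open>Vanishing of \<open>\<j> r 0\<close> makes the \<open>b 0\<close> term of the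
      commutator on \<open>\<alpha> r\<close> equal to the one that arises from differentiating the
      correction term in \<open>Y\<close>.\<close>
    have j: "H (F x) (a r x) (\<beta> 0 x) = - H (F x) (\<alpha> r x) (b 0 x)"
      using Suc.prems(2)[of r x] x by (simp add: jac_def add_eq_0_iff2)
    have 1: "D' (D Z) x = D (D' Z) x - c *s (H (F x) (a 0 x) (a 0 x) *s Z x + H (F x) (Z x) (a 0 x) *s a 0 x
      - H (F x) (b 0 x) (b 0 x) *s Z x - H (F x) (Z x) (b 0 x) *s b 0 x)" if "smooth_on Z U" for Z
      using D_D'[OF that x] by simp
    show "D' (a (Suc r)) x = D (D' (a r)) x + (l x *s a r x + (m x *s a 0 x + n x *s 0))"
      unfolding va_simps(2) 1[OF smooth_sections(1)] e l_def m_def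
      by (simp add: vec_eq_iff algebra_simps)
    have s: "smooth_on (\<lambda>x. H (F x) (a r x) (a 0 x)) U" "smooth_on (\<lambda>x. H (F x) (a r x) (V x)) U"
      by (intro smooth_H smooth_sections smooth_V)+
    have s': "smooth_on (\<lambda>x. c * H (F x) (a r x) (a 0 x)) U" "smooth_on (\<lambda>x. c * H (F x) (a r x) (V x)) U"
      by (intro smooth_on_mult smooth_on_const s open_U)+
    have sY: "smooth_on (\<lambda>x. c *s (H (F x) (a r x) (a 0 x) *s V x)) U"
      "smooth_on (\<lambda>x. c *s (H (F x) (a r x) (V x) *s b 0 x)) U"
      by (intro smooth_on_scalar smooth_on_const s smooth_V smooth_sections open_U)+
    have sD: "smooth_on (D' (\<alpha> r)) U" by (rule smooth_wz[OF smooth_sections(3)])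
    have "D Y x = D (D' (\<alpha> r)) x + c *s (dz e1 e2 (\<lambda>x. H (F x) (a r x) (a 0 x)) x *s V x + H (F x) (a r x) (a 0 x) *s \<alpha> 0 x)
      - c *s (dz e1 e2 (\<lambda>x. H (F x) (a r x) (V x)) x *s b 0 x + H (F x) (a r x) (V x) *s D (b 0) x)"
    proof -
      have const: "dz e1 e2 (\<lambda>_. c) x = 0" by (simp add: dz_def)
      show ?thesis
        unfolding Y_def wz_diff[OF smooth_on_add[OF open_U sD sY(1)] sY(2) x] wz_add[OF sD sY(1) x]
          wz_scalar[OF smooth_on_const smooth_on_scalar[OF open_U s(1) smooth_V] x]
          wz_scalar[OF smooth_on_const smooth_on_scalar[OF open_U s(2) smooth_sections(2)] x]
          wz_scalar[OF s(1) smooth_V x] wz_scalar[OF s(2) smooth_sections(2) x] const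
        by (simp add: wa_simps scalar_simps)
    qed
    also have "\<dots> = D (D' (\<alpha> r)) x + c *s (H (F x) (a (Suc r) x) (a 0 x) *s V x + H (F x) (a r x) (a 0 x) *s \<alpha> 0 x)
      - c *s ((H (F x) (a (Suc r) x) (V x) + H (F x) (a r x) (\<beta> 0 x)) *s b 0 x)"
      unfolding dz_H[OF smooth_sections(1) smooth_V x] dz_H[OF smooth_sections(1) smooth_sections(1) x]
        D_b0[OF x] D'_a0[OF x] va_simps(2)[of g F e1 e2 r, symmetric]
        wa_simps(1)[of g F e1 "- e2" V, symmetric]
      by (simp add: H_simps F_in x scalar_simps)
    finally have DY: "D Y x = D (D' (\<alpha> r)) x + c *s (H (F x) (a (Suc r) x) (a 0 x) *s V x + H (F x) (a r x) (a 0 x) *s \<alpha> 0 x)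
      - c *s ((H (F x) (a (Suc r) x) (V x) + H (F x) (a r x) (\<beta> 0 x)) *s b 0 x)" .
    show "D' (\<alpha> (Suc r)) x + c *s (H (F x) (a (Suc r) x) (a 0 x) *s V x) - c *s (H (F x) (a (Suc r) x) (V x) *s b 0 x) =
      D Y x + (l x *s \<alpha> r x + (m x *s \<alpha> 0 x + n x *s a 0 x))"
      unfolding DY wa_simps(2)[of g F e1 e2 V r] 1[OF smooth_sections(3)] l_def m_def n_def j
      by (simp add: vec_eq_iff algebra_simps)
  qed
qed

lemma eta_holomorphic:
  assumes low: "\<And>i k x. i + k < r + s \<Longrightarrow> x \<in> U \<Longrightarrow> \<eta> i k x = 0" and x: "x \<in> U"
  shows "dz e1 (- e2) (\<eta> r s) x = 0"
proof -
  interpret Z: harmonic_jacobi g Q \<kappa> F U e1 e2 "\<lambda>_. 0" by (rule zero_section)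
  interpret C: harmonic_jacobi g Q \<kappa> F U e1 "- e2" "\<lambda>_. 0" by (rule Z.conjugate)
  have "span_pair U a (wa g F e1 e2 (\<lambda>_. 0)) {..<r} {..r} (D' (a r))
    (\<lambda>x. D' (wa g F e1 e2 (\<lambda>_. 0) r) x + c *s (H (F x) (a r x) (a 0 x) *s 0) - c *s (H (F x) (a r x) 0 *s b 0 x))"
    by (rule Z.D'_span) (auto simp: jac_zero low)
  then have 1: "H (F x) (D' (a r) x) (b s x) = 0"
    by (rule span_pair_H_fst[OF _ x]) (use low[of _ s x] x in \<open>auto simp: eta_def\<close>)
  have "span_pair U b (wa g F e1 (- e2) (\<lambda>_. 0)) {..<s} {..s} (wz g F e1 (- (- e2)) (b s))
    (\<lambda>x. wz g F e1 (- (- e2)) (wa g F e1 (- e2) (\<lambda>_. 0) s) x + c *s (H (F x) (b s x) (b 0 x) *s 0)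
       - c *s (H (F x) (b s x) 0 *s va g F e1 (- (- e2)) 0 x))"
    by (rule C.D'_span) (auto simp: jac_zero eta_conj low)
  then have "H (F x) (D (b s) x) (a r x) = 0"
    unfolding minus_minus
    by (rule span_pair_H_fst[OF _ x]) (use low[of r _ x] x in \<open>auto simp: eta_def intro: H_zero_sym F_in\<close>)
  then have 2: "H (F x) (a r x) (D (b s) x) = 0" using H_cnj[OF F_in[OF x], of "D (b s) x" "a r x"] by simp
  have "dz e1 (- e2) (\<eta> r s) x = H (F x) (D' (a r) x) (b s x) + H (F x) (a r x) (D (b s) x)"
    unfolding eta_def[abs_def] dz_H[OF smooth_sections(1,2) x] by simp
  then show ?thesis by (simp add: 1 2)
qed

lemma jac_holomorphic:
  assumes eta: "\<And>i k x. x \<in> U \<Longrightarrow> \<eta> i k x = 0"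
    and low: "\<And>i k x. i + k < r + s \<Longrightarrow> x \<in> U \<Longrightarrow> \<j> i k x = 0" and x: "x \<in> U"
  shows "dz e1 (- e2) (\<j> r s) x = 0"
proof -
  interpret C: harmonic_jacobi g Q \<kappa> F U e1 "- e2" V by (rule conjugate)
  have H_eta: "H (F x) (a i x) (b k x) = 0" "H (F x) (b k x) (a i x) = 0" for i k
    using eta[OF x, of i k] H_cnj[OF F_in[OF x], of "a i x" "b k x"] by (auto simp: eta_def)
  have "span_pair U a \<alpha> {..<r} {..r} (D' (a r))
    (\<lambda>x. D' (\<alpha> r) x + c *s (H (F x) (a r x) (a 0 x) *s V x) - c *s (H (F x) (a r x) (V x) *s b 0 x))"
    by (rule D'_span) (auto simp: eta low)
  then have "H (F x) (D' (\<alpha> r) x + c *s (H (F x) (a r x) (a 0 x) *s V x) - c *s (H (F x) (a r x) (V x) *s b 0 x)) (b s x)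
    + H (F x) (D' (a r) x) (\<beta> s x) = 0"
    by (rule span_pair_H[OF _ x]) (use low[of _ s x] x in \<open>auto simp: jac_def H_eta\<close>)
  then have 1: "H (F x) (D' (\<alpha> r) x) (b s x) + H (F x) (D' (a r) x) (\<beta> s x) =
      c * H (F x) (a r x) (V x) * H (F x) (b 0 x) (b s x) - c * H (F x) (a r x) (a 0 x) * H (F x) (V x) (b s x)"
    by (simp add: H_simps F_in x algebra_simps)
  have low': "jac g F e1 (- e2) V k i x = 0" if "i + k < r + s" "x \<in> U" for i k x
    using low[OF that] jac_conj[OF that(2)] by simp
  have "span_pair U b \<beta> {..<s} {..s} (wz g F e1 (- (- e2)) (b s))
    (\<lambda>x. wz g F e1 (- (- e2)) (\<beta> s) x + c *s (H (F x) (b s x) (b 0 x) *s V x)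
       - c *s (H (F x) (b s x) (V x) *s va g F e1 (- (- e2)) 0 x))"
    by (rule C.D'_span) (auto simp: eta_conj eta low')
  then have "H (F x) (D (\<beta> s) x + c *s (H (F x) (b s x) (b 0 x) *s V x) - c *s (H (F x) (b s x) (V x) *s a 0 x)) (a r x)
    + H (F x) (D (b s) x) (\<alpha> r x) = 0"
    unfolding minus_minus
    by (rule span_pair_H[OF _ x]) (use low'[of r _ x] x in \<open>auto simp: jac_def H_eta\<close>)
  then have "H (F x) (D (\<beta> s) x) (a r x) + H (F x) (D (b s) x) (\<alpha> r x) =
      c * H (F x) (b s x) (V x) * H (F x) (a 0 x) (a r x) - c * H (F x) (b s x) (b 0 x) * H (F x) (V x) (a r x)"
    by (simp add: H_simps F_in x algebra_simps)
  \<comment> \<open>Conjugation brings the mirrored identity into the slots of \<open>1\<close>; its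
    right-hand side is then the negative of that of \<open>1\<close>.\<close>
  from arg_cong[OF this, of cnj]
  have 2: "H (F x) (a r x) (D (\<beta> s) x) + H (F x) (\<alpha> r x) (D (b s) x) =
      c * H (F x) (V x) (b s x) * H (F x) (a r x) (a 0 x) - c * H (F x) (b 0 x) (b s x) * H (F x) (a r x) (V x)"
    by (simp add: H_cnj F_in x)
  have "dz e1 (- e2) (\<j> r s) x =
    (H (F x) (D' (\<alpha> r) x) (b s x) + H (F x) (D' (a r) x) (\<beta> s x)) +
    (H (F x) (a r x) (D (\<beta> s) x) + H (F x) (\<alpha> r x) (D (b s) x))"
    unfolding jac_def[abs_def]
      dz_add[OF smooth_H[OF smooth_sections(3,2)] smooth_H[OF smooth_sections(1,4)] x]
      dz_H[OF smooth_sections(3,2) x] dz_H[OF smooth_sections(1,4) x] by simp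
  then show ?thesis unfolding 1 2 by (simp add: algebra_simps)
qed

end

section \<open>Change of coordinates on the domain\<close>

text \<open>\<open>DT1\<close> and \<open>DT2\<close> are the Cauchy-Riemann equations with complex
  derivative \<open>\<tau>\<close>. Stated for free directions, they persist when \<open>e2\<close>
  changes sign and \<open>\<tau>\<close> is conjugated.\<close>

locale domain_change = M: kaehler_map g Q \<kappa> F U + P: kaehler_map g Q \<kappa> G U'
  for g :: "complex^'n \<Rightarrow> complex^'n \<Rightarrow> complex^'n \<Rightarrow> real" and Q \<kappa>
    and F :: "'a::euclidean_space \<Rightarrow> complex^'n" and U and G :: "'a \<Rightarrow> complex^'n" and U' +
  fixes T :: "'a \<Rightarrow> 'a" and e1 e2 :: 'a and \<tau> :: "'a \<Rightarrow> complex"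
  assumes T_U: "T ` U' \<subseteq> U" and smooth_T: "smooth_on T U'" and smooth_\<tau>: "smooth_on \<tau> U'"
    and G_eq: "\<And>x. x \<in> U' \<Longrightarrow> G x = F (T x)"
    and DT1: "\<And>x. x \<in> U' \<Longrightarrow> Dif T x e1 = Re (\<tau> x) *\<^sub>R e1 + Im (\<tau> x) *\<^sub>R e2"
    and DT2: "\<And>x. x \<in> U' \<Longrightarrow> Dif T x e2 = - (Im (\<tau> x) *\<^sub>R e1) + Re (\<tau> x) *\<^sub>R e2"
begin

lemma T_in: "x \<in> U' \<Longrightarrow> T x \<in> U"
  using T_U by blast

lemma smooth_pull: "smooth_on Z U \<Longrightarrow> smooth_on (\<lambda>y. Z (T y)) U'"
  by (rule smooth_on_compose[OF M.open_U P.open_U T_U _ smooth_T])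

lemma Dif_pull:
  assumes "smooth_on Z U" "x \<in> U'"
  shows "Dif (\<lambda>y. Z (T y)) x X = Dif Z (T x) (Dif T x X)"
  using Dif_eqI[OF has_derivative_compose[OF smooth_on_Dif_works[OF smooth_T P.open_U assms(2)]
        smooth_on_Dif_works[OF assms(1) M.open_U T_in[OF assms(2)]]]] by simp

lemma DG: "x \<in> U' \<Longrightarrow> Dif G x X = Dif F (T x) (Dif T x X)"
  using Dif_pull[OF M.smooth_F] Dif_cong[OF P.open_U, of x G "\<lambda>y. F (T y)"] G_eq by simp

lemma cov_pull:
  assumes "smooth_on Z U" "x \<in> U'"
  shows "cov g G X (\<lambda>y. Z (T y)) x = cov g F (Dif T x X) Z (T x)"
  unfolding cov_def Dif_pull[OF assms] DG[OF assms(2)] G_eq[OF assms(2)] by simp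

lemma wz_pull:
  assumes "smooth_on Z U" "x \<in> U'"
  shows "wz g G e1 e2 (\<lambda>y. Z (T y)) x = \<tau> x *s wz g F e1 e2 Z (T x)"
proof -
  have "cov g F (- (r *\<^sub>R X)) Z (T x) = - (r *\<^sub>R cov g F X Z (T x))" for r X
    unfolding M.cov_dir[OF assms(1) T_in[OF assms(2)]] ..
  then show ?thesis
    unfolding wz_def cov_pull[OF assms] DT1[OF assms(2)] DT2[OF assms(2)]
      M.cov_dir(1,2)[OF assms(1) T_in[OF assms(2)]] scalar_eq_JC[of "\<tau> x"]
    by (simp add: JC_simps scalar_simps vec_eq_iff scaleR_conv_of_real[where 'a=complex] algebra_simps)
qed

lemma vz_pull:
  assumes "x \<in> U'"
  shows "vz e1 e2 G x = \<tau> x *s vz e1 e2 F (T x)"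
proof -
  have lin: "linear (Dif F (T x))" by (rule Dif_linear[OF M.diff_F[OF T_in[OF assms]]])
  show ?thesis
    unfolding vz_def DG[OF assms] DT1[OF assms] DT2[OF assms] linear_add[OF lin] linear_neg[OF lin]
      linear_cmul[OF lin] scalar_eq_JC[of "\<tau> x"]
    by (simp add: JC_simps scalar_simps vec_eq_iff scaleR_conv_of_real[where 'a=complex] algebra_simps)
qed

lemma conjugate: "domain_change g Q \<kappa> F U G U' T e1 (- e2) (\<lambda>x. cnj (\<tau> x))"
proof
  show "smooth_on (\<lambda>x. cnj (\<tau> x)) U'"
    by (rule smooth_on_linear[OF bounded_linear_cnj P.open_U smooth_\<tau>])
  fix x assume x: "x \<in> U'"
  show "Dif T x (- e2) = - (Im (cnj (\<tau> x)) *\<^sub>R e1) + Re (cnj (\<tau> x)) *\<^sub>R (- e2)"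
    using linear_neg[OF Dif_linear[OF smooth_on_differentiable[OF smooth_T P.open_U x]], of e2] DT2[OF x] by simp
qed (auto simp: T_U smooth_T G_eq DT1 T_in)

text \<open>Each differentiation also hits the accumulated power of \<open>\<tau>\<close>, which
  leaves multiples of lower generators. The coefficients are the same for \<open>va\<close> and
  \<open>wa\<close>, so no eps-generators occur and \<open>K\<close> is empty.\<close>

lemma span_pull:
  assumes V: "smooth_on V U" and W: "\<And>x. x \<in> U' \<Longrightarrow> W x = V (T x)"
  shows "span_pair U' (\<lambda>i x. va g F e1 e2 i (T x)) (\<lambda>i x. wa g F e1 e2 V i (T x)) {..<r} {}
    (\<lambda>x. va g G e1 e2 r x - \<tau> x ^ Suc r *s va g F e1 e2 r (T x))
    (\<lambda>x. wa g G e1 e2 W r x - \<tau> x ^ Suc r *s wa g F e1 e2 V r (T x))"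
proof (induction r)
  case 0
  have "wa g G e1 e2 W 0 x = \<tau> x *s wa g F e1 e2 V 0 (T x)" if x: "x \<in> U'" for x
    unfolding wa_simps by (rule trans[OF P.wz_cong[OF x W] wz_pull[OF V x]])
  then show ?case
    by (intro span_pair.cong[OF span_pair.zero]) (simp_all add: va_simps vz_pull)
next
  case (Suc r)
  let ?A = "\<lambda>i x. va g F e1 e2 i (T x)" and ?B = "\<lambda>i x. wa g F e1 e2 V i (T x)"
  have sW: "smooth_on W U'" by (rule smooth_on_cong[OF P.open_U W, THEN iffD2, OF _ smooth_pull[OF V]])
  have sA: "smooth_on (?A i) U'" "smooth_on (?B i) U'" for i
    by (rule smooth_pull, rule M.smooth_va, rule smooth_pull, rule M.smooth_wa[OF V])
  have s: "smooth_on (va g G e1 e2 r) U'" "smooth_on (wa g G e1 e2 W r) U'"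
    by (rule P.smooth_va, rule P.smooth_wa[OF sW])
  have p: "smooth_on (\<lambda>x. \<tau> x ^ Suc r) U'" by (rule smooth_on_power[OF P.open_U smooth_\<tau>])
  define f where "f = dz e1 e2 (\<lambda>x. \<tau> x ^ Suc r)"
  have f: "smooth_on f U'" unfolding f_def by (rule P.smooth_dz[OF p])
  have S: "span_pair U' ?A ?B {..<Suc r} {} (wz g G e1 e2 (\<lambda>x. va g G e1 e2 r x - \<tau> x ^ Suc r *s ?A r x))
      (wz g G e1 e2 (\<lambda>x. wa g G e1 e2 W r x - \<tau> x ^ Suc r *s ?B r x))"
  proof (rule P.span_pair_wz[OF Suc.IH sA smooth_\<tau>])
    fix i x assume x: "x \<in> U'"
    show "wz g G e1 e2 (?A i) x = \<tau> x *s ?A (Suc i) x"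
      unfolding va_simps(2) by (rule wz_pull[OF M.smooth_va x])
    show "wz g G e1 e2 (?B i) x = \<tau> x *s ?B (Suc i) x"
      unfolding wa_simps(2) by (rule wz_pull[OF M.smooth_wa[OF V] x])
  qed auto
  have "span_pair U' ?A ?B {..<Suc r} {} (?A r) (?B r)" by (rule span_pair.gen) simp
  from span_pair.add[OF S span_pair.scalar[OF f this]] show ?case
  proof (rule span_pair.cong)
    fix x assume x: "x \<in> U'"
    show "va g G e1 e2 (Suc r) x - \<tau> x ^ Suc (Suc r) *s ?A (Suc r) x =
      wz g G e1 e2 (\<lambda>x. va g G e1 e2 r x - \<tau> x ^ Suc r *s ?A r x) x + f x *s ?A r x"
      unfolding P.wz_diff[OF s(1) smooth_on_scalar[OF P.open_U p sA(1)] x] P.wz_scalar[OF p sA(1) x]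
        wz_pull[OF M.smooth_va x] f_def va_simps(2)
      by (simp add: vec_eq_iff)
    show "wa g G e1 e2 W (Suc r) x - \<tau> x ^ Suc (Suc r) *s ?B (Suc r) x =
      wz g G e1 e2 (\<lambda>x. wa g G e1 e2 W r x - \<tau> x ^ Suc r *s ?B r x) x + f x *s ?B r x"
      unfolding P.wz_diff[OF s(2) smooth_on_scalar[OF P.open_U p sA(2)] x] P.wz_scalar[OF p sA(2) x]
        wz_pull[OF M.smooth_wa[OF V] x] f_def wa_simps(2)
      by (simp add: vec_eq_iff)
  qed
qed

text \<open>The error terms \<open>Z\<close> and \<open>W\<close> lie in spans of lower index and
  pair to zero by \<open>low\<close>. The antilinear slot conjugates \<open>cnj (\<tau> x)\<close>
  back, so both leading factors are powers of \<open>\<tau> x\<close> and their exponents add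
  up.\<close>

lemma eta_pull:
  assumes x: "x \<in> U'" and low: "\<And>i k. i + k < r + s \<Longrightarrow> eta g F e1 e2 i k (T x) = 0"
  shows "eta g G e1 e2 r s x = \<tau> x ^ (r + s + 2) * eta g F e1 e2 r s (T x)"
proof -
  interpret C: domain_change g Q \<kappa> F U G U' T e1 "- e2" "\<lambda>x. cnj (\<tau> x)" by (rule conjugate)
  let ?H = "hform (g (G x))"
  let ?A = "\<lambda>i. va g F e1 e2 i (T x)" and ?B = "\<lambda>i. va g F e1 (- e2) i (T x)"
  define Z where "Z = va g G e1 e2 r x - \<tau> x ^ Suc r *s ?A r"
  define W where "W = va g G e1 (- e2) s x - cnj (\<tau> x) ^ Suc s *s ?B s"
  have AB: "?H (?A i) (?B k) = 0" if "i + k < r + s" for i k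
    using low[OF that] by (simp add: eta_def G_eq x)
  have Z: "?H Z B = 0" if "\<And>i. i < r \<Longrightarrow> ?H (?A i) B = 0" for B
    unfolding Z_def by (rule P.span_pair_H_fst[OF span_pull[of "\<lambda>_. 0" "\<lambda>_. 0"] x]) (auto simp: that)
  have W: "?H W B = 0" if "\<And>i. i < s \<Longrightarrow> ?H (?B i) B = 0" for B
    unfolding W_def by (rule P.span_pair_H_fst[OF C.span_pull[of "\<lambda>_. 0" "\<lambda>_. 0"] x]) (auto simp: that)
  have sym: "?H X Y = 0" if "?H Y X = 0" for X Y using M.H_zero_sym[OF P.F_in[OF x] that] .
  have ZB: "?H Z (?B k) = 0" if "k \<le> s" for k
    by (rule Z, rule AB) (use that in linarith)
  have AW: "?H (?A i) W = 0" if "i \<le> r" for i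
    by (rule sym, rule W, rule sym, rule AB) (use that in linarith)
  have ZW: "?H Z W = 0"
    by (rule sym, rule W, rule sym, rule ZB) linarith
  have a: "va g G e1 e2 r x = Z + \<tau> x ^ Suc r *s ?A r" "va g G e1 (- e2) s x = W + cnj (\<tau> x) ^ Suc s *s ?B s"
    by (simp_all add: Z_def W_def)
  have "?H (va g G e1 e2 r x) (va g G e1 (- e2) s x) = \<tau> x ^ (r + s + 2) * ?H (?A r) (?B s)"
    unfolding a by (simp add: M.H_simps P.F_in x ZW AW ZB power_add mult_ac)
  then show ?thesis by (simp add: eta_def G_eq x)
qed

lemma jac_pull:
  assumes x: "x \<in> U'" and eta: "\<And>i k. eta g F e1 e2 i k (T x) = 0"
    and V: "smooth_on V U" and W': "\<And>x. x \<in> U' \<Longrightarrow> W x = V (T x)"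
    and low: "\<And>i k. i + k < r + s \<Longrightarrow> jac g F e1 e2 V i k (T x) = 0"
  shows "jac g G e1 e2 W r s x = \<tau> x ^ (r + s + 2) * jac g F e1 e2 V r s (T x)"
proof -
  interpret C: domain_change g Q \<kappa> F U G U' T e1 "- e2" "\<lambda>x. cnj (\<tau> x)" by (rule conjugate)
  let ?H = "hform (g (G x))"
  let ?A = "\<lambda>i. va g F e1 e2 i (T x)" and ?B = "\<lambda>i. va g F e1 (- e2) i (T x)"
  let ?A' = "\<lambda>i. wa g F e1 e2 V i (T x)" and ?B' = "\<lambda>i. wa g F e1 (- e2) V i (T x)"
  define Z where "Z = va g G e1 e2 r x - \<tau> x ^ Suc r *s ?A r"
  define Y where "Y = va g G e1 (- e2) s x - cnj (\<tau> x) ^ Suc s *s ?B s"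
  define Z' where "Z' = wa g G e1 e2 W r x - \<tau> x ^ Suc r *s ?A' r"
  define Y' where "Y' = wa g G e1 (- e2) W s x - cnj (\<tau> x) ^ Suc s *s ?B' s"
  have sym: "?H X Y = 0" if "?H Y X = 0" for X Y using M.H_zero_sym[OF P.F_in[OF x] that] .
  have cnj: "?H X Y = cnj (?H Y X)" for X Y by (simp add: M.H_cnj P.F_in x)
  have AB: "?H (?A i) (?B k) = 0" for i k
    using eta[of i k] by (simp add: eta_def G_eq x)
  have BA: "?H (?B i) (?A k) = 0" for i k by (rule sym, rule AB)
  have J: "?H (?A' i) (?B k) + ?H (?A i) (?B' k) = 0" if "i + k < r + s" for i k
    using low[OF that] by (simp add: jac_def G_eq x)
  have J': "?H (?B' k) (?A i) + ?H (?B k) (?A' i) = 0" if "i + k < r + s" for i k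
    using arg_cong[OF J[OF that], of cnj]
    unfolding cnj[of "?B' k" "?A i"] cnj[of "?B k" "?A' i"] by (simp add: add.commute)
  have Z: "?H Z' B + ?H Z B' = 0"
    if "\<And>i. ?H (?A i) B = 0" "\<And>i. i < r \<Longrightarrow> ?H (?A' i) B + ?H (?A i) B' = 0" for B B'
    unfolding Z_def Z'_def by (rule P.span_pair_H[OF span_pull[OF V W'] x]) (auto simp: that)
  have Y: "?H Y' B + ?H Y B' = 0"
    if "\<And>i. ?H (?B i) B = 0" "\<And>i. i < s \<Longrightarrow> ?H (?B' i) B + ?H (?B i) B' = 0" for B B'
    unfolding Y_def Y'_def by (rule P.span_pair_H[OF C.span_pull[OF V W'] x]) (auto simp: that)
  have Z0: "?H Z B = 0" if "\<And>i. i < r \<Longrightarrow> ?H (?A i) B = 0" for B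
    unfolding Z_def by (rule P.span_pair_H_fst[OF span_pull[OF V W'] x]) (auto simp: that)
  have ZB: "?H Z' (?B k) + ?H Z (?B' k) = 0" if "k \<le> s" for k
  proof (rule Z)
    show "?H (?A i) (?B k) = 0" for i by (rule AB)
    show "?H (?A' i) (?B k) + ?H (?A i) (?B' k) = 0" if "i < r" for i
      by (rule J) (use that \<open>k \<le> s\<close> in linarith)
  qed
  have BZ: "?H (?B' k) Z + ?H (?B k) Z' = 0" if "k \<le> s" for k
    using arg_cong[OF ZB[OF that], of cnj]
    unfolding cnj[of "?B' k" Z] cnj[of "?B k" Z'] by (simp add: add.commute)
  have "?H Y' (?A k) + ?H Y (?A' k) = 0" if "k \<le> r" for k
  proof (rule Y)
    show "?H (?B i) (?A k) = 0" for i by (rule BA)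
    show "?H (?B' i) (?A k) + ?H (?B i) (?A' k) = 0" if "i < s" for i
      by (rule J') (use that \<open>k \<le> r\<close> in linarith)
  qed
  from this[of r] have AY: "?H (?A' r) Y + ?H (?A r) Y' = 0"
    unfolding cnj[of Y' "?A r"] cnj[of Y "?A' r"]
    by (metis add.commute complex_cnj_add complex_cnj_zero complex_cnj_cnj le_refl)
  have "?H Y' Z + ?H Y Z' = 0"
  proof (rule Y)
    show "?H (?B i) Z = 0" for i by (rule sym, rule Z0, rule AB)
    show "?H (?B' i) Z + ?H (?B i) Z' = 0" if "i < s" for i
      by (rule BZ) (use that in linarith)
  qed
  then have ZY: "?H Z' Y + ?H Z Y' = 0"
    unfolding cnj[of Y' Z] cnj[of Y Z'] by (metis add.commute complex_cnj_add complex_cnj_zero complex_cnj_cnj)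
  have e: "va g G e1 e2 r x = Z + \<tau> x ^ Suc r *s ?A r" "va g G e1 (- e2) s x = Y + cnj (\<tau> x) ^ Suc s *s ?B s"
    "wa g G e1 e2 W r x = Z' + \<tau> x ^ Suc r *s ?A' r" "wa g G e1 (- e2) W s x = Y' + cnj (\<tau> x) ^ Suc s *s ?B' s"
    by (simp_all add: Z_def Y_def Z'_def Y'_def)
  define t where "t = \<tau> x ^ Suc r"
  define u where "u = \<tau> x ^ Suc s"
  have u: "cnj (cnj (\<tau> x) ^ Suc s) = u" by (simp add: u_def)
  \<comment> \<open>Each parenthesis is the eps-coefficient of one of the four pairings between
    leading and error parts; only the pairing of the two leading parts survives.\<close>
  have "jac g G e1 e2 W r s x = (?H Z' Y + ?H Z Y') + t * (?H (?A' r) Y + ?H (?A r) Y') +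
      u * (?H Z' (?B s) + ?H Z (?B' s)) + t * u * (?H (?A' r) (?B s) + ?H (?A r) (?B' s))"
    unfolding jac_def e t_def[symmetric] M.H_simps[OF P.F_in[OF x]] u by (simp add: algebra_simps)
  also have "\<dots> = t * u * jac g F e1 e2 V r s (T x)"
    unfolding ZY AY ZB[OF order.refl] by (simp add: jac_def G_eq x)
  also have "t * u = \<tau> x ^ (r + s + 2)" by (simp add: t_def u_def power_add mult_ac)
  finally show ?thesis .
qed

end

section \<open>Change of the chart of the target\<close>

locale target_change = M: kaehler_chart g Q \<kappa> + N: kaehler_chart g' Q' \<kappa>'
  for g :: "complex^'n \<Rightarrow> complex^'n \<Rightarrow> complex^'n \<Rightarrow> real" and Q \<kappa>
    and g' :: "complex^'n \<Rightarrow> complex^'n \<Rightarrow> complex^'n \<Rightarrow> real" and Q' \<kappa>' +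
  fixes T :: "complex^'n \<Rightarrow> complex^'n"
  assumes T_Q: "T ` Q \<subseteq> Q'" and smooth_T: "smooth_on T Q"
    and T_J: "\<And>q X. q \<in> Q \<Longrightarrow> Dif T q (JC X) = JC (Dif T q X)"
    and isometry: "\<And>q X Y. q \<in> Q \<Longrightarrow> g q X Y = g' (T q) (Dif T q X) (Dif T q Y)"
begin

lemma T_in: "q \<in> Q \<Longrightarrow> T q \<in> Q'"
  using T_Q by blast

lemma linear_DT: "q \<in> Q \<Longrightarrow> linear (Dif T q)"
  by (rule Dif_linear[OF smooth_on_differentiable[OF smooth_T M.open_Q]])

lemma DT_surj:
  assumes q: "q \<in> Q"
  obtains Z where "Dif T q Z = Z'"
proof -
  have "X = 0" if "Dif T q X = 0" for X
    using isometry[OF q, of X X] M.pos_g[OF q, of X] that N.g_simps(9)[OF T_in[OF q]] by fastforce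
  then have "inj (Dif T q)" using linear_DT[OF q] by (simp add: linear_injective_0)
  then have "surj (Dif T q)" using linear_injective_imp_surjective[OF linear_DT[OF q]] by blast
  then show ?thesis using that by (metis surjD)
qed

text \<open>The isometry relation is differentiated and inserted into the Koszul formula. By
  symmetry of the second derivatives of \<open>T\<close> all but one of their terms cancel;
  surjectivity of \<open>Dif T q\<close> allows testing against every vector.\<close>

lemma christoffel_push:
  assumes q: "q \<in> Q"
  shows "christoffel g' (T q) (Dif T q X) (Dif T q Y) =
    Dif T q (christoffel g q X Y) - Dif (\<lambda>p. Dif T p Y) q X"
proof (rule N.christoffel_unique[OF T_in[OF q]])
  fix Z'
  obtain Z where Z: "Dif T q Z = Z'" using DT_surj[OF q] .
  define D2 where "D2 X Y = Dif (\<lambda>p. Dif T p Y) q X" for X Y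
  have D2: "D2 X Y = D2 Y X" for X Y
    unfolding D2_def by (rule Dif_commute[OF M.open_Q smooth_T q])
  have d: "(\<lambda>p. Dif T p Y) differentiable (at q)" for Y
    by (rule smooth_on_differentiable[OF smooth_on_Dif[OF M.open_Q smooth_T] M.open_Q q])
  have dg: "M.dg q X Y Z = N.dg (T q) (Dif T q X) (Dif T q Y) (Dif T q Z) +
      g' (T q) (D2 X Y) (Dif T q Z) + g' (T q) (Dif T q Y) (D2 X Z)" for X Y Z
  proof -
    have "M.dg q X Y Z = Dif (\<lambda>p. g' (T p) (Dif T p Y) (Dif T p Z)) q X"
      unfolding M.dg_def by (rule fun_cong[OF Dif_cong[OF M.open_Q q]]) (rule isometry)
    then show ?thesis
      unfolding N.dg_def D2_def
      by (simp add: smooth_bil_Dif[OF N.open_Q N.smooth_bil_g smooth_on_differentiable[OF smooth_T M.open_Q q] d d T_in[OF q]])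
  qed
  have sym: "g' (T q) X Y = g' (T q) Y X" for X Y by (rule N.sym_g[OF T_in[OF q]])
  have "g' (T q) (Dif T q (christoffel g q X Y)) (Dif T q Z) = (M.dg q X Y Z + M.dg q Y X Z - M.dg q Z X Y) / 2"
    using isometry[OF q] M.christoffel_koszul[OF q] by metis
  then show "g' (T q) (Dif T q (christoffel g q X Y) - Dif (\<lambda>p. Dif T p Y) q X) Z' =
    (N.dg (T q) (Dif T q X) (Dif T q Y) Z' + N.dg (T q) (Dif T q Y) (Dif T q X) Z' - N.dg (T q) Z' (Dif T q X) (Dif T q Y)) / 2"
    unfolding Z[symmetric] N.g_simps(3)[OF T_in[OF q]] D2_def[symmetric] dg
      D2[of Y X] D2[of Z X] D2[of Z Y] sym[of "D2 X Z" "Dif T q Y"] sym[of "D2 X Z"] sym[of "Dif T q X"]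
    by (simp add: field_simps)
qed

end

locale target_change_map = target_change g Q \<kappa> g' Q' \<kappa>' T + M: kaehler_map g Q \<kappa> F U + N: kaehler_map g' Q' \<kappa>' G U
  for g :: "complex^'n \<Rightarrow> complex^'n \<Rightarrow> complex^'n \<Rightarrow> real" and Q \<kappa>
    and g' :: "complex^'n \<Rightarrow> complex^'n \<Rightarrow> complex^'n \<Rightarrow> real" and Q' \<kappa>' T
    and F :: "'a::euclidean_space \<Rightarrow> complex^'n" and G U +
  assumes G_eq: "\<And>x. x \<in> U \<Longrightarrow> G x = T (F x)"
begin

definition push :: "('a \<Rightarrow> complex^'n) \<Rightarrow> 'a \<Rightarrow> complex^'n" where
  "push Z x = Dif T (F x) (Z x)"

lemma Dif_push:
  assumes Z: "smooth_on Z U" and x: "x \<in> U"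
  shows "Dif (push Z) x X = Dif (\<lambda>p. Dif T p (Z x)) (F x) (Dif F x X) + Dif T (F x) (Dif Z x X)"
proof -
  \<comment> \<open>A dummy real argument, evaluated at 1, makes the differential of
    \<open>T\<close> a bilinear family, so that \<open>smooth_bil_Dif\<close> applies.\<close>
  let ?B = "\<lambda>q u (w::real). w *\<^sub>R Dif T q u"
  have B: "smooth_bil ?B Q"
    unfolding smooth_bil_def bilinear_def
  proof (intro conjI ballI allI)
    fix q u and w :: real assume q: "q \<in> Q"
    show "linear (?B q u)" by (auto intro!: linearI simp: scaleR_add_left)
    show "linear (\<lambda>u. ?B q u w)"
      by (auto intro!: linearI simp: linear_add[OF linear_DT[OF q]] linear_cmul[OF linear_DT[OF q]] scaleR_add_right)
  next
    fix u and w :: real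
    show "smooth_on (\<lambda>q. w *\<^sub>R Dif T q u) Q"
      by (rule smooth_on_scaleR[OF M.open_Q smooth_on_const smooth_on_Dif[OF M.open_Q smooth_T]])
  qed
  have p: "push Z = (\<lambda>y. ?B (F y) (Z y) 1)" by (simp add: fun_eq_iff push_def)
  show "Dif (push Z) x X = Dif (\<lambda>p. Dif T p (Z x)) (F x) (Dif F x X) + Dif T (F x) (Dif Z x X)"
    unfolding p smooth_bil_Dif[OF M.open_Q B M.diff_F[OF x] M.diff_sec[OF Z x] differentiable_const M.F_in[OF x]]
    by simp
qed

lemma DG: "x \<in> U \<Longrightarrow> Dif G x X = Dif T (F x) (Dif F x X)"
proof -
  assume x: "x \<in> U"
  have "Dif G x X = Dif (\<lambda>y. T (F y)) x X"
    by (rule fun_cong[OF Dif_cong[OF M.open_U x]]) (rule G_eq)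
  also have "\<dots> = Dif T (F x) (Dif F x X)"
    using Dif_eqI[OF has_derivative_compose[OF Dif_works[OF M.diff_F[OF x]]
          smooth_on_Dif_works[OF smooth_T M.open_Q M.F_in[OF x]]]] by simp
  finally show ?thesis .
qed

text \<open>The second derivative of \<open>T\<close> in \<open>Dif_push\<close> cancels the
  inhomogeneous term in \<open>christoffel_push\<close>.\<close>

lemma cov_push:
  assumes Z: "smooth_on Z U" and x: "x \<in> U"
  shows "cov g' G X (push Z) x = Dif T (F x) (cov g F X Z x)"
  unfolding cov_def Dif_push[OF assms] G_eq[OF x] DG[OF x]
  using linear_add[OF linear_DT[OF M.F_in[OF x]]]
  by (simp add: push_def christoffel_push M.F_in x)

lemma DT_scalar: "x \<in> U \<Longrightarrow> Dif T (F x) (c *s X) = c *s Dif T (F x) X"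
  unfolding scalar_eq_JC[of c]
  using linear_add[OF linear_DT[OF M.F_in]] linear_cmul[OF linear_DT[OF M.F_in]] by (simp add: T_J M.F_in)

lemma wz_push:
  assumes Z: "smooth_on Z U" and x: "x \<in> U"
  shows "wz g' G e1 e2 (push Z) x = push (wz g F e1 e2 Z) x"
  unfolding wz_def cov_push[OF assms] push_def
  using linear_diff[OF linear_DT[OF M.F_in[OF x]]] by (simp add: DT_scalar x T_J M.F_in)

lemma va_push: "x \<in> U \<Longrightarrow> va g' G e1 e2 r x = push (va g F e1 e2 r) x"
proof (induction r arbitrary: x)
  case 0
  then show ?case
    unfolding va_simps vz_def[abs_def] push_def
    using linear_diff[OF linear_DT[OF M.F_in[OF 0]]] by (simp add: DT_scalar DG T_J M.F_in)
next
  case (Suc r)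
  have "va g' G e1 e2 (Suc r) x = wz g' G e1 e2 (push (va g F e1 e2 r)) x"
    unfolding va_simps by (rule N.wz_cong[OF Suc.prems Suc.IH])
  then show ?case by (simp add: wz_push[OF M.smooth_va Suc.prems] va_simps)
qed

lemma wa_push:
  assumes V: "smooth_on V U" and W: "\<And>x. x \<in> U \<Longrightarrow> W x = push V x"
  shows "x \<in> U \<Longrightarrow> wa g' G e1 e2 W r x = push (wa g F e1 e2 V r) x"
proof (induction r arbitrary: x)
  case 0
  then show ?case using N.wz_cong[of x W "push V"] W wz_push[OF V] by (simp add: wa_simps)
next
  case (Suc r)
  have "wa g' G e1 e2 W (Suc r) x = wz g' G e1 e2 (push (wa g F e1 e2 V r)) x"
    unfolding wa_simps by (rule N.wz_cong[OF Suc.prems Suc.IH])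
  then show ?case by (simp add: wz_push[OF M.smooth_wa[OF V] Suc.prems] wa_simps)
qed

lemma H_push: "x \<in> U \<Longrightarrow> hform (g' (G x)) (push Z x) (push W x) = hform (g (F x)) (Z x) (W x)"
  by (simp add: hform_def push_def isometry M.F_in G_eq T_J)

lemma eta_push: "x \<in> U \<Longrightarrow> eta g' G e1 e2 r s x = eta g F e1 e2 r s x"
  by (simp add: eta_def va_push H_push)

lemma jac_push:
  assumes "smooth_on V U" "\<And>x. x \<in> U \<Longrightarrow> W x = Dif T (F x) (V x)" "x \<in> U"
  shows "jac g' G e1 e2 W r s x = jac g F e1 e2 V r s x"
  using wa_push[OF assms(1) _ assms(3), of W] assms(2,3) by (simp add: jac_def va_push H_push push_def[of V])

end

section \<open>The complexified tangent bundle\<close>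

text \<open>\<open>emb X Y\<close> is the sum of the (1,0)-part of \<open>X\<close> and of the (0,1)-part of \<open>Y\<close>.\<close>

definition emb :: "complex^'n \<Rightarrow> complex^'n \<Rightarrow> (complex^'n) \<times> (complex^'n)" where
  "emb X Y = ((1/2) *\<^sub>R (X + Y), (1/2) *\<^sub>R JC (Y - X))"

lemma emb_real: "(V, 0) = emb V V"
  by (simp add: emb_def JC_simps scaleR_2[symmetric])

lemma scaleR_eq_scalar: "r *\<^sub>R (X::complex^'n) = of_real r *s X"
  by (simp add: vec_eq_iff scaleR_conv_of_real[where 'a=complex])

lemma d_z_eq: "d_z F x = emb (vz 1 \<i> F x) 0"
  unfolding d_z_def proj10_def csmul_def emb_def vz_def
  by (simp add: scaleR_eq_scalar vec_eq_iff field_simps)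

lemma d_zbar_eq:
  assumes "F differentiable (at x)"
  shows "d_zbar F x = emb (vz 1 (- \<i>) F x) 0"
  unfolding d_zbar_def proj10_def csmul_def emb_def vz_def
  using linear_neg[OF Dif_linear[OF assms], of \<i>]
  by (simp add: scaleR_eq_scalar vec_eq_iff field_simps)

context kaehler_map
begin

lemma covC_emb:
  assumes "smooth_on X U" "smooth_on Y U" "x \<in> U"
  shows "covC g F e (\<lambda>y. emb (X y) (Y y)) x = emb (cov g F e X x) (cov g F e Y x)"
proof -
  have d: "smooth_on (\<lambda>y. Y y - X y) U" "smooth_on (\<lambda>y. X y + Y y) U"
    using smooth_on_diff[OF open_U] smooth_on_add[OF open_U] assms by auto
  show ?thesis
    unfolding covC_def emb_def o_def fst_conv snd_conv
      cov_scaleR[OF d(2) assms(3)] cov_scaleR[OF smooth_on_JC[OF open_U d(1)] assms(3)]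
      cov_JC[OF d(1) assms(3)] cov_add[OF assms] cov_diff[OF assms(2,1,3)] ..
qed

end

locale kaehler_curve = kaehler_map g Q \<kappa> F U
  for g :: "complex^'n \<Rightarrow> complex^'n \<Rightarrow> complex^'n \<Rightarrow> real" and Q \<kappa> and F :: "complex \<Rightarrow> complex^'n" and U
begin

text \<open>On T''N the imaginary unit of the complexification acts as - \<open>JC\<close>, so on
  the second component each operator appears as its conjugate.\<close>

lemma nabla_emb:
  assumes "smooth_on X U" "smooth_on Y U" "x \<in> U"
  shows "nabla_z g F (\<lambda>y. emb (X y) (Y y)) x = emb (wz g F 1 \<i> X x) (wz g F 1 (- \<i>) Y x)"
    "nabla_zbar g F (\<lambda>y. emb (X y) (Y y)) x = emb (wz g F 1 (- \<i>) X x) (wz g F 1 \<i> Y x)"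
  unfolding nabla_z_def nabla_zbar_def covC_emb[OF assms] wz_def
    cov_dir(3)[OF assms(1,3)] cov_dir(3)[OF assms(2,3)]
  by (simp_all add: emb_def csmul_def scaleR_eq_scalar vec_eq_iff field_simps)

lemma nabla_cong:
  assumes "x \<in> U" "\<And>y. y \<in> U \<Longrightarrow> Z y = W y"
  shows "nabla_z g F Z x = nabla_z g F W x" "nabla_zbar g F Z x = nabla_zbar g F W x"
proof -
  have "covC g F e Z x = covC g F e W x" for e
    unfolding covC_def using cov_cong[OF assms(1), of "fst \<circ> Z" "fst \<circ> W"] cov_cong[OF assms(1), of "snd \<circ> Z" "snd \<circ> W"]
      assms(2) by simp
  then show "nabla_z g F Z x = nabla_z g F W x" "nabla_zbar g F Z x = nabla_zbar g F W x"
    by (simp_all add: nabla_z_def nabla_zbar_def)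
qed

lemma smooth_wz_power: "smooth_on X U \<Longrightarrow> smooth_on ((wz g F e1 e2 ^^ k) X) U"
  by (induction k) (simp_all add: smooth_wz)

lemma nabla_power_emb:
  assumes "smooth_on X U" "smooth_on Y U" "\<And>y. y \<in> U \<Longrightarrow> Z y = emb (X y) (Y y)"
  shows "x \<in> U \<Longrightarrow> (nabla_z g F ^^ k) Z x = emb ((wz g F 1 \<i> ^^ k) X x) ((wz g F 1 (- \<i>) ^^ k) Y x)"
    "x \<in> U \<Longrightarrow> (nabla_zbar g F ^^ k) Z x = emb ((wz g F 1 (- \<i>) ^^ k) X x) ((wz g F 1 \<i> ^^ k) Y x)"
proof (induction k arbitrary: x)
  case 0
  case 1 then show ?case by (simp add: assms)
  case 2 then show ?case by (simp add: assms)
next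
  case (Suc k)
  case 1
  have "(nabla_z g F ^^ Suc k) Z x = nabla_z g F (\<lambda>y. emb ((wz g F 1 \<i> ^^ k) X y) ((wz g F 1 (- \<i>) ^^ k) Y y)) x"
    unfolding funpow.simps o_apply by (rule nabla_cong(1)[OF 1 Suc.IH(1)])
  then show ?case by (simp add: nabla_emb smooth_wz_power assms 1)
  case 2
  have "(nabla_zbar g F ^^ Suc k) Z x = nabla_zbar g F (\<lambda>y. emb ((wz g F 1 (- \<i>) ^^ k) X y) ((wz g F 1 \<i> ^^ k) Y y)) x"
    unfolding funpow.simps o_apply by (rule nabla_cong(2)[OF 2 Suc.IH(2)])
  then show ?case by (simp add: nabla_emb smooth_wz_power assms 2)
qed

text \<open>T'N and T''N are orthogonal for the Hermitian extension, so one component drops out; the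
  factor 1/2 is due to the projection onto T'N. Consequently \<open>etaC\<close> and
  \<open>jC\<close> are halves of \<open>eta\<close> and \<open>jac\<close>.\<close>

lemma herm_emb:
  assumes "q \<in> Q"
  shows "herm (g q) (emb X Y) (emb X' 0) = H q X X' / 2" "herm (g q) (emb X 0) (emb X' Y') = H q X X' / 2"
  using assms
  by (simp_all add: herm_def bilC_def cconj_def emb_def hform_def complex_eq_iff JC_simps g_simps g_J_left J_g field_simps)

lemma wz_power_zero: "x \<in> U \<Longrightarrow> (wz g F e1 e2 ^^ k) (\<lambda>_. 0) x = 0"
  using wa_zero[of x e1 e2 "k - 1"] by (cases k) (simp_all add: wa_def)

lemma nabla_d_z:
  assumes "x \<in> U"
  shows "(nabla_z g F ^^ k) (d_z F) x = emb (va g F 1 \<i> k x) 0"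
    "(nabla_zbar g F ^^ k) (d_zbar F) x = emb (va g F 1 (- \<i>) k x) 0"
  using nabla_power_emb(1)[OF smooth_vz smooth_on_const d_z_eq assms, where k = k]
    nabla_power_emb(2)[OF smooth_vz smooth_on_const d_zbar_eq[OF diff_F] assms, where k = k]
  by (simp_all add: va_def wz_power_zero assms)

lemma herm_eta:
  assumes "x \<in> U"
  shows "herm (g (F x)) ((nabla_z g F ^^ r) (d_z F) x) ((nabla_zbar g F ^^ s) (d_zbar F) x) = eta g F 1 \<i> r s x / 2"
  by (simp add: nabla_d_z assms herm_emb F_in eta_def)

lemma herm_jac:
  assumes V: "smooth_on V U" and x: "x \<in> U"
  shows "herm (g (F x)) ((nabla_z g F ^^ Suc r) (\<lambda>y. (V y, 0)) x) ((nabla_zbar g F ^^ s) (d_zbar F) x) +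
    herm (g (F x)) ((nabla_z g F ^^ r) (d_z F) x) ((nabla_zbar g F ^^ Suc s) (\<lambda>y. (V y, 0)) x) = jac g F 1 \<i> V r s x / 2"
  unfolding nabla_power_emb[OF V V emb_real x] nabla_d_z[OF x] herm_emb[OF F_in[OF x]] jac_def wa_def
  by (simp add: add_divide_distrib)

end

section \<open>Charts\<close>

abbreviation chart_inv :: "('m, 'a) chart \<Rightarrow> 'a \<Rightarrow> 'm" where
  "chart_inv c \<equiv> inv_into (fst c) (snd c)"

context
  fixes M :: "'m::t2_space set" and c :: "('m, 'a::euclidean_space) chart"
  assumes c: "chart_on M c"
begin

lemma chart_homeo: "homeomorphism (fst c) (snd c ` fst c) (snd c) (chart_inv c)"
  using c by (simp add: chart_on_def)

lemma chart_subset: "fst c \<subseteq> M"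
  using c by (auto simp: chart_on_def dest: openin_imp_subset)

lemma chart_inv_left: "x \<in> fst c \<Longrightarrow> chart_inv c (snd c x) = x"
  using chart_homeo by (simp add: homeomorphism_def)

lemma chart_inv_right: "\<zeta> \<in> snd c ` fst c \<Longrightarrow> snd c (chart_inv c \<zeta>) = \<zeta>"
  by (rule f_inv_into_f)

lemma chart_inv_in: "\<zeta> \<in> snd c ` fst c \<Longrightarrow> chart_inv c \<zeta> \<in> fst c"
  by (rule inv_into_into)

lemma chart_image_iff: "\<zeta> \<in> snd c ` (fst c \<inter> W) \<longleftrightarrow> \<zeta> \<in> snd c ` fst c \<and> chart_inv c \<zeta> \<in> W"
  using chart_inv_left chart_inv_right chart_inv_in by (auto intro!: image_eqI)

lemma chart_open_image:
  assumes "openin (top_of_set M) W"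
  shows "open (snd c ` (fst c \<inter> W))"
proof -
  have "openin (top_of_set (fst c)) (fst c \<inter> W)"
  proof -
    obtain S where S: "open S" "W = M \<inter> S" using assms by (auto simp: openin_open)
    have "fst c \<inter> W = fst c \<inter> S" using chart_subset S(2) by blast
    then show ?thesis using S(1) by (simp add: openin_open_Int)
  qed
  from homeomorphism_imp_open_map[OF chart_homeo this]
  show ?thesis using c by (auto simp: chart_on_def intro: openin_open_trans)
qed

lemma chart_open: "open (snd c ` fst c)"
  using c by (simp add: chart_on_def)

end

lemma loc_dom_iff:
  assumes "chart_on M c"
  shows "\<zeta> \<in> loc_dom c d \<phi> \<longleftrightarrow> \<zeta> \<in> snd c ` fst c \<and> \<phi> (chart_inv c \<zeta>) \<in> fst d"
  unfolding loc_dom_def by (simp only: chart_image_iff[OF assms] vimage_eq)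

lemma open_loc_dom:
  assumes c: "chart_on M c" and d: "openin (top_of_set N) (fst d)" and \<phi>: "continuous_on M \<phi>" "\<phi> ` M \<subseteq> N"
  shows "open (loc_dom c d \<phi>)"
proof -
  have "openin (top_of_set M) (M \<inter> \<phi> -` fst d)"
    using \<phi> d by (intro continuous_openin_preimage[of M \<phi> N]) auto
  from chart_open_image[OF c this]
  have "open (snd c ` (fst c \<inter> (M \<inter> \<phi> -` fst d)))" .
  moreover have "fst c \<inter> (M \<inter> \<phi> -` fst d) = fst c \<inter> \<phi> -` fst d" using chart_subset[OF c] by blast
  ultimately show ?thesis by (simp add: loc_dom_def)
qed

section \<open>Holomorphic differentials on the Riemann sphere\<close>

text \<open>One formula covers both charts, with s = 1 or -1. The factor s in the second coordinate
  is the conjugation that makes the transition holomorphic.\<close>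

definition stereo :: "real \<Rightarrow> (real^3, complex) chart" where
  "stereo s = (S2 - {x. x$3 = s}, \<lambda>x. Complex (x$1 / (1 - s * x$3)) (s * x$2 / (1 - s * x$3)))"

definition stereo_inv :: "real \<Rightarrow> complex \<Rightarrow> real^3" where
  "stereo_inv s z = (\<chi> i. (if i = 1 then 2 * Re z else if i = 2 then 2 * s * Im z else s * ((cmod z)\<^sup>2 - 1)) / ((cmod z)\<^sup>2 + 1))"

lemma stereographic_charts_eq: "stereographic_charts = {stereo 1, stereo (- 1)}"
  by (simp add: stereographic_charts_def stereo_def)

lemma S2_iff: "x \<in> S2 \<longleftrightarrow> x$1 * x$1 + x$2 * x$2 + x$3 * x$3 = 1" for x :: "real^3"
  by (simp add: S2_def norm_eq_1 inner_vec_def sum_3)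

lemma stereo_inv_nth:
  "stereo_inv s z $ 1 = 2 * Re z / ((cmod z)\<^sup>2 + 1)" "stereo_inv s z $ 2 = 2 * s * Im z / ((cmod z)\<^sup>2 + 1)"
  "stereo_inv s z $ 3 = s * ((cmod z)\<^sup>2 - 1) / ((cmod z)\<^sup>2 + 1)"
  by (simp_all add: stereo_inv_def)

context
  fixes s :: real
  assumes s: "s = 1 \<or> s = - 1"
begin

lemma s_square: "s * s = 1"
  using s by auto

lemma stereo_inv_in: "stereo_inv s z \<in> fst (stereo s)"
proof -
  define r where "r = (cmod z)\<^sup>2"
  have r: "r = Re z * Re z + Im z * Im z" "r \<ge> 0" unfolding r_def cmod_power2 by (simp_all add: power2_eq_square)
  have "(2 * Re z) * (2 * Re z) + (2 * s * Im z) * (2 * s * Im z) + (s * (r - 1)) * (s * (r - 1)) =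
      4 * (Re z * Re z) + 4 * (s * s) * (Im z * Im z) + (s * s) * ((r - 1) * (r - 1))"
    by (simp add: algebra_simps)
  also have "\<dots> = (r + 1) * (r + 1)" unfolding s_square r(1) by (simp add: algebra_simps)
  finally have "stereo_inv s z \<in> S2"
    using r(2) unfolding S2_iff stereo_inv_nth r_def[symmetric]
    by (simp add: times_divide_times_eq add_divide_distrib[symmetric])
  moreover have "stereo_inv s z $ 3 \<noteq> s"
    using r(2) s unfolding stereo_inv_nth r_def[symmetric] by (auto simp: field_simps)
  ultimately show ?thesis by (simp add: stereo_def)
qed

lemma stereo_stereo_inv: "snd (stereo s) (stereo_inv s z) = z"
proof -
  define r where "r = (cmod z)\<^sup>2"
  have r: "r \<ge> 0" by (simp add: r_def)
  have "1 - s * (s * (r - 1) / (r + 1)) = 1 - (s * s) * (r - 1) / (r + 1)" by simp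
  also have "\<dots> = 2 / (r + 1)" unfolding s_square using r by (simp add: field_simps)
  finally have *: "1 - s * (s * (r - 1) / (r + 1)) = 2 / (r + 1)" .
  have "s * (2 * s * Im z / (r + 1)) = 2 * Im z / (r + 1)"
    using s by auto
  then show ?thesis
    using r unfolding stereo_def snd_conv stereo_inv_nth r_def[symmetric] * by (simp add: complex_eq_iff)
qed

lemma stereo_inv_stereo:
  assumes "x \<in> fst (stereo s)"
  shows "stereo_inv s (snd (stereo s) x) = x"
proof -
  have x: "x$1 * x$1 + x$2 * x$2 + x$3 * x$3 = 1" "x$3 \<noteq> s"
    using assms by (auto simp: stereo_def S2_iff)
  \<comment> \<open>In terms of \<open>u\<close> the equation of the sphere gives (2 - u) / u for
    the squared modulus of the coordinate; \<open>u\<close> is nonzero away from the pole.\<close>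
  define u where "u = 1 - s * x$3"
  have u0: "u \<noteq> 0"
  proof
    assume "u = 0"
    then have "s * (s * x$3) = s" by (simp add: u_def)
    then have "x$3 = s" using s_square by (metis mult.assoc mult_1)
    then show False using x(2) by simp
  qed
  have x3: "x$3 = s * (1 - u)" using s_square by (simp add: u_def algebra_simps mult.assoc[symmetric])
  define r where "r = (cmod (snd (stereo s) x))\<^sup>2"
  have "r = (x$1 * x$1 + (s * s) * (x$2 * x$2)) / (u * u)"
    unfolding r_def stereo_def snd_conv cmod_power2 complex.sel u_def[symmetric]
    by (simp add: power2_eq_square add_divide_distrib mult_ac)
  also have "x$1 * x$1 + (s * s) * (x$2 * x$2) = 1 - x$3 * x$3" using x(1) s_square by simp
  also have "\<dots> = 1 - (s * s) * ((1 - u) * (1 - u))" by (simp add: x3 algebra_simps)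
  also have "\<dots> / (u * u) = (2 - u) / u" unfolding s_square using u0 by (simp add: field_simps)
  finally have r: "r = (2 - u) / u" .
  have r1: "r + 1 = 2 / u" "r - 1 = 2 * (1 - u) / u" using u0 by (simp_all add: r field_simps)
  have "stereo_inv s (snd (stereo s) x) $ i = x $ i" for i
  proof -
    consider "i = 1" | "i = 2" | "i = 3" using exhaust_3 by blast
    then show ?thesis
    proof cases
      case 1
      then show ?thesis using u0 unfolding 1 stereo_inv_nth r_def[symmetric] r1 by (simp add: stereo_def u_def)
    next
      case 2
      have "stereo_inv s (snd (stereo s) x) $ 2 = (s * s) * x$2"
        using u0 unfolding stereo_inv_nth r_def[symmetric] r1 by (simp add: stereo_def u_def)
      then show ?thesis unfolding 2 s_square by simp
    next
      case 3
      show ?thesis using u0 unfolding 3 stereo_inv_nth r_def[symmetric] r1 x3 by simp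
    qed
  qed
  then show ?thesis by (simp add: vec_eq_iff)
qed

lemma stereo_image: "snd (stereo s) ` fst (stereo s) = UNIV"
  using stereo_inv_in stereo_stereo_inv by (metis UNIV_eq_I imageI)

lemma stereo_chart_inv: "chart_inv (stereo s) = stereo_inv s"
proof
  fix z
  have "inj_on (snd (stereo s)) (fst (stereo s))" by (rule inj_on_inverseI[where g = "stereo_inv s"]) (rule stereo_inv_stereo)
  from inv_into_f_f[OF this stereo_inv_in] show "chart_inv (stereo s) z = stereo_inv s z"
    by (simp add: stereo_stereo_inv)
qed

lemma stereo_chart_on: "chart_on S2 (stereo s)"
  unfolding chart_on_def stereo_chart_inv stereo_image
proof (intro conjI homeomorphismI)
  have "closed {x::real^3. x$3 = s}" by (intro closed_Collect_eq continuous_intros)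
  then have "openin (top_of_set S2) (S2 \<inter> - {x. x$3 = s})" by (simp add: openin_open_Int open_Compl)
  then show "openin (top_of_set S2) (fst (stereo s))" by (simp add: stereo_def Diff_eq)
  have ne: "s * x$3 \<noteq> 1" if "x \<in> fst (stereo s)" for x :: "real^3"
    using that s by (auto simp: stereo_def)
  show "continuous_on (fst (stereo s)) (snd (stereo s))"
  proof -
    have "continuous_on (fst (stereo s)) (\<lambda>x::real^3. Complex (x$1 / (1 - s * x$3)) (s * x$2 / (1 - s * x$3)))"
      unfolding complex_eq by (intro continuous_intros) (auto simp: ne)
    then show ?thesis by (simp add: stereo_def)
  qed
  show "continuous_on UNIV (stereo_inv s)"
    unfolding stereo_inv_def
  proof (intro continuous_on_vec_lambda)
    fix i :: 3
    have "(cmod z)\<^sup>2 + 1 \<noteq> 0" for z by (smt (verit) zero_le_power2)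
    then show "continuous_on UNIV (\<lambda>z. (if i = 1 then 2 * Re z else if i = 2 then 2 * s * Im z else s * ((cmod z)\<^sup>2 - 1)) / ((cmod z)\<^sup>2 + 1))"
      by (cases "i = 1"; cases "i = 2") (auto intro!: continuous_intros)
  qed
qed (auto simp: stereo_inv_in stereo_stereo_inv stereo_inv_stereo)

lemma stereo_overlap: "snd (stereo s) ` (fst (stereo s) \<inter> fst (stereo (- s))) = - {0}"
proof -
  have "stereo_inv s z \<in> fst (stereo (- s)) \<longleftrightarrow> z \<noteq> 0" for z
  proof -
    define r where "r = (cmod z)\<^sup>2"
    have r: "r \<ge> 0" "r = 0 \<longleftrightarrow> z = 0" by (simp_all add: r_def)
    have "stereo_inv s z \<in> S2" using stereo_inv_in by (auto simp: stereo_def)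
    moreover have "stereo_inv s z $ 3 = - s \<longleftrightarrow> r = 0"
      using r(1) s unfolding stereo_inv_nth r_def[symmetric] by (auto simp: field_simps)
    ultimately show ?thesis using r(2) by (simp add: stereo_def)
  qed
  then show ?thesis
    unfolding set_eq_iff chart_image_iff[OF stereo_chart_on] stereo_image stereo_chart_inv by simp
qed

lemma stereo_transition:
  assumes "z \<noteq> 0"
  shows "transition (stereo s) (stereo (- s)) z = inverse z"
proof -
  define r where "r = (cmod z)\<^sup>2"
  have r: "r > 0" using assms by (simp add: r_def)
  have "1 + s * (s * (r - 1) / (r + 1)) = 1 + (s * s) * (r - 1) / (r + 1)" by simp
  also have "\<dots> = 2 * r / (r + 1)" unfolding s_square using r by (simp add: field_simps)
  finally have *: "1 - - s * (s * (r - 1) / (r + 1)) = 2 * r / (r + 1)" by simp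
  have **: "- s * (2 * s * Im z / (r + 1)) = - 2 * Im z / (r + 1)"
    using s by auto
  have "transition (stereo s) (stereo (- s)) z = Complex (Re z / r) (- Im z / r)"
    using r unfolding transition_def o_def stereo_chart_inv
    unfolding stereo_def snd_conv stereo_inv_nth r_def[symmetric] * ** by (simp add: complex_eq_iff)
  also have "\<dots> = inverse z"
    by (simp add: complex_eq_iff r_def cmod_power2)
  finally show ?thesis .
qed

lemma stereo_self_transition: "transition (stereo s) (stereo s) z = z"
  by (simp add: transition_def stereo_chart_inv stereo_stereo_inv)

lemma Dif_stereo_transition:
  assumes "z \<noteq> 0"
  shows "Dif (transition (stereo s) (stereo (- s))) z X = - (X / z\<^sup>2)"
proof -
  have "Dif (transition (stereo s) (stereo (- s))) z = Dif inverse z"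
    by (rule Dif_cong[of "- {0}"]) (auto simp: assms stereo_transition)
  also have "\<dots> = (\<lambda>X. - (inverse z * X * inverse z))"
    by (rule Dif_eqI[OF has_derivative_inverse'[OF assms]])
  finally show ?thesis by (simp add: field_simps power2_eq_square)
qed

lemma stereo_compatible: "holo_compatible ((*) \<i>) (stereo s) (stereo (- s))"
  unfolding holo_compatible_def stereo_overlap
proof (intro conjI ballI allI)
  have "smooth_on (inverse :: complex \<Rightarrow> complex) (- {0})"
    using smooth_on_inverse[of "- {0}", OF _ smooth_on_ident] by auto
  then show "smooth_on (transition (stereo s) (stereo (- s))) (- {0})"
    by (subst smooth_on_cong[of "- {0}"]) (auto simp: stereo_transition)
qed (simp add: Dif_stereo_transition)

lemma stereo_self_compatible: "holo_compatible ((*) \<i>) (stereo s) (stereo s)"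
proof -
  have "transition (stereo s) (stereo s) = (\<lambda>z. z)" by (simp add: fun_eq_iff stereo_self_transition)
  then show ?thesis by (simp add: holo_compatible_def stereo_image smooth_on_ident)
qed

end

lemma S2_coords_iff:
  "c \<in> S2_coords \<longleftrightarrow> chart_on S2 c \<and> (\<forall>d\<in>{stereo 1, stereo (- 1)}.
    holo_compatible ((*) \<i>) c d \<and> holo_compatible ((*) \<i>) d c)"
  by (simp only: S2_coords_def max_complex_atlas_def stereographic_charts_eq mem_Collect_eq)

lemma stereo_in_coords:
  assumes "s = 1 \<or> s = - 1"
  shows "stereo s \<in> S2_coords"
proof -
  have comp: "holo_compatible ((*) \<i>) (stereo a) (stereo b)" if "a = 1 \<or> a = - 1" "b = 1 \<or> b = - 1" for a b
  proof (cases "a = b")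
    case True
    then show ?thesis using stereo_self_compatible[OF that(1)] by simp
  next
    case False
    then have "b = - a" using that by auto
    then show ?thesis using stereo_compatible[OF that(1)] by simp
  qed
  show ?thesis
    unfolding S2_coords_iff
  proof (intro conjI ballI)
    show "chart_on S2 (stereo s)" by (rule stereo_chart_on[OF assms])
    fix d assume "d \<in> {stereo 1, stereo (- 1)}"
    then obtain b where "d = stereo b" "b = 1 \<or> b = - 1" by blast
    then show "holo_compatible ((*) \<i>) (stereo s) d" "holo_compatible ((*) \<i>) d (stereo s)"
      using comp assms by metis+
  qed
qed

lemma S2_coordsD:
  assumes "c \<in> S2_coords"
  shows "chart_on S2 c" "s = 1 \<or> s = - 1 \<Longrightarrow> holo_compatible ((*) \<i>) c (stereo s)"
  using assms unfolding S2_coords_iff by auto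

lemma stereo_cover:
  assumes "x \<in> S2"
  obtains s where "s = 1 \<or> s = - 1" "x \<in> fst (stereo s)"
proof (cases "x$3 = 1")
  case True
  then show ?thesis using assms by (intro that[of "- 1"]) (simp_all add: stereo_def)
next
  case False
  then show ?thesis using assms by (intro that[of 1]) (simp_all add: stereo_def)
qed

text \<open>Read in a stereographic chart, a differential of degree \<open>n\<close> decays like \<open>1/z^(2n)\<close> at infinity, so
  Liouville's theorem applies.\<close>

lemma sphere_differential_zero:
  fixes q :: "(real^3, complex) chart \<Rightarrow> complex \<Rightarrow> complex"
  assumes holo: "\<And>s. s = 1 \<or> s = - 1 \<Longrightarrow> q (stereo s) holomorphic_on UNIV"
    and trans: "\<And>c s \<zeta>. c \<in> S2_coords \<Longrightarrow> s = 1 \<or> s = - 1 \<Longrightarrow> \<zeta> \<in> snd c ` (fst c \<inter> fst (stereo s)) \<Longrightarrow>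
      q c \<zeta> = Dif (transition c (stereo s)) \<zeta> 1 ^ n * q (stereo s) (transition c (stereo s) \<zeta>)"
    and n: "n > 0" and c: "c \<in> S2_coords" and \<zeta>: "\<zeta> \<in> snd c ` fst c"
  shows "q c \<zeta> = 0"
proof -
  have zero: "q (stereo s) z = 0" if s: "s = 1 \<or> s = - 1" for s z
  proof (rule Liouville_weak_0[OF holo[OF s]])
    have s': "- s = 1 \<or> - s = - 1" using s by auto
    have eq: "q (stereo s) z = (- (1 / z\<^sup>2)) ^ n * q (stereo (- s)) (inverse z)" if "z \<noteq> 0" for z
      using trans[OF stereo_in_coords[OF s] s', of z] that
      unfolding stereo_overlap[OF s] stereo_transition[OF s that] Dif_stereo_transition[OF s that] by simp
    have "isCont (q (stereo (- s))) 0"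
      using holomorphic_on_imp_continuous_on[OF holo[OF s']] by (simp add: continuous_on_eq_continuous_at)
    then have 1: "((\<lambda>z. q (stereo (- s)) (inverse z)) \<longlongrightarrow> q (stereo (- s)) 0) at_infinity"
      by (rule isCont_tendsto_compose) (rule tendsto_inverse_0)
    have 2: "((\<lambda>z::complex. (- ((inverse z) ^ 2)) ^ n) \<longlongrightarrow> (- (0 ^ 2)) ^ n) at_infinity"
      by (intro tendsto_intros tendsto_inverse_0)
    \<comment> \<open>Positive degree enters here: this factor tends to 0 at infinity, while the
      other one tends to the value at the origin of the opposite chart.\<close>
    have "(- (0 ^ 2)) ^ n * q (stereo (- s)) 0 = 0" using n by simp
    with tendsto_mult[OF 2 1]
    have "((\<lambda>z. (- ((inverse z) ^ 2)) ^ n * q (stereo (- s)) (inverse z)) \<longlongrightarrow> 0) at_infinity"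
      by (simp only:)
    moreover have "\<forall>\<^sub>F z in at_infinity. (- ((inverse z) ^ 2)) ^ n * q (stereo (- s)) (inverse z) = q (stereo s) z"
      using eventually_not_equal_at_infinity[of 0]
    proof eventually_elim
      case (elim z)
      then show ?case by (simp add: eq field_simps)
    qed
    ultimately show "((q (stereo s)) \<longlongrightarrow> 0) at_infinity" by (rule Lim_transform_eventually)
  qed
  have "chart_inv c \<zeta> \<in> S2" using chart_subset[OF S2_coordsD(1)[OF c]] chart_inv_in[OF S2_coordsD(1)[OF c] \<zeta>] by blast
  then obtain s where s: "s = 1 \<or> s = - 1" "chart_inv c \<zeta> \<in> fst (stereo s)" by (rule stereo_cover)
  have "\<zeta> \<in> snd c ` (fst c \<inter> fst (stereo s))"
    using chart_image_iff[OF S2_coordsD(1)[OF c]] \<zeta> s(2) by blast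
  from trans[OF c s(1) this] show ?thesis by (simp add: zero[OF s(1)])
qed

section \<open>Conformal metrics on the domain\<close>

lemma complex_split: "X = Re X *\<^sub>R 1 + Im X *\<^sub>R \<i>"
  by (simp add: complex_eq_iff)

locale conformal_chart = riemannian_chart h W
  for h :: "complex \<Rightarrow> complex \<Rightarrow> complex \<Rightarrow> real" and W +
  assumes J_h: "\<And>q X Y. q \<in> W \<Longrightarrow> h q (\<i> * X) (\<i> * Y) = h q X Y"
begin

lemma h_i:
  assumes "q \<in> W"
  shows "h q \<i> \<i> = h q 1 1" "h q 1 \<i> = 0" "h q \<i> 1 = 0"
proof -
  show "h q \<i> \<i> = h q 1 1" using J_h[OF assms, of 1 1] by simp
  show "h q 1 \<i> = 0" using J_h[OF assms, of 1 \<i>] sym_g[OF assms, of 1 \<i>] by (simp add: g_simps assms)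
  then show "h q \<i> 1 = 0" using sym_g[OF assms, of 1 \<i>] by simp
qed

lemma dh_i:
  assumes "q \<in> W"
  shows "dg q X \<i> \<i> = dg q X 1 1" "dg q X 1 \<i> = 0" "dg q X \<i> 1 = 0"
proof -
  have *: "dg q X (\<i> * Y) (\<i> * Z) = dg q X Y Z" for Y Z
    unfolding dg_def by (intro fun_cong[OF Dif_cong[OF open_Q assms]]) (rule J_h)
  show "dg q X \<i> \<i> = dg q X 1 1" using *[of 1 1] by simp
  show "dg q X 1 \<i> = 0" using *[of 1 \<i>] dg_sym[OF assms, of X 1 \<i>] by (simp add: dg_simps assms)
  then show "dg q X \<i> 1 = 0" using dg_sym[OF assms, of X 1 \<i>] by simp
qed

text \<open>In a conformal coordinate the metric is a function times the flat one, so its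
  derivatives cancel in this trace. Hence the domain connection disappears from the tension field
  and the Jacobi operator.\<close>

lemma christoffel_trace:
  assumes q: "q \<in> W"
  shows "christoffel h q 1 1 + christoffel h q \<i> \<i> = 0"
proof (rule g_eqI[OF q])
  fix Z
  have "dg q X Y (Re Z *\<^sub>R 1 + Im Z *\<^sub>R \<i>) = Re Z * dg q X Y 1 + Im Z * dg q X Y \<i>" for X Y
    by (simp only: dg_simps[OF q])
  note 1 = this[folded complex_split]
  have "dg q (Re Z *\<^sub>R 1 + Im Z *\<^sub>R \<i>) X Y = Re Z * dg q 1 X Y + Im Z * dg q \<i> X Y" for X Y
    by (simp only: dg_simps[OF q])
  note 2 = this[folded complex_split]
  show "h q (christoffel h q 1 1 + christoffel h q \<i> \<i>) Z = h q 0 Z"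
    by (simp add: g_simps q christoffel_koszul 1[of 1 1] 1[of \<i> \<i>] 2 dh_i add_divide_distrib diff_divide_distrib)
qed

lemma metric_trace_conformal:
  assumes q: "q \<in> W" and B: "\<And>X r Y. B X (r *\<^sub>R Y) = r *\<^sub>R B X Y"
  shows "metric_trace (h q) B = inverse (h q 1 1) *\<^sub>R (B 1 1 + B \<i> \<i>)"
proof -
  have l: "h q 1 1 > 0" by (rule pos_g[OF q]) simp
  have "sharp (h q) b = inverse (h q 1 1) *\<^sub>R b" if b: "b = 1 \<or> b = \<i>" for b
    unfolding sharp_def
  proof (rule the_equality)
    show *: "\<forall>Y. h q (inverse (h q 1 1) *\<^sub>R b) Y = b \<bullet> Y"
    proof
      fix Y
      have "h q b Y = h q 1 1 * (b \<bullet> Y)"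
        using b by (subst complex_split[of Y]) (auto simp: g_simps q h_i inner_complex_def simp del: scaleR_complex.code)
      then show "h q (inverse (h q 1 1) *\<^sub>R b) Y = b \<bullet> Y" using l by (simp add: g_simps q)
    qed
    fix W' assume "\<forall>Y. h q W' Y = b \<bullet> Y"
    then show "W' = inverse (h q 1 1) *\<^sub>R b" using * by (intro g_eqI[OF q]) simp
  qed
  then show ?thesis by (simp add: metric_trace_def Basis_complex_def B scaleR_add_right)
qed

end

section \<open>Local pictures of a Jacobi field\<close>

lemma kaehler_chart_subset:
  assumes "kaehler_chart g Q \<kappa>" "open Q'" "Q' \<subseteq> Q"
  shows "kaehler_chart g Q' \<kappa>"
proof -
  interpret kaehler_chart g Q \<kappa> by fact
  show ?thesis
    using assms(2,3)
    by unfold_locales (auto intro: bilinear_g sym_g pos_g smooth_on_subset[OF smooth_g] J_g closed_form sec_curv)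
qed

lemma kaehler_map_subset:
  assumes "kaehler_map g Q \<kappa> F U" "open Q'" "Q' \<subseteq> Q" "open U'" "U' \<subseteq> U" "F ` U' \<subseteq> Q'"
  shows "kaehler_map g Q' \<kappa> F U'"
proof -
  interpret kaehler_map g Q \<kappa> F U by fact
  interpret K: kaehler_chart g Q' \<kappa> by (rule kaehler_chart_subset) (use assms kaehler_chart_axioms in auto)
  show ?thesis using assms by unfold_locales (auto intro: smooth_on_subset[OF smooth_F])
qed

locale jacobi_setup =
  fixes N :: "'p::t2_space set"
    and A :: "('p, complex^'n) chart set"
    and g :: "('p, complex^'n) metric"
    and h :: "(real^3, complex) metric"
    and \<phi> :: "real^3 \<Rightarrow> 'p"
    and v :: "('p, complex^'n) chart \<Rightarrow> real^3 \<Rightarrow> complex^'n"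
    and \<kappa> :: real
  assumes kaehler: "kaehler_manifold N A g"
    and hol_sec: "\<And>d q X. d \<in> A \<Longrightarrow> q \<in> snd d ` fst d \<Longrightarrow> X \<noteq> 0 \<Longrightarrow> sec_curv (g d) q X (JC X) = \<kappa>"
    and h: "hermitian_metric ((*) \<i>) S2_coords h"
    and \<phi>: "harmonic_map S2 S2_coords h N A g \<phi>"
    and v: "jacobi_field S2 S2_coords h A g \<phi> v"
begin

lemma target_chart: "d \<in> A \<Longrightarrow> chart_on N d"
  using kaehler by (simp add: kaehler_manifold_def complex_atlas_def)

lemma openin_target: "d \<in> A \<Longrightarrow> openin (top_of_set N) (fst d)"
  using target_chart by (simp add: chart_on_def)

lemma kaehler_chart_target:
  assumes "d \<in> A"
  shows "kaehler_chart (g d) (snd d ` fst d) \<kappa>"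
proof
  show "open (snd d ` fst d)" by (rule chart_open[OF target_chart[OF assms]])
qed (use kaehler assms hol_sec in \<open>auto simp: kaehler_manifold_def hermitian_metric_def riemannian_metric_def\<close>)

lemma conformal_domain:
  assumes "c \<in> S2_coords"
  shows "conformal_chart (h c) (snd c ` fst c)"
proof
  show "open (snd c ` fst c)" by (rule chart_open[OF S2_coordsD(1)[OF assms]])
qed (use h assms in \<open>auto simp: hermitian_metric_def riemannian_metric_def\<close>)

lemma \<phi>_smooth: "smooth_map S2 S2_coords N A \<phi>"
  using \<phi> by (simp add: harmonic_map_def)

lemma \<phi>_continuous: "continuous_on S2 \<phi>" "\<phi> ` S2 \<subseteq> N"
  using \<phi>_smooth by (auto simp: smooth_map_def)

lemma open_dom: "c \<in> S2_coords \<Longrightarrow> d \<in> A \<Longrightarrow> open (loc_dom c d \<phi>)"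
  by (rule open_loc_dom[OF S2_coordsD(1) openin_target \<phi>_continuous])

lemma dom_iff: "c \<in> S2_coords \<Longrightarrow> \<zeta> \<in> loc_dom c d \<phi> \<longleftrightarrow> \<zeta> \<in> snd c ` fst c \<and> \<phi> (chart_inv c \<zeta>) \<in> fst d"
  by (rule loc_dom_iff[OF S2_coordsD(1)])

lemma dom_cover:
  assumes "c \<in> S2_coords" "\<zeta> \<in> snd c ` fst c"
  shows "\<exists>d\<in>A. \<zeta> \<in> loc_dom c d \<phi>"
proof -
  have "chart_inv c \<zeta> \<in> S2"
    using chart_subset[OF S2_coordsD(1)] chart_inv_in[OF S2_coordsD(1)] assms by blast
  then have "\<phi> (chart_inv c \<zeta>) \<in> N" using \<phi>_continuous(2) by blast
  then have "\<exists>d\<in>A. \<phi> (chart_inv c \<zeta>) \<in> fst d" using kaehler by (auto simp: kaehler_manifold_def complex_atlas_def)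
  then show ?thesis using assms dom_iff by blast
qed

abbreviation "FF c d \<equiv> loc c d \<phi>"
abbreviation "UU c d \<equiv> loc_dom c d \<phi>"
abbreviation "VV c d \<equiv> v d \<circ> chart_inv c"

lemma kaehler_map_local:
  assumes "c \<in> S2_coords" "d \<in> A"
  shows "kaehler_map (g d) (snd d ` fst d) \<kappa> (FF c d) (UU c d)"
proof -
  interpret K: kaehler_chart "g d" "snd d ` fst d" \<kappa> by (rule kaehler_chart_target[OF assms(2)])
  show ?thesis
  proof
    show "open (UU c d)" by (rule open_dom[OF assms])
    show "smooth_on (FF c d) (UU c d)" using \<phi>_smooth assms by (simp add: smooth_map_def)
    show "FF c d ` UU c d \<subseteq> snd d ` fst d"
    proof (rule image_subsetI)
      fix x assume "x \<in> UU c d"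
      then show "FF c d x \<in> snd d ` fst d" using dom_iff[OF assms(1), of x d] by (simp add: loc_def)
    qed
  qed
qed

lemma smooth_VV: "c \<in> S2_coords \<Longrightarrow> d \<in> A \<Longrightarrow> smooth_on (VV c d) (UU c d)"
  using v by (simp add: jacobi_field_def vector_field_along_def)

text \<open>The traces reduce to sums over 1 and \<open>\<i>\<close> times a nonzero conformal
  factor, and the Christoffel terms of the domain cancel by
  \<open>christoffel_trace\<close>.\<close>

lemma harmonic_jacobi_local:
  assumes c: "c \<in> S2_coords" and d: "d \<in> A"
  shows "harmonic_jacobi (g d) (snd d ` fst d) \<kappa> (FF c d) (UU c d) 1 \<i> (VV c d)"
proof -
  interpret K: kaehler_map "g d" "snd d ` fst d" \<kappa> "FF c d" "UU c d" by (rule kaehler_map_local[OF assms])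
  interpret C: conformal_chart "h c" "snd c ` fst c" by (rule conformal_domain[OF c])
  let ?F = "FF c d" and ?V = "VV c d"
  have V: "smooth_on ?V (UU c d)" by (rule smooth_VV[OF assms])
  show ?thesis
  proof
    show "smooth_on ?V (UU c d)" by (rule V)
    fix x assume x: "x \<in> UU c d"
    have xW: "x \<in> snd c ` fst c" using x dom_iff[OF c] by blast
    have lin: "linear (Dif ?F x)" by (rule Dif_linear[OF K.diff_F[OF x]])
    have pos: "inverse (h c x 1 1) \<noteq> 0" using C.pos_g[OF xW, of 1] by simp
    have tr: "christoffel (h c) x \<i> \<i> = - christoffel (h c) x 1 1"
      using C.christoffel_trace[OF xW] by (simp add: eq_neg_iff_add_eq_0 add.commute)
    have hom: "second_ff (h c) (g d) ?F x X (r *\<^sub>R Y) = r *\<^sub>R second_ff (h c) (g d) ?F x X Y" for X Y r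
    proof -
      have "cov (g d) ?F X (\<lambda>y. Dif ?F y (r *\<^sub>R Y)) x = cov (g d) ?F X (\<lambda>y. r *\<^sub>R Dif ?F y Y) x"
        by (rule K.cov_cong[OF x]) (rule linear_cmul[OF Dif_linear[OF K.diff_F]])
      then show ?thesis
        unfolding second_ff_def K.cov_scaleR[OF K.smooth_DF x] C.christoffel_simps(6)[OF xW]
        by (simp add: linear_cmul[OF lin] scaleR_diff_right)
    qed
    have "tension (h c) (g d) ?F x = 0" using \<phi> c d x by (simp add: harmonic_map_def)
    then have "second_ff (h c) (g d) ?F x 1 1 + second_ff (h c) (g d) ?F x \<i> \<i> = 0"
      unfolding tension_def C.metric_trace_conformal[OF xW hom] using pos by simp
    then show "cov (g d) ?F 1 (\<lambda>y. Dif ?F y 1) x + cov (g d) ?F \<i> (\<lambda>y. Dif ?F y \<i>) x = 0"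
      unfolding second_ff_def tr linear_neg[OF lin] by simp
    have hom2: "cov2 (h c) (g d) ?F ?V x X (r *\<^sub>R Y) = r *\<^sub>R cov2 (h c) (g d) ?F ?V x X Y" for X Y r
    proof -
      have "cov (g d) ?F X (cov (g d) ?F (r *\<^sub>R Y) ?V) x = cov (g d) ?F X (\<lambda>y. r *\<^sub>R cov (g d) ?F Y ?V y) x"
        by (rule K.cov_cong[OF x]) (rule K.cov_dir(2)[OF V])
      then show ?thesis
        unfolding cov2_def K.cov_scaleR[OF K.smooth_cov[OF V] x] C.christoffel_simps(6)[OF xW] K.cov_dir(2)[OF V x]
        by (simp add: scaleR_diff_right)
    qed
    let ?R = "\<lambda>X Y. curv (g d) (?F x) (Dif ?F x X) (?V x) (Dif ?F x Y)"
    have hom3: "?R X (r *\<^sub>R Y) = r *\<^sub>R ?R X Y" for X Y r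
      unfolding linear_cmul[OF lin] K.curv_formula[OF K.F_in[OF x]]
      by (simp add: K.H_simps K.F_in x scaleR_eq_scalar scalar_simps vec_eq_iff algebra_simps)
    have "jacobi_operator (h c) (g d) ?F ?V x = 0" using v c d x by (simp add: jacobi_field_def)
    moreover have "jacobi_operator (h c) (g d) ?F ?V x = - (inverse (h c x 1 1) *\<^sub>R
        ((cov2 (h c) (g d) ?F ?V x 1 1 + cov2 (h c) (g d) ?F ?V x \<i> \<i>) + (?R 1 1 + ?R \<i> \<i>)))"
      unfolding jacobi_operator_def C.metric_trace_conformal[OF xW hom2]
        C.metric_trace_conformal[where B = ?R, OF xW hom3] scaleR_add_right by simp
    ultimately have "(cov2 (h c) (g d) ?F ?V x 1 1 + cov2 (h c) (g d) ?F ?V x \<i> \<i>) + (?R 1 1 + ?R \<i> \<i>) = 0"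
      using pos by (metis neg_equal_0_iff_equal scaleR_eq_0_iff)
    then show "cov (g d) ?F 1 (cov (g d) ?F 1 ?V) x + cov (g d) ?F \<i> (cov (g d) ?F \<i> ?V) x +
      ?R 1 1 + ?R \<i> \<i> = 0"
      unfolding cov2_def tr K.cov_dir(3)[OF V x] by (simp add: add.assoc)
  qed
qed

section \<open>Independence of the charts\<close>

lemma target_change_local:
  assumes c: "c \<in> S2_coords" and d: "d \<in> A" and e: "e \<in> A"
  shows "target_change_map (g d) (snd d ` (fst d \<inter> fst e)) \<kappa> (g e) (snd e ` fst e) \<kappa> (transition d e)
    (FF c d) (FF c e) (UU c d \<inter> UU c e)"
proof -
  let ?Q = "snd d ` (fst d \<inter> fst e)" and ?U = "UU c d \<inter> UU c e"
  have Q: "open ?Q" by (rule chart_open_image[OF target_chart[OF d] openin_target[OF e]])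
  have U: "open ?U" by (intro open_Int open_dom c d e)
  have F: "FF c d ` ?U \<subseteq> ?Q"
  proof (rule image_subsetI)
    fix x assume "x \<in> ?U"
    then have "\<phi> (chart_inv c x) \<in> fst d \<inter> fst e" using dom_iff[OF c] by blast
    then show "FF c d x \<in> ?Q" unfolding loc_def o_def by (rule imageI)
  qed
  interpret M: kaehler_map "g d" ?Q \<kappa> "FF c d" ?U
    by (rule kaehler_map_subset[OF kaehler_map_local[OF c d] Q _ U _ F]) auto
  interpret K: kaehler_map "g e" "snd e ` fst e" \<kappa> "FF c e" "UU c e" by (rule kaehler_map_local[OF c e])
  interpret N: kaehler_map "g e" "snd e ` fst e" \<kappa> "FF c e" ?U
    by (rule kaehler_map_subset[OF kaehler_map_local[OF c e] chart_open[OF target_chart[OF e]] _ U]) (use K.F_in in auto)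
  have T: "transition d e (snd d x) = snd e x" if "x \<in> fst d" for x
    by (simp add: transition_def chart_inv_left[OF target_chart[OF d] that])
  have comp: "holo_compatible JC d e" using kaehler d e by (simp add: kaehler_manifold_def complex_atlas_def)
  show ?thesis
  proof
    show "transition d e ` ?Q \<subseteq> snd e ` fst e" using T by auto
    show "smooth_on (transition d e) ?Q" using comp by (simp add: holo_compatible_def)
    show "Dif (transition d e) q (JC X) = JC (Dif (transition d e) q X)" if "q \<in> ?Q" for q X
      using comp that unfolding holo_compatible_def by blast
    show "g d q X Y = g e (transition d e q) (Dif (transition d e) q X) (Dif (transition d e) q Y)" if "q \<in> ?Q" for q X Y
    proof -
      have "\<forall>c\<in>A. \<forall>d\<in>A. \<forall>q \<in> snd c ` (fst c \<inter> fst d). \<forall>X Y. g c q X Y =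
          g d (transition c d q) (Dif (transition c d) q X) (Dif (transition c d) q Y)"
        using kaehler unfolding kaehler_manifold_def hermitian_metric_def riemannian_metric_def by (elim conjE)
      then show ?thesis using d e that by blast
    qed
    show "FF c e x = transition d e (FF c d x)" if "x \<in> ?U" for x
      using that dom_iff[OF c, of x d] T by (simp add: loc_def)
  qed
qed

lemma eta_chart_indep:
  assumes "c \<in> S2_coords" "d \<in> A" "e \<in> A" "\<zeta> \<in> UU c d" "\<zeta> \<in> UU c e"
  shows "eta (g e) (FF c e) 1 \<i> r s \<zeta> = eta (g d) (FF c d) 1 \<i> r s \<zeta>"
  using target_change_map.eta_push[OF target_change_local[OF assms(1-3)]] assms(4,5) by blast

lemma jac_chart_indep:
  assumes "c \<in> S2_coords" "d \<in> A" "e \<in> A" "\<zeta> \<in> UU c d" "\<zeta> \<in> UU c e"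
  shows "jac (g e) (FF c e) 1 \<i> (VV c e) r s \<zeta> = jac (g d) (FF c d) 1 \<i> (VV c d) r s \<zeta>"
proof (rule target_change_map.jac_push[OF target_change_local[OF assms(1-3)]])
  show "smooth_on (VV c d) (UU c d \<inter> UU c e)"
    by (rule smooth_on_subset[OF smooth_VV[OF assms(1,2)]]) auto
  show "\<zeta> \<in> UU c d \<inter> UU c e" using assms by simp
  fix x assume x: "x \<in> UU c d \<inter> UU c e"
  have "chart_inv c x \<in> S2"
    using x dom_iff[OF assms(1)] chart_subset[OF S2_coordsD(1)[OF assms(1)]] chart_inv_in[OF S2_coordsD(1)[OF assms(1)]] by blast
  moreover have "\<phi> (chart_inv c x) \<in> fst d \<inter> fst e" using x dom_iff[OF assms(1)] by blast
  moreover have "\<forall>d\<in>A. \<forall>e\<in>A. \<forall>x\<in>S2. \<phi> x \<in> fst d \<inter> fst e \<longrightarrow>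
      v e x = Dif (transition d e) (snd d (\<phi> x)) (v d x)"
    using v unfolding jacobi_field_def vector_field_along_def by (elim conjE)
  ultimately show "VV c e x = Dif (transition d e) (FF c d x) (VV c d x)"
    using assms(2,3) unfolding loc_def o_def by blast
qed

lemma domain_change_local:
  assumes c: "c \<in> S2_coords" and s: "s = 1 \<or> s = - 1" and d: "d \<in> A"
  defines "U' \<equiv> UU c d \<inter> snd c ` (fst c \<inter> fst (stereo s))"
  defines "T \<equiv> transition c (stereo s)"
  shows "domain_change (g d) (snd d ` fst d) \<kappa> (FF (stereo s) d) (UU (stereo s) d) (FF c d) U' T 1 \<i> (\<lambda>\<zeta>. Dif T \<zeta> 1)"
proof -
  have c': "stereo s \<in> S2_coords" by (rule stereo_in_coords[OF s])
  let ?W = "snd c ` (fst c \<inter> fst (stereo s))"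
  interpret M: kaehler_map "g d" "snd d ` fst d" \<kappa> "FF (stereo s) d" "UU (stereo s) d"
    by (rule kaehler_map_local[OF c' d])
  interpret K: kaehler_map "g d" "snd d ` fst d" \<kappa> "FF c d" "UU c d" by (rule kaehler_map_local[OF c d])
  have W: "open ?W"
    by (rule chart_open_image[OF S2_coordsD(1)[OF c]]) (use S2_coordsD(1)[OF c'] in \<open>simp add: chart_on_def\<close>)
  have U': "open U'" unfolding U'_def using W open_dom[OF c d] by auto
  interpret P: kaehler_map "g d" "snd d ` fst d" \<kappa> "FF c d" U'
    by (rule kaehler_map_subset[OF kaehler_map_local[OF c d] chart_open[OF target_chart[OF d]] _ U']) (use K.F_in in \<open>auto simp: U'_def\<close>)
  have comp: "holo_compatible ((*) \<i>) c (stereo s)" by (rule S2_coordsD(2)[OF c s])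
  have T: "smooth_on T ?W" using comp by (simp add: holo_compatible_def T_def)
  have T_eq: "chart_inv (stereo s) (T \<zeta>) = chart_inv c \<zeta>" "\<zeta> \<in> ?W \<Longrightarrow> T \<zeta> \<in> snd (stereo s) ` fst (stereo s)" if "\<zeta> \<in> ?W" for \<zeta>
  proof -
    have "chart_inv c \<zeta> \<in> fst (stereo s)" using that chart_image_iff[OF S2_coordsD(1)[OF c]] by blast
    then show "chart_inv (stereo s) (T \<zeta>) = chart_inv c \<zeta>" "T \<zeta> \<in> snd (stereo s) ` fst (stereo s)"
      by (simp_all add: T_def transition_def chart_inv_left[OF S2_coordsD(1)[OF c']])
  qed
  show ?thesis
  proof
    show "T ` U' \<subseteq> UU (stereo s) d"
    proof (rule image_subsetI)
      fix x assume "x \<in> U'"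
      then have x: "x \<in> ?W" "x \<in> UU c d" unfolding U'_def by blast+
      then show "T x \<in> UU (stereo s) d"
        using dom_iff[OF c', of "T x" d] dom_iff[OF c, of x d] T_eq[OF x(1)] x by simp
    qed
    show "smooth_on T U'" by (rule smooth_on_subset[OF T]) (auto simp: U'_def)
    then show "smooth_on (\<lambda>\<zeta>. Dif T \<zeta> 1) U'" by (rule smooth_on_Dif[OF U'])
    fix x assume x: "x \<in> U'"
    show "FF c d x = FF (stereo s) d (T x)" using T_eq(1)[of x] x by (simp add: U'_def loc_def)
    show "Dif T x 1 = Re (Dif T x 1) *\<^sub>R 1 + Im (Dif T x 1) *\<^sub>R \<i>" by (simp add: complex_eq_iff)
    have "Dif T x \<i> = \<i> * Dif T x 1"
      using comp x unfolding holo_compatible_def U'_def T_def by (metis IntD2 mult.right_neutral)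
    then show "Dif T x \<i> = - (Im (Dif T x 1) *\<^sub>R 1) + Re (Dif T x 1) *\<^sub>R \<i>" by (simp add: complex_eq_iff)
  qed
qed

section \<open>Vanishing of the isotropy differentials\<close>

text \<open>The image of \<phi> need not fit into one chart, while Liouville's theorem wants a
  single function of the coordinate. A target chart is therefore chosen pointwise, and independence
  of the chart makes the choice immaterial.\<close>

definition target_at :: "(real^3, complex) chart \<Rightarrow> complex \<Rightarrow> ('p, complex^'n) chart" where
  "target_at c \<zeta> = (SOME d. d \<in> A \<and> \<zeta> \<in> UU c d)"

lemma target_at:
  assumes "c \<in> S2_coords" "\<zeta> \<in> snd c ` fst c"
  shows "target_at c \<zeta> \<in> A" "\<zeta> \<in> UU c (target_at c \<zeta>)"
proof -
  have "\<exists>d. d \<in> A \<and> \<zeta> \<in> UU c d" using dom_cover[OF assms] by blast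
  from someI_ex[OF this] show "target_at c \<zeta> \<in> A" "\<zeta> \<in> UU c (target_at c \<zeta>)"
    by (auto simp: target_at_def)
qed

lemma dom_image: "c \<in> S2_coords \<Longrightarrow> \<zeta> \<in> UU c d \<Longrightarrow> \<zeta> \<in> snd c ` fst c"
  using dom_iff by blast

lemma holomorphic_from_local:
  assumes c: "c \<in> S2_coords"
    and f: "\<And>d \<zeta>. d \<in> A \<Longrightarrow> \<zeta> \<in> UU c d \<Longrightarrow> q \<zeta> = f d \<zeta>"
    and smooth: "\<And>d. d \<in> A \<Longrightarrow> smooth_on (f d) (UU c d)"
    and dzbar: "\<And>d \<zeta>. d \<in> A \<Longrightarrow> \<zeta> \<in> UU c d \<Longrightarrow> dz 1 (- \<i>) (f d) \<zeta> = 0"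
  shows "q holomorphic_on snd c ` fst c"
  unfolding holomorphic_on_def
proof
  fix \<zeta> assume \<zeta>: "\<zeta> \<in> snd c ` fst c"
  obtain d where d: "d \<in> A" "\<zeta> \<in> UU c d" using dom_cover[OF c \<zeta>] by blast
  have U: "open (UU c d)" by (rule open_dom[OF c d(1)])
  have D: "(f d has_derivative Dif (f d) \<zeta>) (at \<zeta>)"
    by (rule smooth_on_Dif_works[OF smooth[OF d(1)] U d(2)])
  have lin: "linear (Dif (f d) \<zeta>)" by (rule has_derivative_linear[OF D])
  \<comment> \<open>The hypothesis on \<open>dz 1 (- \<i>)\<close> is the Cauchy-Riemann equation,
    which makes the real derivative complex linear.\<close>
  have i: "Dif (f d) \<zeta> \<i> = \<i> * Dif (f d) \<zeta> 1"
  proof -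
    have "Dif (f d) \<zeta> 1 + \<i> * Dif (f d) \<zeta> \<i> = 0"
      using dzbar[OF d] linear_neg[OF lin, of \<i>] by (simp add: dz_def)
    then have "\<i> * (Dif (f d) \<zeta> 1 + \<i> * Dif (f d) \<zeta> \<i>) = 0" by (simp only: mult_zero_right)
    then show ?thesis by (simp add: distrib_left mult.assoc[symmetric])
  qed
  have "Dif (f d) \<zeta> X = Dif (f d) \<zeta> 1 * X" for X
  proof -
    have "Dif (f d) \<zeta> X = Dif (f d) \<zeta> (Re X *\<^sub>R 1 + Im X *\<^sub>R \<i>)"
      by (simp only: complex_split[symmetric])
    also have "\<dots> = Re X *\<^sub>R Dif (f d) \<zeta> 1 + Im X *\<^sub>R (\<i> * Dif (f d) \<zeta> 1)"
      by (simp only: linear_add[OF lin] linear_cmul[OF lin] i)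
    also have "\<dots> = Dif (f d) \<zeta> 1 * X" by (simp add: complex_eq_iff)
    finally show ?thesis .
  qed
  then have "Dif (f d) \<zeta> = (*) (Dif (f d) \<zeta> 1)" by (rule ext)
  with D have "(f d has_field_derivative Dif (f d) \<zeta> 1) (at \<zeta>)" by (simp add: has_field_derivative_def)
  then have "(q has_field_derivative Dif (f d) \<zeta> 1) (at \<zeta>)"
    by (rule has_field_derivative_transform_within_open[OF _ U d(2)]) (rule f[OF d(1), symmetric])
  then have "q field_differentiable at \<zeta>" unfolding field_differentiable_def by (rule exI)
  then show "q field_differentiable at \<zeta> within snd c ` fst c" by (rule field_differentiable_at_within)
qed

text \<open>The passage from charts to the sphere, common to \<open>eta\<close> and
  \<open>jac\<close>: the local expressions glue to one function per coordinate, to which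
  \<open>sphere_differential_zero\<close> applies.\<close>

lemma local_differential_zero:
  assumes indep: "\<And>c d e \<zeta>. c \<in> S2_coords \<Longrightarrow> d \<in> A \<Longrightarrow> e \<in> A \<Longrightarrow> \<zeta> \<in> UU c d \<Longrightarrow> \<zeta> \<in> UU c e \<Longrightarrow> f c e \<zeta> = f c d \<zeta>"
    and smooth: "\<And>c d. c \<in> S2_coords \<Longrightarrow> d \<in> A \<Longrightarrow> smooth_on (f c d) (UU c d)"
    and dzbar: "\<And>c d \<zeta>. c \<in> S2_coords \<Longrightarrow> d \<in> A \<Longrightarrow> \<zeta> \<in> UU c d \<Longrightarrow> dz 1 (- \<i>) (f c d) \<zeta> = 0"
    and pull: "\<And>c s d \<zeta>. c \<in> S2_coords \<Longrightarrow> s = 1 \<or> s = - 1 \<Longrightarrow> d \<in> A \<Longrightarrow>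
      \<zeta> \<in> UU c d \<inter> snd c ` (fst c \<inter> fst (stereo s)) \<Longrightarrow> transition c (stereo s) \<zeta> \<in> UU (stereo s) d \<Longrightarrow>
      f c d \<zeta> = Dif (transition c (stereo s)) \<zeta> 1 ^ n * f (stereo s) d (transition c (stereo s) \<zeta>)"
    and n: "n > 0" and c: "c \<in> S2_coords" and d: "d \<in> A" and \<zeta>: "\<zeta> \<in> UU c d"
  shows "f c d \<zeta> = 0"
proof -
  define q where "q c \<zeta> = f c (target_at c \<zeta>) \<zeta>" for c \<zeta>
  have q: "q c \<zeta> = f c d \<zeta>" if "c \<in> S2_coords" "d \<in> A" "\<zeta> \<in> UU c d" for c d \<zeta>
    unfolding q_def using dom_image[OF that(1,3)]
    by (intro indep[OF that(1,2) _ that(3)] target_at[OF that(1)])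
  have "q c \<zeta> = 0"
  proof (rule sphere_differential_zero[OF _ _ n c dom_image[OF c \<zeta>]])
    fix s :: real assume s: "s = 1 \<or> s = - 1"
    have c': "stereo s \<in> S2_coords" by (rule stereo_in_coords[OF s])
    show "q (stereo s) holomorphic_on UNIV"
      using holomorphic_from_local[OF c' q[OF c'] smooth[OF c'] dzbar[OF c']] by (simp add: stereo_image[OF s])
    fix c \<zeta> assume c: "c \<in> S2_coords" and \<zeta>: "\<zeta> \<in> snd c ` (fst c \<inter> fst (stereo s))"
    obtain d where d: "d \<in> A" "\<zeta> \<in> UU c d" using dom_cover[OF c] \<zeta> by blast
    have x: "\<zeta> \<in> UU c d \<inter> snd c ` (fst c \<inter> fst (stereo s))" using d \<zeta> by blast
    have T: "transition c (stereo s) \<zeta> \<in> UU (stereo s) d"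
      using domain_change.T_U[OF domain_change_local[OF c s d(1)]] x by blast
    show "q c \<zeta> = Dif (transition c (stereo s)) \<zeta> 1 ^ n * q (stereo s) (transition c (stereo s) \<zeta>)"
      unfolding q[OF c d] q[OF c' d(1) T] by (rule pull[OF c s d(1) x T])
  qed
  then show ?thesis by (simp add: q[OF c d \<zeta>])
qed

text \<open>The induction hypothesis is needed in all charts at once: it feeds
  \<open>eta_holomorphic\<close> in the given chart and \<open>eta_pull\<close> in a stereographic
  one. The degree is r + s + 2 because indices start at 0.\<close>

theorem harmonic_isotropic:
  "c \<in> S2_coords \<Longrightarrow> d \<in> A \<Longrightarrow> \<zeta> \<in> UU c d \<Longrightarrow> eta (g d) (FF c d) 1 \<i> r s \<zeta> = 0"
proof (induction "r + s" arbitrary: r s c d \<zeta> rule: less_induct)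
  case less
  show ?case
  proof (rule local_differential_zero[where n = "r + s + 2", OF _ _ _ _ _ less.prems])
    fix c d assume c: "c \<in> S2_coords" and d: "d \<in> A"
    interpret harmonic_jacobi "g d" "snd d ` fst d" \<kappa> "FF c d" "UU c d" 1 \<i> "VV c d"
      by (rule harmonic_jacobi_local[OF c d])
    show "smooth_on (eta (g d) (FF c d) 1 \<i> r s) (UU c d)" by (rule smooth_eta)
    show "dz 1 (- \<i>) (eta (g d) (FF c d) 1 \<i> r s) \<zeta> = 0" if "\<zeta> \<in> UU c d" for \<zeta>
      by (rule eta_holomorphic[OF less.hyps[OF _ c d] that])
  next
    fix c a d \<zeta> assume c: "c \<in> S2_coords" and a: "a = 1 \<or> a = - 1" and d: "d \<in> A"
      and x: "\<zeta> \<in> UU c d \<inter> snd c ` (fst c \<inter> fst (stereo a))" "transition c (stereo a) \<zeta> \<in> UU (stereo a) d"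
    show "eta (g d) (FF c d) 1 \<i> r s \<zeta> = Dif (transition c (stereo a)) \<zeta> 1 ^ (r + s + 2) *
        eta (g d) (FF (stereo a) d) 1 \<i> r s (transition c (stereo a) \<zeta>)"
      by (rule domain_change.eta_pull[OF domain_change_local[OF c a d] x(1) less.hyps[OF _ stereo_in_coords[OF a] d x(2)]])
  qed (rule eta_chart_indep, assumption+, simp)
qed

text \<open>The same induction one order higher in eps; \<open>harmonic_isotropic\<close> supplies
  the vanishing of all zeroth-order pairings.\<close>

theorem jacobi_isotropic:
  "c \<in> S2_coords \<Longrightarrow> d \<in> A \<Longrightarrow> \<zeta> \<in> UU c d \<Longrightarrow> jac (g d) (FF c d) 1 \<i> (VV c d) r s \<zeta> = 0"
proof (induction "r + s" arbitrary: r s c d \<zeta> rule: less_induct)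
  case less
  show ?case
  proof (rule local_differential_zero[where n = "r + s + 2", OF _ _ _ _ _ less.prems])
    fix c d assume c: "c \<in> S2_coords" and d: "d \<in> A"
    interpret harmonic_jacobi "g d" "snd d ` fst d" \<kappa> "FF c d" "UU c d" 1 \<i> "VV c d"
      by (rule harmonic_jacobi_local[OF c d])
    show "smooth_on (jac (g d) (FF c d) 1 \<i> (VV c d) r s) (UU c d)" by (rule smooth_jac[OF smooth_V])
    show "dz 1 (- \<i>) (jac (g d) (FF c d) 1 \<i> (VV c d) r s) \<zeta> = 0" if "\<zeta> \<in> UU c d" for \<zeta>
      by (rule jac_holomorphic[OF harmonic_isotropic[OF c d] less.hyps[OF _ c d] that])
  next
    fix c a d \<zeta> assume c: "c \<in> S2_coords" and a: "a = 1 \<or> a = - 1" and d: "d \<in> A"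
      and x: "\<zeta> \<in> UU c d \<inter> snd c ` (fst c \<inter> fst (stereo a))" "transition c (stereo a) \<zeta> \<in> UU (stereo a) d"
    have c': "stereo a \<in> S2_coords" by (rule stereo_in_coords[OF a])
    have V: "VV c d \<xi> = VV (stereo a) d (transition c (stereo a) \<xi>)"
      if "\<xi> \<in> UU c d \<inter> snd c ` (fst c \<inter> fst (stereo a))" for \<xi>
      using that chart_image_iff[OF S2_coordsD(1)[OF c]] chart_inv_left[OF S2_coordsD(1)[OF c']]
      by (auto simp: transition_def)
    show "jac (g d) (FF c d) 1 \<i> (VV c d) r s \<zeta> = Dif (transition c (stereo a)) \<zeta> 1 ^ (r + s + 2) *
        jac (g d) (FF (stereo a) d) 1 \<i> (VV (stereo a) d) r s (transition c (stereo a) \<zeta>)"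
      by (rule domain_change.jac_pull[OF domain_change_local[OF c a d] x(1) harmonic_isotropic[OF c' d x(2)]
            smooth_VV[OF c' d] V less.hyps[OF _ c' d x(2)]])
  qed (rule jac_chart_indep, assumption+, simp)
qed

end

section \<open>Variations\<close>

lemma has_derivative_slice: "((\<lambda>\<zeta>. (t::real, \<zeta>::complex)) has_derivative (\<lambda>X. (0, X))) (at \<zeta>)"
  by (auto intro!: derivative_eq_intros)

text \<open>A variation is treated as one map of (t, \<zeta>), so that time and coordinate
  derivatives belong to the same pulled-back connection and commute up to its curvature.\<close>

locale map_family = kaehler_map g Q \<kappa> G \<Omega>
  for g :: "complex^'n \<Rightarrow> complex^'n \<Rightarrow> complex^'n \<Rightarrow> real" and Q \<kappa>
    and G :: "real \<times> complex \<Rightarrow> complex^'n" and \<Omega>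
begin

definition slice :: "real \<Rightarrow> complex set" where
  "slice t = {\<zeta>. (t, \<zeta>) \<in> \<Omega>}"

lemma open_slice: "open (slice t)"
proof -
  have "open ((\<lambda>\<zeta>. (t, \<zeta>)) -` \<Omega>)" by (intro open_vimage open_U continuous_intros)
  then show ?thesis by (simp add: slice_def vimage_def)
qed

lemma smooth_slice:
  assumes "smooth_on Z \<Omega>"
  shows "smooth_on (\<lambda>\<zeta>. Z (t, \<zeta>)) (slice t)"
proof -
  have "bounded_linear (\<lambda>\<zeta>::complex. (0::real, \<zeta>))"
    by (intro bounded_linear_Pair bounded_linear_zero bounded_linear_ident)
  from smooth_on_linear[OF this open_slice smooth_on_ident[OF open_slice]]
  have "smooth_on (\<lambda>\<zeta>. (t, 0) + (0, \<zeta>)) (slice t)"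
    by (rule smooth_on_add[OF open_slice smooth_on_const])
  then have T: "smooth_on (\<lambda>\<zeta>::complex. (t, \<zeta>)) (slice t)" by simp
  show ?thesis
    by (rule smooth_on_compose[OF open_U open_slice _ assms T]) (auto simp: slice_def)
qed

lemma Dif_slice:
  assumes "smooth_on Z \<Omega>" "(t, \<zeta>) \<in> \<Omega>"
  shows "Dif (\<lambda>\<zeta>. Z (t, \<zeta>)) \<zeta> X = Dif Z (t, \<zeta>) (0, X)"
  using Dif_eqI[OF has_derivative_compose[OF has_derivative_slice smooth_on_Dif_works[OF assms(1) open_U assms(2)]]]
  by simp

lemma kaehler_curve_slice: "kaehler_curve g Q \<kappa> (\<lambda>\<zeta>. G (t, \<zeta>)) (slice t)"
proof -
  have "kaehler_map g Q \<kappa> (\<lambda>\<zeta>. G (t, \<zeta>)) (slice t)"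
    by unfold_locales (use open_slice smooth_slice[OF smooth_F] F_Q in \<open>auto simp: slice_def\<close>)
  then show ?thesis by (simp add: kaehler_curve_def)
qed

lemma cov_slice:
  assumes "smooth_on Z \<Omega>" "(t, \<zeta>) \<in> \<Omega>"
  shows "cov g (\<lambda>\<zeta>. G (t, \<zeta>)) X (\<lambda>\<zeta>. Z (t, \<zeta>)) \<zeta> = cov g G (0, X) Z (t, \<zeta>)"
  unfolding cov_def Dif_slice[OF assms] Dif_slice[OF smooth_F assms(2)] ..

lemma wz_slice:
  assumes "smooth_on Z \<Omega>" "(t, \<zeta>) \<in> \<Omega>"
  shows "wz g (\<lambda>\<zeta>. G (t, \<zeta>)) e1 e2 (\<lambda>\<zeta>. Z (t, \<zeta>)) \<zeta> = wz g G (0, e1) (0, e2) Z (t, \<zeta>)"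
  unfolding wz_def cov_slice[OF assms] ..

lemma va_slice: "(t, \<zeta>) \<in> \<Omega> \<Longrightarrow> va g (\<lambda>\<zeta>. G (t, \<zeta>)) e1 e2 r \<zeta> = va g G (0, e1) (0, e2) r (t, \<zeta>)"
proof (induction r arbitrary: \<zeta>)
  case 0
  then show ?case by (simp add: va_simps vz_def Dif_slice[OF smooth_F])
next
  case (Suc r)
  interpret S: kaehler_curve g Q \<kappa> "\<lambda>\<zeta>. G (t, \<zeta>)" "slice t" by (rule kaehler_curve_slice)
  have "va g (\<lambda>\<zeta>. G (t, \<zeta>)) e1 e2 (Suc r) \<zeta> =
      wz g (\<lambda>\<zeta>. G (t, \<zeta>)) e1 e2 (\<lambda>\<zeta>. va g G (0, e1) (0, e2) r (t, \<zeta>)) \<zeta>"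
    unfolding va_simps by (rule S.wz_cong) (use Suc in \<open>auto simp: slice_def\<close>)
  then show ?case by (simp add: wz_slice[OF smooth_va Suc.prems] va_simps)
qed

lemma eta_slice:
  assumes "(t, \<zeta>) \<in> \<Omega>"
  shows "eta g (\<lambda>\<zeta>. G (t, \<zeta>)) e1 e2 r s \<zeta> = eta g G (0, e1) (0, e2) r s (t, \<zeta>)"
  using va_slice[OF assms, of e1 "- e2" s] by (simp add: eta_def va_slice assms)

abbreviation "V0 \<equiv> \<lambda>\<zeta>. Dif G (0, \<zeta>) (1, 0)"
abbreviation "F0 \<equiv> \<lambda>\<zeta>. G (0, \<zeta>)"

text \<open>Commuting \<open>\<nabla>/\<partial>t\<close> past \<open>\<nabla>/\<partial>z\<close> produces curvature terms, which isotropy confines to the span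
  of the derivatives of \<open>\<partial>\<phi>/\<partial>z\<close>.\<close>

lemma cov_t_va:
  assumes iso: "\<And>i \<zeta>. \<zeta> \<in> slice 0 \<Longrightarrow> eta g F0 e1 e2 i 0 \<zeta> = 0"
  shows "span_pair (slice 0) (va g F0 e1 e2) (\<lambda>_ _. 0) {} {..r} (\<lambda>_. 0)
    (\<lambda>\<zeta>. cov g G (1, 0) (va g G (0, e1) (0, e2) r) (0, \<zeta>) - wa g F0 e1 e2 V0 r \<zeta>)"
proof (induction r)
  interpret S: kaehler_curve g Q \<kappa> F0 "slice 0" by (rule kaehler_curve_slice)
  have smooth_V0: "smooth_on V0 (slice 0)" by (rule smooth_slice[OF smooth_DF])
  {
    case 0
    \<comment> \<open>Torsion-freeness exchanges the time and coordinate derivatives of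
      \<open>G\<close>, so in order 0 the two sides agree exactly.\<close>
    have "cov g G (1, 0) (va g G (0, e1) (0, e2) 0) (0, \<zeta>) = wa g F0 e1 e2 V0 0 \<zeta>" if "\<zeta> \<in> slice 0" for \<zeta>
    proof -
      have x: "(0, \<zeta>) \<in> \<Omega>" using that by (simp add: slice_def)
      have s: "smooth_on (\<lambda>y. JC (Dif G y e)) \<Omega>" for e by (rule smooth_on_JC[OF open_U smooth_DF])
      have "cov g G (1, 0) (va g G (0, e1) (0, e2) 0) (0, \<zeta>) =
        (1/2::complex) *s (cov g G (1, 0) (\<lambda>y. Dif G y (0, e1)) (0, \<zeta>) - JC (cov g G (1, 0) (\<lambda>y. Dif G y (0, e2)) (0, \<zeta>)))"
        unfolding va_simps vz_def[abs_def] cov_scalar[OF smooth_on_const smooth_on_diff[OF open_U smooth_DF s] x]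
          cov_diff[OF smooth_DF s x] cov_JC[OF smooth_DF x] by (simp add: scalar_simps)
      also have "\<dots> = wz g G (0, e1) (0, e2) (\<lambda>y. Dif G y (1, 0)) (0, \<zeta>)"
        unfolding wz_def cov_torsion_free[OF x, of "(1, 0)"] ..
      also have "\<dots> = wz g F0 e1 e2 V0 \<zeta>" by (rule wz_slice[OF smooth_DF x, symmetric])
      finally show ?thesis by (simp add: wa_simps)
    qed
    then show ?case by (intro span_pair.cong[OF span_pair.zero]) auto
  next
    case (Suc r)
    let ?a = "va g F0 e1 e2" and ?c = "complex_of_real (\<kappa> / 4)"
    let ?X = "cov g G (1, 0) (va g G (0, e1) (0, e2) r)"
    define f where "f = (\<lambda>\<zeta>. ?c * (H (F0 \<zeta>) (V0 \<zeta>) (vz e1 (- e2) F0 \<zeta>) - H (F0 \<zeta>) (vz e1 e2 F0 \<zeta>) (V0 \<zeta>)))"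
    define m where "m = (\<lambda>\<zeta>. - ?c * H (F0 \<zeta>) (?a r \<zeta>) (V0 \<zeta>))"
    have f: "smooth_on f (slice 0)" "smooth_on m (slice 0)" unfolding f_def m_def
      by (intro smooth_on_mult smooth_on_diff smooth_on_const S.smooth_H S.smooth_vz S.smooth_va smooth_V0 open_slice)+
    have X: "smooth_on ?X \<Omega>" by (rule smooth_cov[OF smooth_va])
    have S1: "span_pair (slice 0) ?a (\<lambda>_ _. 0) {} {..Suc r} (wz g F0 e1 e2 (\<lambda>_. 0))
        (wz g F0 e1 e2 (\<lambda>\<zeta>. ?X (0, \<zeta>) - wa g F0 e1 e2 V0 r \<zeta>))"
      by (rule S.span_pair_wz[where \<tau> = "\<lambda>_. 1", OF Suc.IH S.smooth_va smooth_on_const smooth_on_const])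
         (auto simp: va_simps S.wz_zero scalar_simps)
    have S2: "span_pair (slice 0) ?a (\<lambda>_ _. 0) {} {..Suc r} (\<lambda>_. 0) (?a r)"
      "span_pair (slice 0) ?a (\<lambda>_ _. 0) {} {..Suc r} (\<lambda>_. 0) (?a 0)"
      by (auto intro: span_pair.gen0)
    show ?case
    proof (rule span_pair.cong[OF span_pair.add[OF S1 span_pair.add[OF span_pair.scalar[OF f(1) S2(1)] span_pair.scalar[OF f(2) S2(2)]]]])
      fix \<zeta> assume z: "\<zeta> \<in> slice 0"
      have x: "(0, \<zeta>) \<in> \<Omega>" using z by (simp add: slice_def)
      show "0 = wz g F0 e1 e2 (\<lambda>_. 0) \<zeta> + (f \<zeta> *s 0 + m \<zeta> *s 0)" by (simp add: S.wz_zero[OF z])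
      have b: "vz (0, e1) (- (0, e2)) G (0, \<zeta>) = vz e1 (- e2) F0 \<zeta>"
        using va_slice[OF x, of e1 "- e2" 0] by (simp add: va_simps)
      have a: "vz (0, e1) (0, e2) G (0, \<zeta>) = ?a 0 \<zeta>" "va g G (0, e1) (0, e2) r (0, \<zeta>) = ?a r \<zeta>"
        using va_slice[OF x, of e1 e2 0] va_slice[OF x, of e1 e2 r] by (simp_all add: va_simps)
      \<comment> \<open>Isotropy removes the multiple of \<open>V0\<close> from the commutator, the
        only term outside the span of the \<open>?a i\<close>.\<close>
      have iso': "H (F0 \<zeta>) (?a r \<zeta>) (vz e1 (- e2) F0 \<zeta>) = 0" using iso[OF z, of r] by (simp add: eta_def va_simps)
      have "cov g G (1, 0) (va g G (0, e1) (0, e2) (Suc r)) (0, \<zeta>) = wz g G (0, e1) (0, e2) ?X (0, \<zeta>) +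
        ?c *s (H (F0 \<zeta>) (V0 \<zeta>) (vz e1 (- e2) F0 \<zeta>) *s ?a r \<zeta> + H (F0 \<zeta>) (?a r \<zeta>) (vz e1 (- e2) F0 \<zeta>) *s V0 \<zeta>
          - H (F0 \<zeta>) (?a 0 \<zeta>) (V0 \<zeta>) *s ?a r \<zeta> - H (F0 \<zeta>) (?a r \<zeta>) (V0 \<zeta>) *s ?a 0 \<zeta>)"
        using cov_wz_commutator[OF smooth_va x, of "(1, 0)" "(0, e1)" "(0, e2)" "(0, e1)" "(0, e2)" r]
        unfolding va_simps(2)[of g G] a b by (simp add: algebra_simps)
      also have "wz g G (0, e1) (0, e2) ?X (0, \<zeta>) = wz g F0 e1 e2 (\<lambda>\<zeta>. ?X (0, \<zeta>)) \<zeta>"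
        by (rule wz_slice[OF X x, symmetric])
      finally show "cov g G (1, 0) (va g G (0, e1) (0, e2) (Suc r)) (0, \<zeta>) - wa g F0 e1 e2 V0 (Suc r) \<zeta> =
        wz g F0 e1 e2 (\<lambda>\<zeta>. ?X (0, \<zeta>) - wa g F0 e1 e2 V0 r \<zeta>) \<zeta> + (f \<zeta> *s ?a r \<zeta> + m \<zeta> *s ?a 0 \<zeta>)"
        unfolding S.wz_diff[OF smooth_slice[OF X] S.smooth_wa[OF smooth_V0] z] wa_simps(2) iso' f_def m_def va_simps(1)
        by (simp add: vec_eq_iff algebra_simps)
    qed
  }
qed

lemma Dif_eta_t:
  assumes iso: "\<And>i k \<zeta>. \<zeta> \<in> slice 0 \<Longrightarrow> eta g F0 e1 e2 i k \<zeta> = 0" and z: "\<zeta> \<in> slice 0"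
  shows "Dif (eta g G (0, e1) (0, e2) r s) (0, \<zeta>) (1, 0) = jac g F0 e1 e2 V0 r s \<zeta>"
proof -
  interpret S: kaehler_curve g Q \<kappa> F0 "slice 0" by (rule kaehler_curve_slice)
  have x: "(0, \<zeta>) \<in> \<Omega>" using z by (simp add: slice_def)
  have q: "G (0, \<zeta>) \<in> Q" by (rule F_in[OF x])
  let ?a = "va g F0 e1 e2" and ?b = "va g F0 e1 (- e2)"
  let ?A = "cov g G (1, 0) (va g G (0, e1) (0, e2) r) (0, \<zeta>)" and ?B = "cov g G (1, 0) (va g G (0, e1) (0, - e2) s) (0, \<zeta>)"
  have ab: "H (F0 \<zeta>) (?a i \<zeta>) (?b k \<zeta>) = 0" for i k using iso[OF z, of i k] by (simp add: eta_def)
  have ba: "H (F0 \<zeta>) (?b k \<zeta>) (?a i \<zeta>) = 0" for i k using H_zero_sym[OF q ab] .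
  have iso': "eta g F0 e1 (- e2) i 0 \<xi> = 0" if "\<xi> \<in> slice 0" for i \<xi>
    using S.eta_conj[OF that] iso[OF that] by simp
  have "H (F0 \<zeta>) (?A - wa g F0 e1 e2 V0 r \<zeta>) (?b s \<zeta>) + H (F0 \<zeta>) 0 0 = 0"
    by (rule S.span_pair_H[OF cov_t_va[OF iso] z]) (auto simp: ab)
  then have 1: "H (F0 \<zeta>) ?A (?b s \<zeta>) = H (F0 \<zeta>) (wa g F0 e1 e2 V0 r \<zeta>) (?b s \<zeta>)"
    by (simp add: H_simps q)
  have "H (F0 \<zeta>) (?B - wa g F0 e1 (- e2) V0 s \<zeta>) (?a r \<zeta>) + H (F0 \<zeta>) 0 0 = 0"
    by (rule S.span_pair_H[OF cov_t_va[OF iso'] z]) (auto simp: ba)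
  then have "H (F0 \<zeta>) (?B - wa g F0 e1 (- e2) V0 s \<zeta>) (?a r \<zeta>) = 0" by (simp add: H_simps q)
  from H_zero_sym[OF q this] have 2: "H (F0 \<zeta>) (?a r \<zeta>) ?B = H (F0 \<zeta>) (?a r \<zeta>) (wa g F0 e1 (- e2) V0 s \<zeta>)"
    by (simp add: H_simps q)
  have "Dif (eta g G (0, e1) (0, e2) r s) (0, \<zeta>) (1, 0) = H (F0 \<zeta>) ?A (?b s \<zeta>) + H (F0 \<zeta>) (?a r \<zeta>) ?B"
    unfolding eta_def[abs_def] Dif_H[OF smooth_va smooth_va x]
    using va_slice[OF x, of e1 "- e2" s] by (simp add: va_slice[OF x])
  then show ?thesis by (simp add: 1 2 jac_def)
qed

end

text \<open>The identity serves as the change of target chart, so the invariance results already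
  cover maps that agree on \<open>U\<close>.\<close>

lemma kaehler_map_cong:
  assumes "kaehler_map g Q \<kappa> F U" "kaehler_map g Q \<kappa> F' U" "\<And>x. x \<in> U \<Longrightarrow> F' x = F x"
  shows "x \<in> U \<Longrightarrow> eta g F' e1 e2 r s x = eta g F e1 e2 r s x"
    and "smooth_on V U \<Longrightarrow> (\<And>x. x \<in> U \<Longrightarrow> W x = V x) \<Longrightarrow> x \<in> U \<Longrightarrow>
      jac g F' e1 e2 W r s x = jac g F e1 e2 V r s x"
proof -
  interpret M: kaehler_map g Q \<kappa> F U by fact
  interpret N: kaehler_map g Q \<kappa> F' U by fact
  interpret T: target_change_map g Q \<kappa> g Q \<kappa> "\<lambda>x. x" F F' U
    by unfold_locales (auto simp: assms(3) intro: smooth_on_ident M.open_Q)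
  show "x \<in> U \<Longrightarrow> eta g F' e1 e2 r s x = eta g F e1 e2 r s x" by (rule T.eta_push)
  show "smooth_on V U \<Longrightarrow> (\<And>x. x \<in> U \<Longrightarrow> W x = V x) \<Longrightarrow> x \<in> U \<Longrightarrow>
      jac g F' e1 e2 W r s x = jac g F e1 e2 V r s x"
    by (rule T.jac_push) auto
qed

section \<open>Conclusion for Jacobi fields and for variations\<close>

context jacobi_setup
begin

lemma kaehler_curve_local: "c \<in> S2_coords \<Longrightarrow> d \<in> A \<Longrightarrow> kaehler_curve (g d) (snd d ` fst d) \<kappa> (FF c d) (UU c d)"
  using kaehler_map_local by (simp add: kaehler_curve_def)

lemma etaC_zero:
  assumes "c \<in> S2_coords" "d \<in> A" "\<zeta> \<in> UU c d"
  shows "etaC g c d \<phi> r s \<zeta> = 0"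
  unfolding etaC_def Let_def kaehler_curve.herm_eta[OF kaehler_curve_local[OF assms(1,2)] assms(3)]
  by (simp add: harmonic_isotropic[OF assms])

lemma jC_zero:
  assumes "c \<in> S2_coords" "d \<in> A" "\<zeta> \<in> UU c d" "r \<ge> 1" "s \<ge> 1"
  shows "jC g c d \<phi> v r s \<zeta> = 0"
proof -
  obtain r' s' where rs: "r = Suc r'" "s = Suc s'" using assms(4,5) by (metis Suc_le_D One_nat_def)
  show ?thesis
    using kaehler_curve.herm_jac[OF kaehler_curve_local[OF assms(1,2)] smooth_VV[OF assms(1,2)] assms(3), of r' s']
      jacobi_isotropic[OF assms(1-3), of r' s']
    unfolding jC_def Let_def rs o_def by (simp del: funpow.simps)
qed

lemma variation_etaC:
  assumes var: "smooth_variation S2 S2_coords N A \<phi> I \<Phi>" and tan: "variation_tangent_to S2 A \<phi> \<Phi> v"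
    and c: "c \<in> S2_coords" and d: "d \<in> A" and \<zeta>: "\<zeta> \<in> UU c d"
  shows "((\<lambda>t. etaC g c d (\<Phi> t) r s \<zeta>) has_vector_derivative 0) (at 0)"
proof -
  define \<Omega> where "\<Omega> = (SIGMA t:I. loc_dom c d (\<Phi> t))"
  define G where "G = (\<lambda>(t, \<zeta>). loc c d (\<Phi> t) \<zeta>)"
  let ?W = "snd c ` fst c"
  have I: "open I" "0 \<in> I" and \<Phi>N: "\<And>t. t \<in> I \<Longrightarrow> \<Phi> t ` S2 \<subseteq> N"
    and cont: "continuous_on (I \<times> S2) (\<lambda>(t, x). \<Phi> t x)" and smooth_G: "smooth_on G \<Omega>"
    and \<Phi>0: "\<And>x. x \<in> S2 \<Longrightarrow> \<Phi> 0 x = \<phi> x"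
    using var c d unfolding smooth_variation_def G_def \<Omega>_def by blast+
  have chart: "chart_on S2 c" by (rule S2_coordsD(1)[OF c])
  have inv_S2: "chart_inv c \<xi> \<in> S2" if "\<xi> \<in> ?W" for \<xi>
    using chart_inv_in[OF chart that] chart_subset[OF chart] by blast
  have \<Omega>_iff: "(t, \<xi>) \<in> \<Omega> \<longleftrightarrow> t \<in> I \<and> \<xi> \<in> ?W \<and> \<Phi> t (chart_inv c \<xi>) \<in> fst d" for t \<xi>
    unfolding \<Omega>_def using loc_dom_iff[OF chart, of \<xi> d "\<Phi> t"] by blast
  \<comment> \<open>Joint continuity of the variation is what makes its coordinate domain open in
    time and space together.\<close>
  have open_\<Omega>: "open \<Omega>"
  proof -
    let ?f = "\<lambda>p. \<Phi> (fst p) (chart_inv c (snd p))"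
    have "continuous_on ?W (chart_inv c)" using chart_homeo[OF chart] by (simp add: homeomorphism_def)
    then have "continuous_on (I \<times> ?W) (\<lambda>p. (fst p, chart_inv c (snd p)))"
      by (intro continuous_on_Pair continuous_on_fst continuous_on_id continuous_on_compose2[of ?W "chart_inv c" "I \<times> ?W" snd]
          continuous_on_snd) auto
    then have "continuous_on (I \<times> ?W) ((\<lambda>(t, x). \<Phi> t x) \<circ> (\<lambda>p. (fst p, chart_inv c (snd p))))"
      by (rule continuous_on_compose[OF _ continuous_on_subset[OF cont]]) (use inv_S2 in auto)
    then have f: "continuous_on (I \<times> ?W) ?f" by (simp add: o_def)
    have "?f \<in> I \<times> ?W \<rightarrow> N" using \<Phi>N inv_S2 by fastforce
    from continuous_openin_preimage[OF f this openin_target[OF d]]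
    have "openin (top_of_set (I \<times> ?W)) (I \<times> ?W \<inter> ?f -` fst d)" .
    moreover have "open (I \<times> ?W)" using I(1) chart_open[OF chart] by (rule open_Times)
    ultimately have "open (I \<times> ?W \<inter> ?f -` fst d)" by (rule openin_open_trans)
    moreover have "I \<times> ?W \<inter> ?f -` fst d = \<Omega>" using \<Omega>_iff by auto
    ultimately show ?thesis by simp
  qed
  interpret K: kaehler_chart "g d" "snd d ` fst d" \<kappa> by (rule kaehler_chart_target[OF d])
  interpret M: map_family "g d" "snd d ` fst d" \<kappa> G \<Omega>
  proof
    show "open \<Omega>" by (rule open_\<Omega>)
    show "smooth_on G \<Omega>" by (rule smooth_G)
    show "G ` \<Omega> \<subseteq> snd d ` fst d"
    proof (rule image_subsetI)
      fix p assume "p \<in> \<Omega>"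
      then show "G p \<in> snd d ` fst d" using \<Omega>_iff[of "fst p" "snd p"] by (cases p) (simp add: G_def loc_def)
    qed
  qed
  have Gt: "(\<lambda>\<zeta>. G (t, \<zeta>)) = loc c d (\<Phi> t)" for t by (simp add: G_def)
  have slice0: "M.slice 0 = UU c d"
    unfolding set_eq_iff M.slice_def mem_Collect_eq \<Omega>_iff dom_iff[OF c] using I(2) \<Phi>0 inv_S2 by metis
  have F0: "kaehler_map (g d) (snd d ` fst d) \<kappa> M.F0 (UU c d)"
    using M.kaehler_curve_slice[of 0] by (simp add: kaehler_curve_def slice0)
  have F0_eq: "M.F0 x = FF c d x" if "x \<in> UU c d" for x
    using \<Phi>0[OF inv_S2[OF dom_image[OF c that]]] by (simp add: G_def loc_def)
  have iso: "eta (g d) M.F0 1 \<i> i k x = 0" if "x \<in> M.slice 0" for i k x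
  proof -
    have x: "x \<in> UU c d" using that by (simp add: slice0)
    show ?thesis
      by (rule trans[OF kaehler_map_cong(1)[OF kaehler_map_local[OF c d] F0 _ x] harmonic_isotropic[OF c d x]])
         (rule F0_eq)
  qed
  have V0: "M.V0 x = VV c d x" if "x \<in> UU c d" for x
  proof -
    have x: "(0, x) \<in> \<Omega>" using that slice0 by (auto simp: M.slice_def)
    have "((\<lambda>t. (t, x)) has_derivative (\<lambda>t. (t, 0))) (at (0::real))"
      by (auto intro!: derivative_eq_intros)
    from has_derivative_compose[OF this smooth_on_Dif_works[OF smooth_G open_\<Omega> x]]
    have "((\<lambda>t. G (t, x)) has_derivative (\<lambda>t. Dif G (0, x) (t, 0))) (at 0)" .
    moreover have "Dif G (0, x) (t, 0) = t *\<^sub>R M.V0 x" for t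
      using linear_cmul[OF Dif_linear[OF M.diff_F[OF x]], of t "(1, 0)"] by simp
    then have "(\<lambda>t. Dif G (0, x) (t, 0)) = (\<lambda>t. t *\<^sub>R M.V0 x)" by (rule ext)
    ultimately have 1: "((\<lambda>t. G (t, x)) has_vector_derivative M.V0 x) (at 0)"
      unfolding has_vector_derivative_def by (simp only:)
    have "chart_inv c x \<in> S2" "\<phi> (chart_inv c x) \<in> fst d"
      using that inv_S2[OF dom_image[OF c that]] dom_iff[OF c] by blast+
    then have "((\<lambda>t. snd d (\<Phi> t (chart_inv c x))) has_vector_derivative v d (chart_inv c x)) (at 0)"
      using tan d unfolding variation_tangent_to_def by blast
    then have "((\<lambda>t. G (t, x)) has_vector_derivative v d (chart_inv c x)) (at 0)"
      by (simp add: G_def loc_def)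
    with 1 show ?thesis using vector_derivative_unique_at by (metis o_apply)
  qed
  have \<zeta>0: "(0, \<zeta>) \<in> \<Omega>" using \<zeta> slice0 by (auto simp: M.slice_def)
  \<comment> \<open>\<open>etaC\<close> counts orders from 1 and \<open>eta\<close> from 0, hence
    the shift; the factor 1/2 between them is restored below.\<close>
  define f where "f = eta (g d) G (0, 1) (0, \<i>) (r - 1) (s - 1)"
  have f: "smooth_on f \<Omega>" unfolding f_def by (rule M.smooth_eta)
  have "Dif f (0, \<zeta>) (1, 0) = jac (g d) M.F0 1 \<i> M.V0 (r - 1) (s - 1) \<zeta>"
    unfolding f_def by (rule M.Dif_eta_t[OF iso]) (use \<zeta> slice0 in simp_all)
  also have "\<dots> = 0"
    by (rule trans[OF kaehler_map_cong(2)[OF kaehler_map_local[OF c d] F0 _ smooth_VV[OF c d] _ \<zeta>]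
          jacobi_isotropic[OF c d \<zeta>]]) (rule F0_eq V0, assumption)+
  finally have Df: "Dif f (0, \<zeta>) (1, 0) = 0" .
  have "((\<lambda>t. (t, \<zeta>)) has_derivative (\<lambda>t. (t, 0))) (at (0::real))"
    by (auto intro!: derivative_eq_intros)
  from has_derivative_compose[OF this smooth_on_Dif_works[OF f open_\<Omega> \<zeta>0]]
  have "((\<lambda>t. f (t, \<zeta>)) has_derivative (\<lambda>t. Dif f (0, \<zeta>) (t, 0))) (at 0)" .
  moreover have "Dif f (0, \<zeta>) (t, 0) = t *\<^sub>R 0" for t
    using linear_cmul[OF Dif_linear[OF smooth_on_differentiable[OF f open_\<Omega> \<zeta>0]], of t "(1, 0)"] Df by simp
  ultimately have "((\<lambda>t. f (t, \<zeta>)) has_vector_derivative 0) (at 0)"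
    by (simp add: has_vector_derivative_def)
  then have 2: "((\<lambda>t. f (t, \<zeta>) / 2) has_vector_derivative 0 / 2) (at 0)"
    by (rule bounded_linear.has_vector_derivative[OF bounded_linear_divide])
  \<comment> \<open>The coordinate domain moves with t, so the identification with
    \<open>etaC\<close> is made only for times at which \<zeta> stays inside it; these form a
    neighbourhood of 0.\<close>
  have "open ((\<lambda>t. (t, \<zeta>)) -` \<Omega>)" by (intro open_vimage open_\<Omega> continuous_intros)
  moreover have "f (t, \<zeta>) / 2 = etaC g c d (\<Phi> t) r s \<zeta>" if "t \<in> (\<lambda>t. (t, \<zeta>)) -` \<Omega>" for t
  proof -
    have t: "(t, \<zeta>) \<in> \<Omega>" using that by simp
    then have "\<zeta> \<in> M.slice t" by (simp add: M.slice_def)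
    from kaehler_curve.herm_eta[OF M.kaehler_curve_slice this, of "r - 1" "s - 1"]
    show ?thesis
      unfolding etaC_def Let_def f_def Gt M.eta_slice[OF t, unfolded Gt] fun_cong[OF Gt] by simp
  qed
  ultimately show ?thesis
    using has_vector_derivative_transform_within_open[OF 2] \<zeta>0 by fastforce
qed

end

theorem proposition4p4:
  fixes N :: "'p::t2_space set"
    and A :: "('p, complex^'n) chart set"
    and g :: "('p, complex^'n) metric"
    and h :: "(real^3, complex) metric"
    and \<phi> :: "real^3 \<Rightarrow> 'p"
    and v :: "('p, complex^'n) chart \<Rightarrow> real^3 \<Rightarrow> complex^'n"
  assumes "compact N" and "complex_space_form N A g"
    and "hermitian_metric ((*) \<i>) S2_coords h"
    and "harmonic_map S2 S2_coords h N A g \<phi>"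
    and "jacobi_field S2 S2_coords h A g \<phi> v"
  shows "preserves_complex_isotropy S2_coords A g \<phi> v \<and>
    (\<forall>I \<Phi>. smooth_variation S2 S2_coords N A \<phi> I \<Phi> \<and> variation_tangent_to S2 A \<phi> \<Phi> v \<longrightarrow>
       complex_isotropic_to_first_order S2_coords A g \<phi> \<Phi>)"
proof -
  from assms(2) obtain \<kappa> where k: "kaehler_manifold N A g"
    "\<forall>d\<in>A. \<forall>q \<in> snd d ` fst d. \<forall>X. X \<noteq> 0 \<longrightarrow> sec_curv (g d) q X (JC X) = \<kappa>"
    unfolding complex_space_form_def by blast
  interpret jacobi_setup N A g h \<phi> v \<kappa>
    using k assms(3-5) by unfold_locales blast+
  show ?thesis
    unfolding preserves_complex_isotropy_def complex_isotropic_to_first_order_def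
    using jC_zero etaC_zero variation_etaC by blast
qed

end
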